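(* Let $X_{EW}$ be the Eierlegende Wollmilchsau origami. Then for any direction $\theta$ with $\tan\theta$ irrational and Lebesgue almost any $p,p'$ in $X_{EW}$ we have $$\overline{w}_{\mathrm{hit}}(\phi_\theta,p,p')=w(\tan\theta).$$
   Context: Let $\mathcal{Q}=\{\pm1,\pm i,\pm j,\pm k\}$ be the quaternion group ($i^2=j^2=k^2=-1$, $ij=k$). $X_{EW}$ is the translation surface obtained from eight unit squares $Q_g=\{g\}\times[0,1]^2$, $g\in\mathcal{Q}$, by gluing via translations, for every $g\in\mathcal{Q}$, the right side of $Q_g$ to the left side of $Q_{g\cdot i}$ and the top side of $Q_g$ to the bottom side of $Q_{g\cdot j}$. (It has genus $3$ and four conical singularities of angle $4\pi$.) $\phi_\theta$ is the unit speed flow on $X_{EW}$ in direction $(\sin\theta,\cos\theta)$ ($\theta=0$ vertical). For irrational $\alpha$, $w(\alpha)\in[1,+\infty]$ is the supremum of $w\ge1$ such that $|\alpha-p/q|<q^{-(w+1)}$ for infinitely many rationals $p/q$. $\overline{w}_{\mathrm{hit}}(\phi_\theta,p,p')=\limsup_{r\to0^+}\frac{\log R(\phi_\theta,p,p',r)}{-\log r}$ with $R(\phi_\theta,p,p',r)=\inf\{t>r:\mathrm{Dist}(\phi^t_\theta(p),p')<r\}$, $\mathrm{Dist}$ being the flat distance. *)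

theory Defs
  imports "HOL-Analysis.Analysis"
begin

section \<open>The quaternion group\<close>

datatype quat_unit = U1 | Ui | Uj | Uk

datatype quat = Pos quat_unit | Neg quat_unit

fun quat_neg :: "quat \<Rightarrow> quat" where
  "quat_neg (Pos a) = Neg a"
| "quat_neg (Neg a) = Pos a"

fun unit_mult :: "quat_unit \<Rightarrow> quat_unit \<Rightarrow> quat" where
  "unit_mult U1 b = Pos b"
| "unit_mult a U1 = Pos a"
| "unit_mult Ui Ui = Neg U1"
| "unit_mult Ui Uj = Pos Uk"
| "unit_mult Ui Uk = Neg Uj"
| "unit_mult Uj Ui = Neg Uk"
| "unit_mult Uj Uj = Neg U1"
| "unit_mult Uj Uk = Pos Ui"
| "unit_mult Uk Ui = Pos Uj"
| "unit_mult Uk Uj = Neg Ui"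
| "unit_mult Uk Uk = Neg U1"

fun quat_mult :: "quat \<Rightarrow> quat \<Rightarrow> quat" where
  "quat_mult (Pos a) (Pos b) = unit_mult a b"
| "quat_mult (Pos a) (Neg b) = quat_neg (unit_mult a b)"
| "quat_mult (Neg a) (Pos b) = quat_neg (unit_mult a b)"
| "quat_mult (Neg a) (Neg b) = unit_mult a b"

lemma quat_neg_neg [simp]: "quat_neg (quat_neg x) = x"
  by (cases x) auto

lemma quat_mult_neg [simp]:
  "quat_mult (quat_neg x) y = quat_neg (quat_mult x y)"
  "quat_mult x (quat_neg y) = quat_neg (quat_mult x y)"
  by (cases x; cases y; simp)+

instantiation quat :: "{monoid_mult, uminus}"
begin

definition "(1 :: quat) = Pos U1"
definition "(x :: quat) * y = quat_mult x y"
definition "- (x :: quat) = quat_neg x"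

instance
proof
  fix x y z :: quat
  have *: "quat_mult (unit_mult a b) (Pos c) = quat_mult (Pos a) (unit_mult b c)" for a b c
    by (cases a; cases b; cases c; simp)
  have **: "Neg a = quat_neg (Pos a)" for a
    by simp
  show "x * y * z = x * (y * z)"
    unfolding times_quat_def
    by (cases x; cases y; cases z) (simp_all only: ** quat_mult_neg quat_mult.simps(1) * )
  show "1 * x = x" "x * 1 = x"
    unfolding times_quat_def one_quat_def
    by (cases x; simp; rename_tac a; case_tac a; simp)+
qed

end

definition qi :: quat where "qi = Pos Ui"
definition qj :: quat where "qj = Pos Uj"
definition qk :: quat where "qk = Pos Uk"

lemma quat_relations:
  "qi * qi = - 1" "qj * qj = - 1" "qk * qk = - 1" "qi * qj = qk"
  "- (- x) = (x :: quat)" "(- x) * y = - (x * y :: quat)" "x * (- y) = - (x * y :: quat)"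
  by (simp_all add: qi_def qj_def qk_def times_quat_def uminus_quat_def one_quat_def)

lemma UNIV_quat: "(UNIV :: quat set) = {1, - 1, qi, - qi, qj, - qj, qk, - qk}"
proof -
  have "x \<in> {1, - 1, qi, - qi, qj, - qj, qk, - qk}" for x :: quat
    by (cases x; rename_tac a; case_tac a;
        simp add: qi_def qj_def qk_def uminus_quat_def one_quat_def)
  thus ?thesis by blast
qed

lemma card_quat: "card (UNIV :: quat set) = 8"
  unfolding UNIV_quat by (simp add: qi_def qj_def qk_def uminus_quat_def one_quat_def)

instance quat :: finite
  by standard (simp add: UNIV_quat)

section \<open>The Eierlegende Wollmilchsau\<close>

definition squares :: "(quat \<times> real \<times> real) set" where
  "squares = UNIV \<times> {0..1} \<times> {0..1}"

inductive_set glue :: "((quat \<times> real \<times> real) \<times> (quat \<times> real \<times> real)) set" where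
  right: "0 \<le> y \<Longrightarrow> y \<le> 1 \<Longrightarrow> ((g, 1, y), (g * qi, 0, y)) \<in> glue"
| top: "0 \<le> x \<Longrightarrow> x \<le> 1 \<Longrightarrow> ((g, x, 1), (g * qj, x, 0)) \<in> glue"

definition EW_rel :: "((quat \<times> real \<times> real) \<times> (quat \<times> real \<times> real)) set" where
  "EW_rel = (glue \<union> glue\<inverse>)\<^sup>* \<inter> squares \<times> squares"

lemma equiv_EW_rel: "equiv squares EW_rel"
proof (rule equivI)
  show "refl_on squares EW_rel"
    by (auto simp: EW_rel_def refl_on_def)
  have "sym ((glue \<union> glue\<inverse>)\<^sup>*)"
    by (intro sym_rtrancl sym_Un_converse)
  thus "sym EW_rel"
    by (auto simp: EW_rel_def sym_def)
  show "trans EW_rel"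
    by (auto simp: EW_rel_def trans_def intro: rtrancl_trans)
qed (auto simp: EW_rel_def)

type_synonym EW_point = "(quat \<times> real \<times> real) set"

definition EW :: "EW_point set" where
  "EW = squares // EW_rel"

definition EW_proj :: "quat \<times> real \<times> real \<Rightarrow> EW_point" where
  "EW_proj a = EW_rel `` {a}"

lemma EW_proj_in_EW [intro]: "a \<in> squares \<Longrightarrow> EW_proj a \<in> EW"
  unfolding EW_proj_def EW_def by (rule quotientI)

text \<open>
  Every corner of a square is a cone point: turning once around a corner multiplies the label
  by a conjugate of the commutator of \<open>i\<close> and \<open>j\<close>, which is \<open>-1\<close>, so two turns are needed
  to close up.
\<close>

definition EW_singular :: "EW_point set" where
  "EW_singular = EW_proj ` (UNIV \<times> {0, 1} \<times> {0, 1})"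

text \<open>
  Lebesgue measure on the quotient: the push-forward of the sum of the Lebesgue measures of the
  squares, on the largest sigma-algebra making the projection measurable.
\<close>

definition squares_measure :: "(quat \<times> real \<times> real) measure" where
  "squares_measure = count_space UNIV \<Otimes>\<^sub>M restrict_space lborel ({0..1} \<times> {0..1})"

definition EW_measure :: "EW_point measure" where
  "EW_measure = distr squares_measure
     (sigma EW {A \<in> Pow EW. EW_proj -` A \<inter> squares \<in> sets squares_measure}) EW_proj"

lemma space_squares_measure: "space squares_measure = squares"
  by (simp add: squares_measure_def squares_def space_pair_measure space_restrict_space)

lemma EW_sigma_algebra:
  "sigma_algebra EW {A \<in> Pow EW. EW_proj -` A \<inter> squares \<in> sets squares_measure}"
proof (rule sigma_algebra_iff2[THEN iffD2], intro conjI ballI allI impI)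
  fix A assume "A \<in> {A \<in> Pow EW. EW_proj -` A \<inter> squares \<in> sets squares_measure}"
  hence A: "EW_proj -` A \<inter> squares \<in> sets squares_measure" by simp
  have "EW_proj -` (EW - A) \<inter> squares = space squares_measure - (EW_proj -` A \<inter> squares)"
    by (auto simp: space_squares_measure)
  thus "EW - A \<in> {A \<in> Pow EW. EW_proj -` A \<inter> squares \<in> sets squares_measure}"
    using A by auto
next
  fix A :: "nat \<Rightarrow> EW_point set"
  assume A: "range A \<subseteq> {A \<in> Pow EW. EW_proj -` A \<inter> squares \<in> sets squares_measure}"
  have "EW_proj -` (\<Union>i. A i) \<inter> squares = (\<Union>i. EW_proj -` A i \<inter> squares)"
    by auto
  moreover have "\<dots> \<in> sets squares_measure"
    using A by (intro sets.countable_UN) auto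
  ultimately show "(\<Union>i. A i) \<in> {A \<in> Pow EW. EW_proj -` A \<inter> squares \<in> sets squares_measure}"
    using A by auto
qed auto

lemma space_EW_measure: "space EW_measure = EW"
  by (simp add: EW_measure_def space_measure_of_conv)

lemma sets_EW_measure:
  "sets EW_measure = {A \<in> Pow EW. EW_proj -` A \<inter> squares \<in> sets squares_measure}"
  unfolding EW_measure_def sets_distr
  by (rule sigma_algebra.sets_measure_of_eq[OF EW_sigma_algebra])

lemma emeasure_EW_measure:
  assumes "A \<in> sets EW_measure"
  shows "emeasure EW_measure A = emeasure squares_measure (EW_proj -` A \<inter> squares)"
proof -
  let ?N = "sigma EW {A \<in> Pow EW. EW_proj -` A \<inter> squares \<in> sets squares_measure}"
  have sets: "sets ?N = {A \<in> Pow EW. EW_proj -` A \<inter> squares \<in> sets squares_measure}"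
    by (rule sigma_algebra.sets_measure_of_eq[OF EW_sigma_algebra])
  have "EW_proj \<in> measurable squares_measure ?N"
    unfolding measurable_def sets
    by (auto simp: space_squares_measure space_measure_of_conv)
  moreover have "A \<in> sets ?N"
    using assms by (simp add: EW_measure_def)
  ultimately show ?thesis
    unfolding EW_measure_def by (simp add: emeasure_distr space_squares_measure)
qed

lemma emeasure_EW: "emeasure EW_measure EW = 8"
proof -
  let ?L = "restrict_space lborel ({0..1} \<times> {0..1}) :: (real \<times> real) measure"
  let ?S = "{0..1} \<times> {0..1} :: (real \<times> real) set"
  have meas: "?S \<in> sets lborel"
    unfolding sets_lborel by (intro borel_closed closed_Times) auto
  have L: "emeasure lborel ?S = 1"
    unfolding lborel_prod[symmetric] by (subst lborel.emeasure_pair_measure_Times) auto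
  have S: "emeasure ?L ?S = 1"
    using meas L by (subst emeasure_restrict_space) auto
  interpret L: finite_measure ?L
    using S by (intro finite_measureI) (simp add: space_restrict_space)
  have "EW_proj -` EW \<inter> squares = UNIV \<times> ?S"
    unfolding squares_def[symmetric] by auto
  moreover have "emeasure squares_measure (UNIV \<times> ?S) = 8"
    unfolding squares_measure_def using S meas
    by (subst L.emeasure_pair_measure_Times)
       (auto simp: sets_restrict_space emeasure_count_space card_quat)
  moreover have "EW \<in> sets EW_measure"
    using sets.top[of EW_measure] by (simp add: space_EW_measure)
  ultimately show ?thesis by (simp add: emeasure_EW_measure)
qed

text \<open>
  The flat distance is the infimum of the lengths of broken lines; each segment of a broken line
  lies in one closed square, and \<^term>\<open>dist\<close> on \<^typ>\<open>real \<times> real\<close> is Euclidean.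
\<close>

inductive EW_broken_line :: "EW_point \<Rightarrow> EW_point \<Rightarrow> real \<Rightarrow> bool" where
  refl: "p \<in> EW \<Longrightarrow> EW_broken_line p p 0"
| segment: "(g, z) \<in> squares \<Longrightarrow> (g, z') \<in> squares \<Longrightarrow> EW_broken_line (EW_proj (g, z')) q l
    \<Longrightarrow> EW_broken_line (EW_proj (g, z)) q (dist z z' + l)"

definition EW_dist :: "EW_point \<Rightarrow> EW_point \<Rightarrow> real" where
  "EW_dist p q = Inf {l. EW_broken_line p q l}"

text \<open>
  \<open>EW_flow \<theta> t p q\<close> says that the flow in direction \<open>\<theta>\<close> is defined at \<open>p\<close> up to the time
  \<open>t \<ge> 0\<close> and takes \<open>p\<close> to \<open>q\<close>. The flow is only partially defined, as no orbit continues
  through a cone point: an orbit is a concatenation of straight segments, each in one closed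
  square, that avoids the cone points. A corner can lie on a segment only as an endpoint, so it
  is enough to exclude it there.
\<close>

inductive EW_flow :: "real \<Rightarrow> real \<Rightarrow> EW_point \<Rightarrow> EW_point \<Rightarrow> bool" for \<theta> :: real where
  start: "p \<in> EW - EW_singular \<Longrightarrow> EW_flow \<theta> 0 p p"
| segment: "0 \<le> s \<Longrightarrow> (g, z) \<in> squares \<Longrightarrow> (g, z + s *\<^sub>R (sin \<theta>, cos \<theta>)) \<in> squares
    \<Longrightarrow> EW_proj (g, z) \<notin> EW_singular
    \<Longrightarrow> EW_flow \<theta> t (EW_proj (g, z + s *\<^sub>R (sin \<theta>, cos \<theta>))) q
    \<Longrightarrow> EW_flow \<theta> (s + t) (EW_proj (g, z)) q"

section \<open>Hitting times and Diophantine type\<close>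

text \<open>The infimum of the empty set is \<^term>\<open>\<infinity> :: ereal\<close>: the orbit does not hit the ball.\<close>

definition hitting_time :: "real \<Rightarrow> EW_point \<Rightarrow> EW_point \<Rightarrow> real \<Rightarrow> ereal" where
  "hitting_time \<theta> p p' r = Inf {ereal t |t. t > r \<and> (\<exists>q. EW_flow \<theta> t p q \<and> EW_dist q p' < r)}"

definition log_ereal :: "ereal \<Rightarrow> ereal" where
  "log_ereal x = (if x = \<infinity> then \<infinity> else ereal (ln (real_of_ereal x)))"

definition w_hit_sup :: "real \<Rightarrow> EW_point \<Rightarrow> EW_point \<Rightarrow> ereal" where
  "w_hit_sup \<theta> p p' =
     Limsup (at_right 0) (\<lambda>r. log_ereal (hitting_time \<theta> p p' r) / ereal (- ln r))"

definition diophantine_type :: "real \<Rightarrow> ereal" where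
  "diophantine_type \<alpha> = Sup {ereal w |w. w \<ge> 1 \<and>
     infinite {(a :: int, b :: int). b > 0 \<and> coprime a b \<and>
       \<bar>\<alpha> - of_int a / of_int b\<bar> < of_int b powr - (w + 1)}}"

end

theory Submission
  imports Defs "HOL-Real_Asymp.Real_Asymp" "HOL-Analysis.Kronecker_Approximation_Theorem"
begin

text \<open>
  Cut the surface along the horizontal edges of its squares. Put \<open>\<alpha> = \<bar>tan \<theta>\<bar>\<close>. A flow line that leaves
  the bottom edge of the square \<open>g\<close> at position \<open>x\<close> climbs through one unit of height in time
  \<open>1 / \<bar>cos \<theta>\<bar>\<close>; on its way it crosses \<open>\<lfloor>x + \<alpha>\<rfloor>\<close> vertical edges and then one horizontal edge. So the first
  return to the bottom edges is the skew product
  \<open>(g, x) \<mapsto> (g X\<^bsup>\<lfloor>x + \<alpha>\<rfloor>\<^esup> Y, frac (x + \<alpha>))\<close> over a rotation, with \<open>X = \<plusminus> i\<close> and \<open>Y = \<plusminus> j\<close>.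

  Lower bound. The surface covers the unit torus and the covering does not increase distances, so a hit
  on the surface is a hit on the torus. If \<open>\<bar>q \<beta> - p\<bar> < q\<^bsup>-w\<^esup>\<close> for \<open>\<beta> = tan \<theta>\<close>, then, up to time \<open>q\<^bsup>w-e\<^esup>\<close>,
  the \<open>q\<^bsup>-1-e\<^esup>\<close>-neighbourhood of a flow line on the torus lies in a number of strips of order \<open>q\<close> whose total
  area tends to \<open>0\<close> as \<open>q\<close> grows (\<open>rare_scale\<close>). Hence almost every \<open>p'\<close> is missed at infinitely many of these scales, and the
  upper limit is at least \<open>(w - e) / (1 + e)\<close>.

  Upper bound. Here the difficulty is to reach the right one of the eight squares above a point of the
  torus. Rauzy induction presents the rotation by two towers over an interval \<open>[0, a + b)\<close>; passing
  through a tower multiplies the label by \<open>A\<close> or by \<open>B\<close>, and \<open>A, B\<close> remain a pair of generators of the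
  quaternion group. Let \<open>x > y\<close> be the two lengths.
  \<^item> If \<open>x \<ge> 4 y\<close>, an orbit sweeps through the longer interval in steps of length \<open>y\<close>, and each step
    multiplies the label by the same generator, which has order \<open>4\<close>. So one sweep comes near every
    point with each label of one coset of a subgroup of index \<open>2\<close>, and the next sweep does the same for
    the other coset. This takes time of order \<open>1 / y\<close> (\<open>long_run_hits\<close>).
  \<^item> If \<open>x < 4 y\<close>, pass to the next stage of the continued fraction algorithm; its longer
    length \<open>y\<close> is comparable to \<open>x\<close>. When seven consecutive quotients are less than \<open>4\<close>, only finitely many words in \<open>A\<close>
    and \<open>B\<close> are possible, and a computation shows that both towers visit all eight labels
    (\<open>covering_right\<close>, \<open>covering_left\<close>).

  Start this at the stage with \<open>x > \<rho> \<ge> y\<close>. If \<open>w\<close> exceeds the Diophantine type, every stage has \<open>y \<ge> c x\<^bsup>w\<^esup>\<close>,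
  so both cases give hits at distance of order \<open>\<rho>\<close> within time of order \<open>\<rho>\<^bsup>-w\<^esup>\<close> (\<open>hits_at_all_scales\<close>). The
  estimate holds for every starting point whose flow line avoids the corners and for every target in
  the interior of a square.
\<close>

section \<open>Pairs of generators of the quaternion group\<close>

lemmas quat_arith = times_quat_def one_quat_def uminus_quat_def qi_def qj_def qk_def

text \<open>
  These relations single out the \<open>24\<close> pairs that generate the quaternion group; they are the images of
  \<open>(i, j)\<close> under automorphisms.
\<close>

definition gen_pair :: "quat \<Rightarrow> quat \<Rightarrow> bool" where
  "gen_pair A B \<longleftrightarrow> A * A = - 1 \<and> B * B = - 1 \<and> B * A = - (A * B)"

lemma all_quat_iff: "(\<forall>x :: quat. P x) \<longleftrightarrow> P (Pos U1) \<and> P (Neg U1) \<and> P (Pos Ui) \<and> P (Neg Ui)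
    \<and> P (Pos Uj) \<and> P (Neg Uj) \<and> P (Pos Uk) \<and> P (Neg Uk)"
proof (intro iffI allI)
  fix x assume "P (Pos U1) \<and> P (Neg U1) \<and> P (Pos Ui) \<and> P (Neg Ui)
    \<and> P (Pos Uj) \<and> P (Neg Uj) \<and> P (Pos Uk) \<and> P (Neg Uk)"
  thus "P x" by (cases x; rename_tac u; case_tac u) auto
qed auto

lemma quat_pow4: "x * (x * (x * x)) = (1 :: quat)"
proof -
  have "\<forall>x :: quat. x * (x * (x * x)) = 1"
    unfolding all_quat_iff by (simp add: quat_arith)
  thus ?thesis by blast
qed

lemma quat_pow_mod: "(x :: quat) ^ n = x ^ (n mod 4)"
proof -
  have four: "x ^ 4 = 1"
    by (simp only: numeral_eq_Suc pred_numeral_simps BitM.simps power_Suc power_0 mult_1_right quat_pow4)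
  have "x ^ n = x ^ (4 * (n div 4) + n mod 4)" by (simp only: mult_div_mod_eq)
  also have "\<dots> = x ^ (n mod 4)" by (simp only: power_add power_mult four power_one mult_1)
  finally show ?thesis .
qed

lemma quat_minus_minus [simp]: "- (- x) = (x :: quat)" by (simp add: quat_relations)
lemma quat_minus_mult [simp]: "(- x) * y = - (x * y :: quat)" "x * (- y) = - (x * y :: quat)"
  by (simp_all add: quat_relations)

lemma quat_divide: "\<exists>k. h = g * (k :: quat)" "\<exists>k. h = k * (g :: quat)"
proof -
  show "\<exists>k. h = g * k" by (rule exI[of _ "g * (g * (g * h))"]) (metis mult.assoc mult_1 quat_pow4)
  show "\<exists>k. h = k * g" by (rule exI[of _ "h * (g * (g * g))"]) (metis mult.assoc mult_1_right quat_pow4)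
qed

lemma gen_pair_simps:
  assumes "gen_pair A B"
  shows "A * A = - 1" "B * B = - 1" "B * A = - (A * B)"
    "A * (A * z) = - z" "B * (B * z) = - z" "B * (A * z) = - (A * (B * z))"
  using assms unfolding gen_pair_def
  by (simp_all add: mult.assoc[symmetric])

lemma gen_pair_step:
  assumes "gen_pair A B" shows "gen_pair A (A * B)" "gen_pair (A * B) B"
  using gen_pair_simps[OF assms] by (simp_all add: gen_pair_def mult.assoc)

lemma gen_pair_swap: "gen_pair A B \<Longrightarrow> gen_pair B A"
  unfolding gen_pair_def by (metis quat_minus_minus)

text \<open>
  For a pair of generators, the automorphism that takes \<open>(i, j)\<close> to \<open>(A, B)\<close>. It reduces statements about words in an arbitrary
  pair of generators to words in \<open>i\<close> and \<open>j\<close>.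
\<close>

fun quat_hom :: "quat \<Rightarrow> quat \<Rightarrow> quat \<Rightarrow> quat" where
  "quat_hom A B (Pos U1) = 1"
| "quat_hom A B (Pos Ui) = A"
| "quat_hom A B (Pos Uj) = B"
| "quat_hom A B (Pos Uk) = A * B"
| "quat_hom A B (Neg U1) = - 1"
| "quat_hom A B (Neg Ui) = - A"
| "quat_hom A B (Neg Uj) = - B"
| "quat_hom A B (Neg Uk) = - (A * B)"

lemma quat_hom_mult:
  assumes "gen_pair A B"
  shows "quat_hom A B (x * y) = quat_hom A B x * quat_hom A B y"
proof -
  note s = gen_pair_simps[OF assms]
  have neg: "quat_hom A B (- x) = - quat_hom A B x" for x
    by (cases x; rename_tac u; case_tac u) (auto simp: uminus_quat_def[of "Pos _"] uminus_quat_def[of "Neg _"])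
  have "quat_hom A B (unit_mult u v) = quat_hom A B (Pos u) * quat_hom A B (Pos v)" for u v
    by (cases u; cases v; simp add: s mult.assoc)
  hence pos: "quat_hom A B (Pos u * Pos v) = quat_hom A B (Pos u) * quat_hom A B (Pos v)" for u v
    by (simp add: times_quat_def[of "Pos u" "Pos v"])
  have "Neg u = - Pos u" for u by (simp add: uminus_quat_def)
  thus ?thesis by (cases x; cases y) (simp_all add: neg pos del: quat_hom.simps)
qed

lemma quat_hom_surj:
  assumes "gen_pair A B"
  shows "\<exists>x. quat_hom A B x = y"
proof -
  have "\<forall>A B. gen_pair A B \<longrightarrow> (\<forall>y. y \<in> {1, A, B, A * B, - 1, - A, - B, - (A * B)})"
    unfolding all_quat_iff gen_pair_def by (simp add: quat_arith)
  hence "y \<in> {1, A, B, A * B, - 1, - A, - B, - (A * B)}" using assms by blast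
  moreover have "{1, A, B, A * B, - 1, - A, - B, - (A * B)} \<subseteq> range (quat_hom A B)"
  proof -
    have "(1::quat) = quat_hom A B (Pos U1)" "A = quat_hom A B (Pos Ui)" "B = quat_hom A B (Pos Uj)"
      "A * B = quat_hom A B (Pos Uk)" "(- 1::quat) = quat_hom A B (Neg U1)" "- A = quat_hom A B (Neg Ui)"
      "- B = quat_hom A B (Neg Uj)" "- (A * B) = quat_hom A B (Neg Uk)" by simp_all
    thus ?thesis by (metis (no_types, lifting) empty_subsetI insert_subset rangeI)
  qed
  ultimately show ?thesis by (metis (no_types, lifting) subsetD rangeE)
qed

text \<open>
  The powers of \<open>A\<close> form a subgroup of index \<open>2\<close>, and \<open>B\<close> lies outside it.
\<close>

lemma two_cosets:
  assumes "gen_pair A B"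
  shows "(\<exists>j. h = g * A ^ j) \<or> (\<exists>j. h = g * A ^ l * B * A ^ j)"
proof -
  note s = gen_pair_simps[OF assms]
  obtain k where k: "h = g * k" using quat_divide by blast
  obtain x where x: "k = quat_hom A B x" using quat_hom_surj[OF assms] by metis
  have P: "A ^ 0 = 1" "A ^ 1 = A" "A ^ 2 = -1" "A ^ 3 = - A"
    by (simp_all add: eval_nat_numeral s)
  have "(\<exists>j. k = A ^ j) \<or> (\<exists>j. k = A ^ (l mod 4) * B * A ^ j)"
  proof -
    have "l mod 4 = 0 \<or> l mod 4 = 1 \<or> l mod 4 = 2 \<or> l mod 4 = 3" by auto
    moreover have "\<forall>x. (\<exists>j\<in>{0,1,2,3}. quat_hom A B x = A ^ j) \<or>
       (\<exists>j\<in>{0,1,2,3}. quat_hom A B x = A ^ 0 * B * A ^ j) "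
      unfolding all_quat_iff by (simp add: s eval_nat_numeral mult.assoc)
    moreover have "\<forall>x. (\<exists>j\<in>{0,1,2,3}. quat_hom A B x = A ^ j) \<or>
       (\<exists>j\<in>{0,1,2,3}. quat_hom A B x = A ^ 1 * B * A ^ j) "
      unfolding all_quat_iff by (simp add: s eval_nat_numeral mult.assoc)
    moreover have "\<forall>x. (\<exists>j\<in>{0,1,2,3}. quat_hom A B x = A ^ j) \<or>
       (\<exists>j\<in>{0,1,2,3}. quat_hom A B x = A ^ 2 * B * A ^ j) "
      unfolding all_quat_iff by (simp add: s eval_nat_numeral mult.assoc)
    moreover have "\<forall>x. (\<exists>j\<in>{0,1,2,3}. quat_hom A B x = A ^ j) \<or>
       (\<exists>j\<in>{0,1,2,3}. quat_hom A B x = A ^ 3 * B * A ^ j) "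
      unfolding all_quat_iff by (simp add: s eval_nat_numeral mult.assoc)
    ultimately show ?thesis unfolding x by metis
  qed
  thus ?thesis unfolding k using quat_pow_mod[of A l] by (auto simp: mult.assoc)
qed

section \<open>Words with small quotients visit every label\<close>

text \<open>
  Bookkeeping for \<open>m\<close> equal steps of Rauzy induction. \<open>A\<close> and \<open>B\<close> are the labels collected along the left and
  the right tower; \<open>U\<close> and \<open>V\<close> list the labels, relative to the base, with which these towers meet some
  fixed target. In \<open>run_on_right\<close> each step puts the right tower on top of a copy of the left one, in
  \<open>run_on_left\<close> it puts the right tower on top of the left one.
\<close>

fun run_on_right :: "nat \<Rightarrow> quat \<Rightarrow> quat \<Rightarrow> quat list \<Rightarrow> quat list \<Rightarrow> quat \<times> quat list" where
  "run_on_right 0 A B U V = (B, V)"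
| "run_on_right (Suc m) A B U V = (let (B', V') = run_on_right m A B U V in (A * B', List.union U (map ((*) A) V')))"

fun run_on_left :: "nat \<Rightarrow> quat \<Rightarrow> quat \<Rightarrow> quat list \<Rightarrow> quat list \<Rightarrow> quat \<times> quat list" where
  "run_on_left 0 A B U V = (A, U)"
| "run_on_left (Suc m) A B U V = (let (A', U') = run_on_left m A B U V in (A' * B, List.union U' (map ((*) A') V)))"

text \<open>
  \<open>covering k r\<close>: whichever quotients \<open>1\<close>, \<open>2\<close>, \<open>3\<close> occur in the next \<open>k\<close> runs, which alternate between the
  two towers and start with the right one if \<open>r\<close> holds, after some of these runs both towers meet the
  target with all eight labels.
\<close>

fun covering :: "nat \<Rightarrow> bool \<Rightarrow> quat \<Rightarrow> quat \<Rightarrow> quat list \<Rightarrow> quat list \<Rightarrow> bool" where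
  "covering 0 r A B U V \<longleftrightarrow> length (remdups U) = 8 \<and> length (remdups V) = 8"
| "covering (Suc k) r A B U V \<longleftrightarrow> length (remdups U) = 8 \<and> length (remdups V) = 8 \<or>
     (if r then list_all (\<lambda>m. case run_on_right m A B U V of (B', V') \<Rightarrow> covering k False A B' U V') [1, 2, 3]
      else list_all (\<lambda>m. case run_on_left m A B U V of (A', U') \<Rightarrow> covering k True A' B U' V) [1, 2, 3])"

text \<open>
  At the start the target is the base of the left tower only; in \<open>covering_left\<close> it is the base of both
  towers.
\<close>

lemma covering_right: "covering 7 True qi qj [1] []"
  by code_simp

lemma covering_left: "covering 7 False qi qj [1] [1]"
  by code_simp

section \<open>Rauzy induction for the first return map\<close>

locale quat_rotation =
  fixes \<alpha> :: real and X Y :: quat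
  assumes pos: "\<alpha> > 0" and irrational: "\<alpha> \<notin> \<rat>" and gen: "gen_pair X Y"
begin

text \<open>
  The first return of the flow to the bottom edges of the squares, with time rescaled by \<open>\<bar>cos \<theta>\<bar>\<close>.
\<close>

definition skew :: "quat \<times> real \<Rightarrow> quat \<times> real" where
  "skew = (\<lambda>(g, x). (g * X ^ nat \<lfloor>x + \<alpha>\<rfloor> * Y, frac (x + \<alpha>)))"

lemma skew_equivariant: "(skew ^^ n) (h * g, x) = (h * fst ((skew ^^ n) (g, x)), snd ((skew ^^ n) (g, x)))"
  by (induction n) (auto simp: skew_def mult.assoc split: prod.splits)

lemma skew_translate: "\<exists>m::int. snd ((skew ^^ n) (g, x)) = x + of_nat n * \<alpha> - of_int m"
proof (induction n)
  case (Suc n)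
  then obtain m :: int where "snd ((skew ^^ n) (g, x)) = x + of_nat n * \<alpha> - of_int m" by blast
  hence "snd ((skew ^^ Suc n) (g, x)) = x + of_nat (Suc n) * \<alpha> - of_int (m + \<lfloor>snd ((skew ^^ n) (g, x)) + \<alpha>\<rfloor>)"
    by (simp add: skew_def frac_def split_beta algebra_simps)
  thus ?case by blast
qed (auto intro: exI[of _ 0])

definition moves :: "real set \<Rightarrow> nat \<Rightarrow> quat \<Rightarrow> real \<Rightarrow> bool" where
  "moves J n W d \<longleftrightarrow> (\<forall>x\<in>J. \<forall>g. (skew ^^ n) (g, x) = (g * W, x + d))"

text \<open>
  A rigid interval travels in one piece, so it also carries a constant label at each of the \<open>n\<close> times.
\<close>

definition rigid :: "real set \<Rightarrow> nat \<Rightarrow> bool" where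
  "rigid J n \<longleftrightarrow> (\<forall>i\<le>n. \<exists>W d. moves J i W d)"

lemma movesD: "moves J n W d \<Longrightarrow> x \<in> J \<Longrightarrow> (skew ^^ n) (g, x) = (g * W, x + d)"
  by (simp add: moves_def)

lemma moves_0: "moves J 0 1 0" by (simp add: moves_def)

lemma moves_subset: "moves J n W d \<Longrightarrow> J' \<subseteq> J \<Longrightarrow> moves J' n W d"
  by (auto simp: moves_def)

lemma rigid_subset: "rigid J n \<Longrightarrow> J' \<subseteq> J \<Longrightarrow> m \<le> n \<Longrightarrow> rigid J' m"
  unfolding rigid_def by (meson moves_subset order_trans)

lemma moves_trans:
  assumes "moves J n W d" "moves J' m W' d'" "\<And>x. x \<in> J \<Longrightarrow> x + d \<in> J'"
  shows "moves J (n + m) (W * W') (d + d')"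
  using assms by (auto simp: moves_def add.commute[of n] funpow_add mult.assoc add.assoc)

lemma rigid_trans:
  assumes "rigid J n" "moves J n W d" "rigid J' m" "\<And>x. x \<in> J \<Longrightarrow> x + d \<in> J'"
  shows "rigid J (n + m)"
  unfolding rigid_def
proof (intro allI impI)
  fix i assume i: "i \<le> n + m"
  show "\<exists>W d. moves J i W d"
  proof (cases "i \<le> n")
    case True thus ?thesis using assms(1) by (auto simp: rigid_def)
  next
    case False
    hence "i - n \<le> m" using i by simp
    then obtain W' d' where "moves J' (i - n) W' d'" using assms(3) unfolding rigid_def by blast
    from moves_trans[OF assms(2) this assms(4)] False show ?thesis by auto
  qed
qed

text \<open>
  The first return to \<open>[0, a + b)\<close> exchanges the intervals \<open>[0, a)\<close> and \<open>[a, a + b)\<close>, which are the bases of two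
  towers of heights \<open>hA\<close> and \<open>hB\<close> with labels \<open>A\<close> and \<open>B\<close>; together the towers fill \<open>[0, 1)\<close>. The point \<open>a\<close>
  returns to \<open>0\<close>, a corner of the square, at time \<open>hB\<close>; before that no corner is met over the interior
  of the base, which is why the whole base is rigid up to time \<open>hB - 1\<close>.
\<close>

definition stage :: "real \<Rightarrow> real \<Rightarrow> nat \<Rightarrow> nat \<Rightarrow> quat \<Rightarrow> quat \<Rightarrow> bool" where
  "stage a b hA hB A B \<longleftrightarrow> 0 < a \<and> 0 < b \<and> a + b \<le> 1 \<and> 0 < hA \<and> 0 < hB \<and> gen_pair A B \<and>
     moves {0..<a} hA A b \<and> rigid {0..<a} hA \<and>
     moves {a..<a+b} hB B (- a) \<and> rigid {a..<a+b} hB \<and> rigid {0..<a+b} (hB - 1) \<and>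
     (\<forall>y\<in>{0..<1}. \<exists>i z. (z \<in> {0..<a} \<and> i < hA \<or> z \<in> {a..<a+b} \<and> i < hB) \<and> snd ((skew ^^ i) (1, z)) = y) \<and>
     a * real hA + b * real hB = 1 \<and>
     (\<exists>m::int. b = real hA * \<alpha> - of_int m) \<and> (\<exists>m::int. a = of_int m - real hB * \<alpha>)"

lemma stageD:
  assumes "stage a b hA hB A B"
  shows "0 < a" "0 < b" "a + b \<le> 1" "0 < hA" "0 < hB" "gen_pair A B"
    "moves {0..<a} hA A b" "rigid {0..<a} hA" "moves {a..<a+b} hB B (- a)" "rigid {a..<a+b} hB"
    "rigid {0..<a+b} (hB - 1)" "a * real hA + b * real hB = 1"
  using assms by (simp_all add: stage_def)

lemma stage_cover:
  assumes "stage a b hA hB A B" "y \<in> {0..<1}"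
  obtains i z where "z \<in> {0..<a} \<and> i < hA \<or> z \<in> {a..<a+b} \<and> i < hB" "snd ((skew ^^ i) (1, z)) = y"
  using assms unfolding stage_def by blast

lemma stage_heights:
  assumes "stage a b hA hB A B"
  shows "real hA \<le> 1 / a" "real hB \<le> 1 / b" "real hA + real hB \<le> 1 / a + 1 / b"
proof -
  note s = stageD[OF assms]
  have "0 \<le> a * real hA" "0 \<le> b * real hB" using s by auto
  hence "a * real hA \<le> 1" "b * real hB \<le> 1" using s(12) by linarith+
  thus "real hA \<le> 1 / a" "real hB \<le> 1 / b" using s by (auto simp: field_simps)
  thus "real hA + real hB \<le> 1 / a + 1 / b" by linarith
qed

text \<open>
  Equal lengths would make \<open>(hA + hB) \<alpha>\<close> an integer.
\<close>

lemma stage_neq: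
  assumes "stage a b hA hB A B" shows "a \<noteq> b"
proof
  assume "a = b"
  from assms obtain m m' :: int where "b = real hA * \<alpha> - of_int m" "a = of_int m' - real hB * \<alpha>"
    by (auto simp: stage_def)
  with \<open>a = b\<close> have "real (hA + hB) * \<alpha> = of_int (m + m')" by (simp add: algebra_simps)
  hence "\<alpha> = of_int (m + m') / real (hA + hB)" using stageD(4)[OF assms] by (simp add: field_simps)
  hence "\<alpha> \<in> \<rat>" by simp
  thus False using irrational by simp
qed

text \<open>
  The two towers of height \<open>1\<close> stand over the intervals on which \<open>\<lfloor>x + \<alpha>\<rfloor>\<close> is constant.
\<close>

lemma stage_init: "\<exists>A B. stage (1 - frac \<alpha>) (frac \<alpha>) 1 1 A B"
proof -
  define m where "m = nat \<lfloor>\<alpha>\<rfloor>"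
  let ?A = "X ^ m * Y" and ?B = "X ^ Suc m * Y"
  have "frac \<alpha> \<noteq> 0" using irrational by (metis Ints_subset_Rats frac_eq_0_iff subsetD)
  hence f: "0 < frac \<alpha>" "frac \<alpha> < 1" using frac_lt_1[of \<alpha>] frac_ge_0[of \<alpha>] by linarith+
  note s = gen_pair_simps[OF gen]
  have P: "X ^ 0 = 1" "X ^ 1 = X" "X ^ 2 = -1" "X ^ 3 = - X"
    by (simp_all add: eval_nat_numeral s)
  have "gen_pair (X ^ (m mod 4) * Y) (X * X ^ (m mod 4) * Y)"
  proof -
    have "m mod 4 = 0 \<or> m mod 4 = 1 \<or> m mod 4 = 2 \<or> m mod 4 = 3" by auto
    thus ?thesis by (elim disjE; simp only: P; simp add: gen_pair_def s mult.assoc)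
  qed
  hence g: "gen_pair ?A ?B" by (simp add: quat_pow_mod[of X m] mult.assoc)
  have fl: "\<lfloor>x + \<alpha>\<rfloor> = \<lfloor>\<alpha>\<rfloor>" if "x \<in> {0..<1 - frac \<alpha>}" for x
    using that by (auto simp: floor_eq_iff frac_def) linarith+
  have fl': "\<lfloor>x + \<alpha>\<rfloor> = \<lfloor>\<alpha>\<rfloor> + 1" if "x \<in> {1 - frac \<alpha>..<1}" for x
    using that by (auto simp: floor_eq_iff frac_def) linarith+
  have m0: "\<lfloor>\<alpha>\<rfloor> \<ge> 0" using pos by simp
  have mA: "moves {0..<1 - frac \<alpha>} 1 ?A (frac \<alpha>)"
    by (auto simp: moves_def skew_def fl m_def frac_def mult.assoc)
  have mB: "moves {1 - frac \<alpha>..<1} 1 ?B (- (1 - frac \<alpha>))"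
    using m0 by (auto simp: moves_def skew_def fl' m_def frac_def mult.assoc nat_add_distrib)
  have r: "rigid J 1" if "moves J 1 W d" for J W d
    unfolding rigid_def using that moves_0[of J] by (auto simp: le_Suc_eq)
  have "stage (1 - frac \<alpha>) (frac \<alpha>) 1 1 ?A ?B"
    unfolding stage_def
  proof (intro conjI)
    show "rigid {0..<1 - frac \<alpha> + frac \<alpha>} (1 - 1)" using moves_0 by (auto simp: rigid_def)
    show "\<forall>y\<in>{0..<1}. \<exists>i z. (z \<in> {0..<1 - frac \<alpha>} \<and> i < 1 \<or> z \<in> {1 - frac \<alpha>..<1 - frac \<alpha> + frac \<alpha>} \<and> i < 1) \<and>
            snd ((skew ^^ i) (1, z)) = y"
    proof
      fix y :: real assume "y \<in> {0..<1}"
      thus "\<exists>i z. (z \<in> {0..<1 - frac \<alpha>} \<and> i < 1 \<or> z \<in> {1 - frac \<alpha>..<1 - frac \<alpha> + frac \<alpha>} \<and> i < 1) \<and>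
            snd ((skew ^^ i) (1, z)) = y"
        by (intro exI[of _ 0] exI[of _ y]) auto
    qed
    show "\<exists>m::int. frac \<alpha> = real 1 * \<alpha> - of_int m" by (auto simp: frac_def)
    show "\<exists>m::int. 1 - frac \<alpha> = of_int m - real 1 * \<alpha>"
      by (rule exI[of _ "\<lfloor>\<alpha>\<rfloor> + 1"]) (simp add: frac_def)
  qed (use f g mA mB r[OF mA] r[OF mB] in auto)
  thus ?thesis by blast
qed

text \<open>
  The base shrinks to \<open>[0, a)\<close>. Points of \<open>[a - b, a)\<close> climb the left tower, land in the part of the base
  that was removed, and then climb the right tower.
\<close>

lemma stage_right:
  assumes st: "stage a b hA hB A B" and "b < a"
  shows "stage (a - b) b hA (hA + hB) A (A * B)"
  unfolding stage_def
proof (intro conjI)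
  note s = stageD[OF st]
  show "0 < a - b" "0 < b" "a - b + b \<le> 1" "0 < hA" "0 < hA + hB" using s assms(2) by auto
  show "gen_pair A (A * B)" using gen_pair_step s(6) by blast
  show "moves {0..<a - b} hA A b" by (rule moves_subset[OF s(7)]) (use s in auto)
  show "rigid {0..<a - b} hA" by (rule rigid_subset[OF s(8)]) (use s in auto)
  have mA: "moves {a - b..<a} hA A b" by (rule moves_subset[OF s(7)]) (use s assms(2) in auto)
  have rA: "rigid {a - b..<a} hA" by (rule rigid_subset[OF s(8)]) (use s assms(2) in auto)
  show "moves {a - b..<a - b + b} (hA + hB) (A * B) (- (a - b))"
    using moves_trans[OF mA s(9)] by auto
  show "rigid {a - b..<a - b + b} (hA + hB)"
    using rigid_trans[OF rA mA s(10)] by auto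
  have "rigid {0..<a} (hA + (hB - 1))"
    by (rule rigid_trans[OF s(8) s(7) s(11)]) (use s in auto)
  thus "rigid {0..<a - b + b} (hA + hB - 1)" using s by simp
  show "\<forall>y\<in>{0..<1}. \<exists>i z. (z \<in> {0..<a - b} \<and> i < hA \<or> z \<in> {a - b..<a - b + b} \<and> i < hA + hB)
      \<and> snd ((skew ^^ i) (1, z)) = y"
  proof
    fix y :: real assume y1: "y \<in> {0..<1}"
    obtain i z where i: "z \<in> {0..<a} \<and> i < hA \<or> z \<in> {a..<a+b} \<and> i < hB"
      and y: "snd ((skew ^^ i) (1, z)) = y" using stage_cover[OF st y1] .
    show "\<exists>i z. (z \<in> {0..<a - b} \<and> i < hA \<or> z \<in> {a - b..<a - b + b} \<and> i < hA + hB)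
      \<and> snd ((skew ^^ i) (1, z)) = y"
    proof (cases "z < a")
      case True
      with i y show ?thesis by (intro exI[of _ i] exI[of _ z]) auto
    next
      case False
      hence "z - b \<in> {a - b..<a}" using i by auto
      from movesD[OF mA this, of 1] have "(skew ^^ (i + hA)) (1, z - b) = (skew ^^ i) (A * 1, z)"
        by (simp add: funpow_add)
      also have "snd \<dots> = y" using skew_equivariant[of i A 1 z] y by simp
      finally have "snd ((skew ^^ (i + hA)) (1, z - b)) = y" .
      thus ?thesis using i False by (intro exI[of _ "i + hA"] exI[of _ "z - b"]) auto
    qed
  qed
  show "(a - b) * real hA + b * real (hA + hB) = 1" using s(12) by (simp add: algebra_simps)
  obtain m m' :: int where m: "b = real hA * \<alpha> - of_int m" "a = of_int m' - real hB * \<alpha>"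
    using st by (auto simp: stage_def)
  show "\<exists>m::int. b = real hA * \<alpha> - of_int m" using m by blast
  show "\<exists>m::int. a - b = of_int m - real (hA + hB) * \<alpha>"
    by (rule exI[of _ "m + m'"]) (simp add: m algebra_simps)
qed

text \<open>
  The base shrinks to \<open>[0, b)\<close>. Points of \<open>[0, a)\<close> climb the left tower, land in the removed part
  \<open>[b, a + b)\<close>, and then climb the right tower.
\<close>

lemma stage_left:
  assumes st: "stage a b hA hB A B" and "a < b"
  shows "stage a (b - a) (hA + hB) hB (A * B) B"
  unfolding stage_def
proof (intro conjI)
  note s = stageD[OF st]
  show "0 < a" "0 < b - a" "a + (b - a) \<le> 1" "0 < hA + hB" "0 < hB" using s assms(2) by auto
  show "gen_pair (A * B) B" using gen_pair_step s(6) by blast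
  have mB: "moves {b..<a+b} hB B (- a)" by (rule moves_subset[OF s(9)]) (use s assms(2) in auto)
  have rB: "rigid {b..<a+b} hB" by (rule rigid_subset[OF s(10)]) (use s assms(2) in auto)
  show "moves {0..<a} (hA + hB) (A * B) (b - a)"
    using moves_trans[OF s(7) mB] by auto
  show "rigid {0..<a} (hA + hB)"
    using rigid_trans[OF s(8) s(7) rB] by auto
  show "moves {a..<a + (b - a)} hB B (- a)" by (rule moves_subset[OF s(9)]) (use s in auto)
  show "rigid {a..<a + (b - a)} hB" by (rule rigid_subset[OF s(10)]) (use s in auto)
  show "rigid {0..<a + (b - a)} (hB - 1)" by (rule rigid_subset[OF s(11)]) (use s in auto)
  show "\<forall>y\<in>{0..<1}. \<exists>i z. (z \<in> {0..<a} \<and> i < hA + hB \<or> z \<in> {a..<a + (b - a)} \<and> i < hB)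
      \<and> snd ((skew ^^ i) (1, z)) = y"
  proof
    fix y :: real assume y1: "y \<in> {0..<1}"
    obtain i z where i: "z \<in> {0..<a} \<and> i < hA \<or> z \<in> {a..<a+b} \<and> i < hB"
      and y: "snd ((skew ^^ i) (1, z)) = y" using stage_cover[OF st y1] .
    show "\<exists>i z. (z \<in> {0..<a} \<and> i < hA + hB \<or> z \<in> {a..<a + (b - a)} \<and> i < hB)
      \<and> snd ((skew ^^ i) (1, z)) = y"
    proof (cases "z < b")
      case True
      with i y show ?thesis by (intro exI[of _ i] exI[of _ z]) auto
    next
      case False
      hence "z - b \<in> {0..<a}" using i s assms(2) by auto
      from movesD[OF s(7) this, of 1] have "(skew ^^ (i + hA)) (1, z - b) = (skew ^^ i) (A * 1, z)"
        by (simp add: funpow_add)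
      also have "snd \<dots> = y" using skew_equivariant[of i A 1 z] y by simp
      finally have "snd ((skew ^^ (i + hA)) (1, z - b)) = y" .
      thus ?thesis using i False assms(2) by (intro exI[of _ "i + hA"] exI[of _ "z - b"]) auto
    qed
  qed
  show "a * real (hA + hB) + (b - a) * real hB = 1" using s(12) by (simp add: algebra_simps)
  obtain m m' :: int where m: "b = real hA * \<alpha> - of_int m" "a = of_int m' - real hB * \<alpha>"
    using st by (auto simp: stage_def)
  show "\<exists>m::int. a = of_int m - real hB * \<alpha>" using m by blast
  show "\<exists>k::int. b - a = real (hA + hB) * \<alpha> - of_int k"
    by (rule exI[of _ "m + m'"]) (simp add: m algebra_simps)
qed

text \<open>
  The uniform property of the skew product that bounds the hitting times of the flow.
\<close>

definition hits :: "real \<Rightarrow> real \<Rightarrow> bool" where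
  "hits N \<rho> \<longleftrightarrow> (\<forall>g h. \<forall>x\<in>{0..<1}. \<forall>y\<in>{0..<1}. \<exists>n x'. real n \<le> N \<and> (skew ^^ n) (g, x) = (h, x') \<and> \<bar>x' - y\<bar> \<le> \<rho>)"

lemma hits_mono: "hits N \<rho> \<Longrightarrow> N \<le> N' \<Longrightarrow> \<rho> \<le> \<rho>' \<Longrightarrow> hits N' \<rho>'"
  unfolding hits_def by (meson order_trans)

lemma reach_base:
  assumes st: "stage a b hA hB A B" and x: "x \<in> {0..<1}"
  shows "\<exists>n\<le>hA + hB. snd ((skew ^^ n) (g, x)) \<in> {0..<a+b}"
proof -
  note s = stageD[OF st]
  obtain i z where i: "z \<in> {0..<a} \<and> i < hA \<or> z \<in> {a..<a+b} \<and> i < hB"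
      and y: "snd ((skew ^^ i) (1, z)) = x" using stage_cover[OF st x] .
  define w where "w = fst ((skew ^^ i) (1, z))"
  have w: "(skew ^^ i) (1, z) = (w, x)" using y by (simp add: w_def prod_eq_iff)
  obtain k where k: "g = k * w" using quat_divide by blast
  have *: "snd ((skew ^^ n) (g, x)) = snd ((skew ^^ (n + i)) (1, z))" for n
    using skew_equivariant[of n k w x] by (simp add: k funpow_add w)
  show ?thesis
  proof (cases "z < a")
    case True
    hence "z \<in> {0..<a}" using i by auto
    from movesD[OF s(7) this, of 1] True i s(1,2) show ?thesis by (intro exI[of _ "hA - i"]) (auto simp: *)
  next
    case False
    hence "z \<in> {a..<a+b}" using i by auto
    from movesD[OF s(9) this, of 1] False i s(1,2) show ?thesis by (intro exI[of _ "hB - i"]) (auto simp: *)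
  qed
qed

text \<open>
  Every \<open>y\<close> lies above some \<open>z\<close> in the base, at height \<open>i\<close> say. For \<open>i < hB\<close> the whole base climbs rigidly to
  that level; for larger \<open>i\<close> the point \<open>y\<close> lies in the left tower, so that \<open>hB < hA\<close> and at least the
  interval \<open>[0, a)\<close> climbs rigidly.
\<close>

lemma climb_to_target:
  assumes st: "stage a b hA hB A B" and y: "y \<in> {0..<1}"
  shows "\<exists>z\<in>{0..<a+b}. \<exists>i\<le>hA+hB. \<exists>W. moves (if hA \<le> hB then {0..<a+b} else {0..<a}) i W (y - z)"
proof -
  note s = stageD[OF st]
  obtain i z where i: "z \<in> {0..<a} \<and> i < hA \<or> z \<in> {a..<a+b} \<and> i < hB"
      and y: "snd ((skew ^^ i) (1, z)) = y" using stage_cover[OF st y] .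
  have z: "z \<in> {0..<a+b}" using i s by auto
  have yd: "d = y - z" if "moves J i W d" "z \<in> J" for J W d
    using movesD[OF that, of 1] y by auto
  have "\<exists>W. moves (if hA \<le> hB then {0..<a+b} else {0..<a}) i W (y - z)"
  proof (cases "i \<le> hB - 1")
    case True
    then obtain W d where W: "moves {0..<a+b} i W d" using s(11) by (auto simp: rigid_def)
    with yd[OF W z] show ?thesis using s moves_subset[OF W, of "{0..<a}"] by auto
  next
    case False
    hence "hB < hA" "z \<in> {0..<a}" "i < hA" using i by auto
    moreover obtain W d where W: "moves {0..<a} i W d" using s(8) \<open>i < hA\<close> by (fastforce simp: rigid_def)
    ultimately show ?thesis using yd[OF W] by auto
  qed
  with z i show ?thesis by (intro bexI[of _ z] exI[of _ i]) auto
qed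

text \<open>
  An approximation of \<open>z\<close> in the base climbs with it to an equally good approximation of the target.
\<close>

lemma hits_from_base:
  assumes st: "stage a b hA hB A B"
    and J: "J = (if hA \<le> hB then {0..<a+b} else {0..<a})"
    and near: "\<And>g h x z. x \<in> {0..<a+b} \<Longrightarrow> z \<in> {0..<a+b} \<Longrightarrow>
      \<exists>n x'. real n \<le> N \<and> x' \<in> J \<and> (skew ^^ n) (g, x) = (h, x') \<and> \<bar>x' - z\<bar> \<le> \<rho>"
  shows "hits (N + 2 * (real hA + real hB)) \<rho>"
  unfolding hits_def
proof (intro allI ballI)
  fix g h and x y :: real assume x: "x \<in> {0..<1}" and y: "y \<in> {0..<1}"
  obtain n0 where n0: "n0 \<le> hA + hB" "snd ((skew ^^ n0) (g, x)) \<in> {0..<a+b}"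
    using reach_base[OF st x] by blast
  obtain g1 x1 where g1: "(skew ^^ n0) (g, x) = (g1, x1)" by fastforce
  obtain z i W where z: "z \<in> {0..<a+b}" "i \<le> hA + hB" "moves J i W (y - z)"
    using climb_to_target[OF st y] unfolding J by blast
  obtain h' where h': "h = h' * W" using quat_divide by blast
  obtain n x' where n: "real n \<le> N" "x' \<in> J" "(skew ^^ n) (g1, x1) = (h', x')" "\<bar>x' - z\<bar> \<le> \<rho>"
    using near[of x1 z g1 h'] z n0 g1 by auto
  have "(skew ^^ (i + (n + n0))) (g, x) = (h, x' + (y - z))"
    by (simp only: funpow_add o_apply g1 n(3) movesD[OF z(3) n(2)] h')
  moreover have "\<bar>x' + (y - z) - y\<bar> \<le> \<rho>" using n by (simp add: algebra_simps)
  moreover have "real (i + (n + n0)) \<le> N + 2 * (real hA + real hB)" using n z n0 by simp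
  ultimately show "\<exists>n x'. real n \<le> N + 2 * (real hA + real hB) \<and> (skew ^^ n) (g, x) = (h, x') \<and> \<bar>x' - y\<bar> \<le> \<rho>" by blast
qed

end

section \<open>Sweeping through a long interval\<close>

text \<open>
  Consecutive points of the progression have distance \<open>y\<close>, so those with a prescribed index modulo \<open>4\<close>
  have gaps \<open>4 y\<close>; one more \<open>y\<close> absorbs the ends. A prescribed index modulo \<open>4\<close> means a prescribed power
  of an element of order \<open>4\<close>.
\<close>

lemma window:
  fixes x y z a :: real
  assumes "0 < y" "0 \<le> x" "x \<le> y" "4 \<le> L" "a \<le> x + real L * y" "0 \<le> z" "z \<le> a + y"
  shows "\<exists>j<L. j mod 4 = k mod 4 \<and> \<bar>x + real j * y - z\<bar> \<le> 5 * y"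
proof -
  define i where "i = min (L - 4) (nat \<lfloor>(z - x) / y\<rfloor>)"
  define j where "j = i + (k + 3 * i) mod 4"
  have "j mod 4 = (4 * i + k) mod 4" unfolding j_def by (simp add: mod_add_right_eq algebra_simps)
  hence 1: "j mod 4 = k mod 4" by simp
  have ij: "i \<le> j" "j \<le> i + 3" unfolding j_def by auto
  have 2: "j < L" using ij assms(4) by (auto simp: i_def)
  have lo: "real i * y \<le> real j * y"
    using ij assms(1) by (intro mult_right_mono) auto
  have "real j * y \<le> (real i + 3) * y"
    using ij assms(1) by (intro mult_right_mono) auto
  hence hi: "real j * y \<le> real i * y + 3 * y" by (simp only: distrib_right)
  have "x + real i * y \<le> z + y"
  proof (cases "z < x")
    case True
    hence "(z - x) / y < 0" using assms(1) by (simp add: field_simps)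
    hence "i = 0" by (simp add: i_def)
    thus ?thesis using assms by simp
  next
    case False
    hence "(z - x) / y \<ge> 0" using assms(1) by (simp add: field_simps)
    hence "real i \<le> (z - x) / y" by (simp add: i_def) linarith
    hence "real i * y \<le> z - x" using assms(1) by (simp add: field_simps)
    thus ?thesis using assms by simp
  qed
  moreover have "z \<le> x + (real i * y + 5 * y)"
  proof (cases "i = L - 4")
    case True
    hence "real L = real i + 4" using assms(4) by simp
    hence "a \<le> x + (real i + 4) * y" using assms(5) by simp
    thus ?thesis using assms(7) by (simp add: algebra_simps)
  next
    case False
    hence "i = nat \<lfloor>(z - x) / y\<rfloor>" by (simp add: i_def min_def split: if_splits)
    hence "(z - x) / y \<le> real i + 1" by linarith
    hence "z - x \<le> (real i + 1) * y" using assms(1) by (simp add: field_simps)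
    thus ?thesis using assms(1) by (simp add: algebra_simps)
  qed
  ultimately have "\<bar>x + real j * y - z\<bar> \<le> 5 * y"
    using lo hi unfolding abs_le_iff by linarith
  with 1 2 show ?thesis by blast
qed

context quat_rotation
begin

text \<open>
  While the orbit stays in \<open>[0, a)\<close>, each passage through the left tower translates it by \<open>b\<close>.
\<close>

lemma sweep_right:
  assumes st: "stage a b hA hB A B" and x: "x \<in> {0..<a+b}"
  obtains l where "x + real l * b \<in> {a..<a+b}" "real l \<le> a / b + 1"
    "\<And>j g. j \<le> l \<Longrightarrow> (skew ^^ (j * hA)) (g, x) = (g * A ^ j, x + real j * b)"
    "\<And>j. j < l \<Longrightarrow> x + real j * b < a"
proof
  note s = stageD[OF st]
  define l where "l = nat \<lceil>(a - x) / b\<rceil>"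
  show lt: "x + real j * b < a" if "j < l" for j
  proof -
    from that have "real j < (a - x) / b" unfolding l_def by linarith
    thus ?thesis using s by (simp add: field_simps)
  qed
  have "(a - x) / b \<le> real l" unfolding l_def by linarith
  hence 1: "a \<le> x + real l * b" using s by (simp add: field_simps)
  have "x + real l * b < a + b"
  proof (cases l)
    case 0 thus ?thesis using x by simp
  next
    case (Suc n)
    thus ?thesis using lt[of n] by (simp add: algebra_simps)
  qed
  with 1 show "x + real l * b \<in> {a..<a+b}" by simp
  have "(a - x) / b \<le> a / b" using s x by (intro divide_right_mono) auto
  moreover have "0 < a / b" using s by simp
  ultimately show "real l \<le> a / b + 1" unfolding l_def by linarith
  show "(skew ^^ (j * hA)) (g, x) = (g * A ^ j, x + real j * b)" if "j \<le> l" for j g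
    using that
  proof (induction j)
    case (Suc j)
    have "0 \<le> real j * b" using s by simp
    hence "x + real j * b \<in> {0..<a}" using lt[of j] Suc.prems x by simp
    from movesD[OF s(7) this] Suc show ?case
      by (simp add: funpow_add mult.assoc power_commutes algebra_simps)
  qed simp
qed

text \<open>
  The mirror image: passages through the right tower translate the orbit by \<open>- a\<close>.
\<close>

lemma sweep_left:
  assumes st: "stage a b hA hB A B" and x: "x \<in> {0..<a+b}"
  obtains l where "x - real l * a \<in> {0..<a}" "real l \<le> b / a + 1"
    "\<And>j g. j \<le> l \<Longrightarrow> (skew ^^ (j * hB)) (g, x) = (g * B ^ j, x - real j * a)"
    "\<And>j. j < l \<Longrightarrow> a \<le> x - real j * a"
proof
  note s = stageD[OF st]
  define l where "l = nat \<lfloor>x / a\<rfloor>"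
  have xa: "0 \<le> x / a" using s x by simp
  show lt: "a \<le> x - real j * a" if "j < l" for j
  proof -
    from that have "real j + 1 \<le> x / a" unfolding l_def by linarith
    thus ?thesis using s by (simp add: field_simps)
  qed
  have "real l \<le> x / a" "x / a < real l + 1" using xa unfolding l_def by linarith+
  hence 1: "real l * a \<le> x" "x < real l * a + a" using s by (auto simp: field_simps)
  thus "x - real l * a \<in> {0..<a}" by simp
  have "x / a \<le> (a + b) / a" using s x by (intro divide_right_mono) auto
  thus "real l \<le> b / a + 1" using \<open>real l \<le> x / a\<close> s by (simp add: add_divide_distrib)
  show "(skew ^^ (j * hB)) (g, x) = (g * B ^ j, x - real j * a)" if "j \<le> l" for j g
    using that
  proof (induction j)
    case (Suc j)
    have "0 \<le> real j * a" using s by simp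
    hence "x - real j * a \<in> {a..<a+b}" using lt[of j] Suc.prems x by simp
    from movesD[OF s(9) this] Suc show ?case
      by (simp add: funpow_add mult.assoc power_commutes algebra_simps)
  qed simp
qed

lemma sweep_hits_right:
  assumes st: "stage a b hA hB A B" and ab: "4 * b \<le> a" and x: "x \<in> {0..<b}" and z: "z \<in> {0..<a+b}"
  shows "\<exists>n x'. real n \<le> (a / b + 1) * real hA \<and> x' \<in> {0..<a} \<and> (skew ^^ n) (g, x) = (g * A ^ k, x') \<and> \<bar>x' - z\<bar> \<le> 5 * b"
proof -
  note s = stageD[OF st]
  have "x \<in> {0..<a+b}" using x s by auto
  from sweep_right[OF st this] obtain l where l: "x + real l * b \<in> {a..<a+b}" "real l \<le> a / b + 1"
    "\<And>j g. j \<le> l \<Longrightarrow> (skew ^^ (j * hA)) (g, x) = (g * A ^ j, x + real j * b)"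
    "\<And>j. j < l \<Longrightarrow> x + real j * b < a" by blast
  have "3 * b < real l * b" using l(1) ab x unfolding atLeastLessThan_iff by linarith
  hence "3 < real l" using s by simp
  hence "4 \<le> l" by linarith
  then obtain j where j: "j < l" "j mod 4 = k mod 4" "\<bar>x + real j * b - z\<bar> \<le> 5 * b"
    using window[of b x l a z k] s x z l(1) by auto
  have "A ^ j = A ^ k" using quat_pow_mod[of A j] quat_pow_mod[of A k] j(2) by simp
  moreover have "real (j * hA) \<le> (a / b + 1) * real hA"
    using j(1) l(2) by (simp add: mult_right_mono)
  moreover have "0 \<le> real j * b" using s by simp
  ultimately show ?thesis using l(3)[of j g] l(4)[of j] j x
    by (intro exI[of _ "j * hA"] exI[of _ "x + real j * b"]) auto
qed

lemma sweep_hits_left: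
  assumes st: "stage a b hA hB A B" and ab: "4 * a \<le> b" and x: "x \<in> {b..<a+b}" and z: "z \<in> {0..<a+b}"
  shows "\<exists>n x'. real n \<le> (b / a + 1) * real hB \<and> x' \<in> {0..<a+b} \<and> (skew ^^ n) (g, x) = (g * B ^ k, x') \<and> \<bar>x' - z\<bar> \<le> 5 * a"
proof -
  note s = stageD[OF st]
  have x0: "x \<in> {0..<a+b}" using x s by auto
  from sweep_left[OF st this] obtain l where l: "x - real l * a \<in> {0..<a}" "real l \<le> b / a + 1"
    "\<And>j g. j \<le> l \<Longrightarrow> (skew ^^ (j * hB)) (g, x) = (g * B ^ j, x - real j * a)"
    "\<And>j. j < l \<Longrightarrow> a \<le> x - real j * a" by blast
  have "3 * a < real l * a" using l(1) ab x unfolding atLeastLessThan_iff by linarith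
  hence "3 < real l" using s by simp
  hence "4 \<le> l" by linarith
  moreover have "b \<le> (a + b - x) + real l * a" using l(1) by auto
  ultimately obtain j where j: "j < l" "j mod 4 = k mod 4" "\<bar>(a + b - x) + real j * a - (a + b - z)\<bar> \<le> 5 * a"
    using window[of a "a + b - x" l b "a + b - z" k] s x z by auto
  have "B ^ j = B ^ k" using quat_pow_mod[of B j] quat_pow_mod[of B k] j(2) by simp
  moreover have "real (j * hB) \<le> (b / a + 1) * real hB"
    using j(1) l(2) by (simp add: mult_right_mono)
  moreover have "0 \<le> real j * a" using s by simp
  moreover have "\<bar>x - real j * a - z\<bar> \<le> 5 * a" using j(3) by (simp add: abs_le_iff)
  ultimately have "x - real j * a \<in> {0..<a+b}" "(skew ^^ (j * hB)) (g, x) = (g * B ^ k, x - real j * a)"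
    "real (j * hB) \<le> (b / a + 1) * real hB" "\<bar>x - real j * a - z\<bar> \<le> 5 * a"
    using l(3)[of j g] l(4)[OF j(1)] j(1) x0 s(1) unfolding atLeastLessThan_iff by (linarith | simp)+
  thus ?thesis
    by (intro exI[of _ "j * hB"] exI[of _ "x - real j * a"]) auto
qed

text \<open>
  The first sweep runs through the labels of one left coset of the powers of \<open>A\<close>. It ends in the right
  tower, whose label \<open>B\<close> leads to the other coset, which the second sweep runs through. A further sweep
  is allowed for reaching the left end of the base first.
\<close>

lemma two_sweeps_right:
  assumes st: "stage a b hA hB A B" and ab: "4 * b \<le> a" and x: "x \<in> {0..<a+b}" and z: "z \<in> {0..<a+b}"
  shows "\<exists>n x'. real n \<le> 3 * ((a / b + 1) * real hA + real hB) \<and> x' \<in> {0..<a} \<and> (skew ^^ n) (g, x) = (h, x') \<and> \<bar>x' - z\<bar> \<le> 5 * b"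
proof -
  note s = stageD[OF st]
  let ?T = "(a / b + 1) * real hA + real hB"
  have pass: "\<exists>n l x'. real n \<le> ?T \<and> x' \<in> {0..<b} \<and> (\<forall>g. (skew ^^ n) (g, x) = (g * A ^ l * B, x'))"
    if x: "x \<in> {0..<a+b}" for x
  proof -
    from sweep_right[OF st x] obtain l where l: "x + real l * b \<in> {a..<a+b}" "real l \<le> a / b + 1"
      "\<And>j g. j \<le> l \<Longrightarrow> (skew ^^ (j * hA)) (g, x) = (g * A ^ j, x + real j * b)"
      "\<And>j. j < l \<Longrightarrow> x + real j * b < a" by blast
    have "real (l * hA) \<le> (a / b + 1) * real hA" using l(2) by (simp add: mult_right_mono)
    moreover have "(skew ^^ (hB + l * hA)) (g, x) = (g * A ^ l * B, x + real l * b - a)" for g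
      using movesD[OF s(9) l(1)] l(3)[of l g] by (simp add: funpow_add)
    moreover have "x + real l * b - a \<in> {0..<b}" using l(1) unfolding atLeastLessThan_iff by linarith
    moreover have "real (hB + l * hA) \<le> ?T" using calculation(1) by simp
    ultimately show ?thesis by blast
  qed
  obtain n1 l1 x1 where 1: "real n1 \<le> ?T" "x1 \<in> {0..<b}" "\<And>g. (skew ^^ n1) (g, x) = (g * A ^ l1 * B, x1)"
    using pass[OF x] by blast
  have "x1 \<in> {0..<a+b}" using 1 s by auto
  then obtain n2 l2 x2 where 2: "real n2 \<le> ?T" "x2 \<in> {0..<b}" "\<And>g. (skew ^^ n2) (g, x1) = (g * A ^ l2 * B, x2)"
    using pass by blast
  define g1 where "g1 = g * A ^ l1 * B"
  have "0 \<le> (a / b + 1) * real hA" using s by simp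
  hence T: "(a / b + 1) * real hA \<le> ?T" "0 \<le> ?T" by auto
  have sum3: "p + q + r \<le> 3 * t" if "p \<le> t" "q \<le> t" "r \<le> t" for p q r t :: real
    using that by linarith
  consider j where "h = g1 * A ^ j" | j where "h = g1 * A ^ l2 * B * A ^ j"
    using two_cosets[OF s(6), of h g1 l2] by blast
  thus ?thesis
  proof cases
    case c: 1
    obtain n x' where n: "real n \<le> (a / b + 1) * real hA" "x' \<in> {0..<a}" "(skew ^^ n) (g1, x1) = (h, x')" "\<bar>x' - z\<bar> \<le> 5 * b"
      using sweep_hits_right[OF st ab 1(2) z, of g1 j] c by blast
    have "(skew ^^ (n + n1)) (g, x) = (h, x')" by (simp only: funpow_add o_apply 1(3) n(3) g1_def[symmetric])
    moreover have "real (n + n1) \<le> 3 * ?T"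
      using sum3[OF order_trans[OF n(1) T(1)] 1(1) T(2)] by simp
    ultimately show ?thesis using n by blast
  next
    case c: 2
    obtain n x' where n: "real n \<le> (a / b + 1) * real hA" "x' \<in> {0..<a}"
      "(skew ^^ n) (g1 * A ^ l2 * B, x2) = (h, x')" "\<bar>x' - z\<bar> \<le> 5 * b"
      using sweep_hits_right[OF st ab 2(2) z, of "g1 * A ^ l2 * B" j] c by blast
    have "(skew ^^ (n + (n2 + n1))) (g, x) = (h, x')" by (simp only: funpow_add o_apply 1(3) 2(3) n(3) g1_def[symmetric])
    moreover have "real (n + (n2 + n1)) \<le> 3 * ?T"
      using sum3[OF order_trans[OF n(1) T(1)] 2(1) 1(1)] by (simp add: add.assoc)
    ultimately show ?thesis using n by blast
  qed
qed

lemma two_sweeps_left: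
  assumes st: "stage a b hA hB A B" and ab: "4 * a \<le> b" and x: "x \<in> {0..<a+b}" and z: "z \<in> {0..<a+b}"
  shows "\<exists>n x'. real n \<le> 3 * ((b / a + 1) * real hB + real hA) \<and> x' \<in> {0..<a+b} \<and> (skew ^^ n) (g, x) = (h, x') \<and> \<bar>x' - z\<bar> \<le> 5 * a"
proof -
  note s = stageD[OF st]
  let ?T = "(b / a + 1) * real hB + real hA"
  have pass: "\<exists>n l x'. real n \<le> ?T \<and> x' \<in> {b..<a+b} \<and> (\<forall>g. (skew ^^ n) (g, x) = (g * B ^ l * A, x'))"
    if x: "x \<in> {0..<a+b}" for x
  proof -
    from sweep_left[OF st x] obtain l where l: "x - real l * a \<in> {0..<a}" "real l \<le> b / a + 1"
      "\<And>j g. j \<le> l \<Longrightarrow> (skew ^^ (j * hB)) (g, x) = (g * B ^ j, x - real j * a)"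
      "\<And>j. j < l \<Longrightarrow> a \<le> x - real j * a" by blast
    have "real (l * hB) \<le> (b / a + 1) * real hB" using l(2) by (simp add: mult_right_mono)
    moreover have "(skew ^^ (hA + l * hB)) (g, x) = (g * B ^ l * A, x - real l * a + b)" for g
      using movesD[OF s(7) l(1)] l(3)[of l g] by (simp add: funpow_add)
    moreover have "x - real l * a + b \<in> {b..<a + b}" using l(1) unfolding atLeastLessThan_iff by linarith
    moreover have "real (hA + l * hB) \<le> ?T" using calculation(1) by simp
    ultimately show ?thesis by blast
  qed
  obtain n1 l1 x1 where 1: "real n1 \<le> ?T" "x1 \<in> {b..<a+b}" "\<And>g. (skew ^^ n1) (g, x) = (g * B ^ l1 * A, x1)"
    using pass[OF x] by blast
  have "x1 \<in> {0..<a+b}" using 1 s by auto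
  then obtain n2 l2 x2 where 2: "real n2 \<le> ?T" "x2 \<in> {b..<a+b}" "\<And>g. (skew ^^ n2) (g, x1) = (g * B ^ l2 * A, x2)"
    using pass by blast
  define g1 where "g1 = g * B ^ l1 * A"
  have "0 \<le> (b / a + 1) * real hB" using s by simp
  hence T: "(b / a + 1) * real hB \<le> ?T" "0 \<le> ?T" by auto
  have sum3: "p + q + r \<le> 3 * t" if "p \<le> t" "q \<le> t" "r \<le> t" for p q r t :: real
    using that by linarith
  consider j where "h = g1 * B ^ j" | j where "h = g1 * B ^ l2 * A * B ^ j"
    using two_cosets[OF gen_pair_swap[OF s(6)], of h g1 l2] by blast
  thus ?thesis
  proof cases
    case c: 1
    obtain n x' where n: "real n \<le> (b / a + 1) * real hB" "x' \<in> {0..<a+b}" "(skew ^^ n) (g1, x1) = (h, x')" "\<bar>x' - z\<bar> \<le> 5 * a"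
      using sweep_hits_left[OF st ab 1(2) z, of g1 j] c by blast
    have "(skew ^^ (n + n1)) (g, x) = (h, x')" by (simp only: funpow_add o_apply 1(3) n(3) g1_def[symmetric])
    moreover have "real (n + n1) \<le> 3 * ?T"
      using sum3[OF order_trans[OF n(1) T(1)] 1(1) T(2)] by simp
    ultimately show ?thesis using n by blast
  next
    case c: 2
    obtain n x' where n: "real n \<le> (b / a + 1) * real hB" "x' \<in> {0..<a+b}"
      "(skew ^^ n) (g1 * B ^ l2 * A, x2) = (h, x')" "\<bar>x' - z\<bar> \<le> 5 * a"
      using sweep_hits_left[OF st ab 2(2) z, of "g1 * B ^ l2 * A" j] c by blast
    have "(skew ^^ (n + (n2 + n1))) (g, x) = (h, x')" by (simp only: funpow_add o_apply 1(3) 2(3) n(3) g1_def[symmetric])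
    moreover have "real (n + (n2 + n1)) \<le> 3 * ?T"
      using sum3[OF order_trans[OF n(1) T(1)] 2(1) 1(1)] by (simp add: add.assoc)
    ultimately show ?thesis using n by blast
  qed
qed

text \<open>
  A stage at which a run of the continued fraction algorithm begins: \<open>x\<close> is the longer length, and it lies
  on the left if \<open>r\<close> holds. If it lies on the right, the condition \<open>hA \<le> hB\<close> makes the whole base
  climb rigidly to every level of both towers.
\<close>

definition gauss_stage :: "bool \<Rightarrow> real \<Rightarrow> real \<Rightarrow> nat \<Rightarrow> nat \<Rightarrow> quat \<Rightarrow> quat \<Rightarrow> bool" where
  "gauss_stage r x y hA hB A B \<longleftrightarrow> y < x \<and> (if r then stage x y hA hB A B else stage y x hA hB A B \<and> hA \<le> hB)"

lemma gauss_stage_bounds: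
  assumes "gauss_stage r x y hA hB A B"
  shows "0 < y" "y < x" "x + y \<le> 1" "gen_pair A B" "real hA + real hB \<le> 2 / y"
proof -
  from assms obtain a b where st: "stage a b hA hB A B" and "a = x \<and> b = y \<or> a = y \<and> b = x" and "y < x"
    by (auto simp: gauss_stage_def split: if_splits)
  note this stageD[OF st] stage_heights[OF st]
  thus yx: "0 < y" "y < x" "x + y \<le> 1" "gen_pair A B" by auto
  have "1 / x \<le> 1 / y" using yx by (intro divide_left_mono) auto
  moreover have "real hA + real hB \<le> 1 / x + 1 / y"
    using stage_heights(3)[OF st] \<open>a = x \<and> b = y \<or> a = y \<and> b = x\<close> by auto
  moreover have "2 / y = 1 / y + 1 / y" by simp
  ultimately show "real hA + real hB \<le> 2 / y" by linarith
qed

text \<open>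
  A sweep consists of about \<open>x / y\<close> passages through the tower over the longer interval, whose height is
  at most \<open>1 / x\<close> because its area is at most \<open>1\<close>.
\<close>

lemma long_run_hits:
  assumes g: "gauss_stage r x y hA hB A B" and xy: "4 * y \<le> x"
  shows "hits (13 / y) (5 * y)"
proof -
  note b = gauss_stage_bounds[OF g]
  have time: "3 * ((x / y + 1) * h + h') + 2 * (real hA + real hB) \<le> 13 / y"
    if "h * x \<le> 1" "h + h' = real hA + real hB" "0 \<le> h" for h h'
  proof -
    have 1: "x / y * h \<le> 1 / y" using that(1) b by (simp add: field_simps)
    have "3 * ((x / y + 1) * h + h') + 2 * (real hA + real hB) = 3 * (x / y * h) + 5 * (real hA + real hB)"
      unfolding that(2)[symmetric] by (simp add: algebra_simps)
    also have "\<dots> \<le> 3 * (1 / y) + 5 * (2 / y)"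
      by (intro add_mono mult_left_mono 1 b(5)) auto
    finally show ?thesis by simp
  qed
  show ?thesis
  proof (cases r)
    case True
    hence st: "stage x y hA hB A B" using g by (simp add: gauss_stage_def)
    have "0 \<le> y * real hB" using b by simp
    hence "real hA * x \<le> 1" using stageD(12)[OF st] by (simp add: mult.commute)
    from time[OF this, of "real hB"]
    have t: "3 * ((x / y + 1) * real hA + real hB) + 2 * (real hA + real hB) \<le> 13 / y" by simp
    have "hits (3 * ((x / y + 1) * real hA + real hB) + 2 * (real hA + real hB)) (5 * y)"
    proof (rule hits_from_base[OF st HOL.refl])
      fix g h u z assume "u \<in> {0..<x+y}" "z \<in> {0..<x+y}"
      from two_sweeps_right[OF st xy this, of g h]
      show "\<exists>n x'. real n \<le> 3 * ((x / y + 1) * real hA + real hB) \<and> x' \<in> (if hA \<le> hB then {0..<x + y} else {0..<x})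
         \<and> (skew ^^ n) (g, u) = (h, x') \<and> \<bar>x' - z\<bar> \<le> 5 * y" using b by fastforce
    qed
    thus ?thesis using hits_mono t by blast
  next
    case False
    hence st: "stage y x hA hB A B" and le: "hA \<le> hB" using g by (auto simp: gauss_stage_def)
    have "0 \<le> y * real hA" using b by simp
    hence "real hB * x \<le> 1" using stageD(12)[OF st] by (simp add: mult.commute)
    from time[OF this, of "real hA"]
    have t: "3 * ((x / y + 1) * real hB + real hA) + 2 * (real hA + real hB) \<le> 13 / y" by simp
    have "hits (3 * ((x / y + 1) * real hB + real hA) + 2 * (real hA + real hB)) (5 * y)"
    proof (rule hits_from_base[OF st HOL.refl])
      fix g h u z assume "u \<in> {0..<y+x}" "z \<in> {0..<y+x}"
      from two_sweeps_left[OF st xy this, of g h]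
      show "\<exists>n x'. real n \<le> 3 * ((x / y + 1) * real hB + real hA) \<and> x' \<in> (if hA \<le> hB then {0..<y+x} else {0..<y})
         \<and> (skew ^^ n) (g, u) = (h, x') \<and> \<bar>x' - z\<bar> \<le> 5 * y" using le by simp
    qed
    thus ?thesis using hits_mono t by blast
  qed
qed

section \<open>Records of visits along the continued fraction algorithm\<close>

text \<open>
  Labels are recorded as if the two towers of a reference stage had the labels \<open>i\<close> and \<open>j\<close>; the homomorphism
  \<open>\<phi>\<close> translates them into labels on the surface.
\<close>

definition visits :: "(quat \<Rightarrow> quat) \<Rightarrow> real set \<Rightarrow> real set \<Rightarrow> nat \<Rightarrow> quat list \<Rightarrow> bool" where
  "visits \<phi> J D h V \<longleftrightarrow> (\<forall>x\<in>D. \<forall>g. \<forall>v\<in>set V. \<exists>i<h. \<exists>x'\<in>J. (skew ^^ i) (g, x) = (g * \<phi> v, x'))"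

lemma visits_subset: "visits \<phi> J D h V \<Longrightarrow> D' \<subseteq> D \<Longrightarrow> visits \<phi> J D' h V"
  by (auto simp: visits_def)

lemma visits_concat:
  assumes "visits \<phi> J D h U" "visits \<phi> J D' h' V" "moves D h (\<phi> c) d" "\<And>x. x \<in> D \<Longrightarrow> x + d \<in> D'"
    and hom: "\<And>x y. \<phi> (x * y) = \<phi> x * \<phi> y"
  shows "visits \<phi> J D (h + h') (List.union U (map ((*) c) V))"
  unfolding visits_def
proof (intro ballI allI)
  fix x g v assume x: "x \<in> D" and "v \<in> set (List.union U (map ((*) c) V))"
  then consider "v \<in> set U" | w where "w \<in> set V" "v = c * w" by auto
  thus "\<exists>i<h + h'. \<exists>x'\<in>J. (skew ^^ i) (g, x) = (g * \<phi> v, x')"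
  proof cases
    case 1
    then obtain i x' where "i < h" "x' \<in> J" "(skew ^^ i) (g, x) = (g * \<phi> v, x')"
      using assms(1) x unfolding visits_def by blast
    thus ?thesis by (intro exI[of _ i]) auto
  next
    case 2
    then obtain i x' where i: "i < h'" "x' \<in> J" "(skew ^^ i) (g * \<phi> c, x + d) = (g * \<phi> c * \<phi> w, x')"
      using assms(2) assms(4)[OF x] unfolding visits_def by blast
    have "(skew ^^ (i + h)) (g, x) = (g * \<phi> v, x')"
      using i(3) movesD[OF assms(3) x] by (simp add: funpow_add 2 hom mult.assoc)
    thus ?thesis using i by (intro exI[of _ "i + h"]) auto
  qed
qed

lemma stage_run_right:
  assumes st: "stage a b hA hB (\<phi> c) (\<phi> d)" and hom: "\<And>x y. \<phi> (x * y) = \<phi> x * \<phi> y"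
    and U: "visits \<phi> J {0..<a} hA U" and V: "visits \<phi> J {a..<a+b} hB V" and m: "real m * b \<le> a"
    and run: "run_on_right m c d U V = (d', V')"
  shows "stage (a - real m * b) b hA (hB + m * hA) (\<phi> c) (\<phi> d') \<and>
     visits \<phi> J {0..<a - real m * b} hA U \<and>
     visits \<phi> J {a - real m * b..<a - real m * b + b} (hB + m * hA) V'"
  using m run
proof (induction m arbitrary: d' V')
  case 0 thus ?case using assms by simp
next
  case (Suc m)
  obtain d1 V1 where 1: "run_on_right m c d U V = (d1, V1)" by fastforce
  have b: "0 < b" using stageD[OF st] by simp
  have "real m * b \<le> a" using Suc.prems(1) b by (simp add: algebra_simps)
  note IH = Suc.IH[OF this 1]
  define e where "e = a - real m * b"
  have e: "stage e b hA (hB + m * hA) (\<phi> c) (\<phi> d1)" "visits \<phi> J {0..<e} hA U"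
    "visits \<phi> J {e..<e + b} (hB + m * hA) V1" using IH by (auto simp: e_def)
  have "b \<le> e" using Suc.prems(1) by (simp add: e_def algebra_simps)
  hence be: "b < e" using stage_neq[OF e(1)] by simp
  have eq: "d' = c * d1" "V' = List.union U (map ((*) c) V1)" using Suc.prems(2) 1 by auto
  have e': "e - b = a - real (Suc m) * b" by (simp add: e_def algebra_simps)
  have h': "hA + (hB + m * hA) = hB + Suc m * hA" by simp
  have "stage (e - b) b hA (hB + Suc m * hA) (\<phi> c) (\<phi> d')"
    using stage_right[OF e(1) be] by (simp add: eq hom add_ac)
  moreover have "visits \<phi> J {0..<e - b} hA U" by (rule visits_subset[OF e(2)]) (use b in auto)
  moreover have "visits \<phi> J {e - b..<e - b + b} (hA + (hB + m * hA)) V'"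
    unfolding eq
  proof (rule visits_concat[OF _ e(3) _ _ hom])
    show "visits \<phi> J {e - b..<e - b + b} hA U" by (rule visits_subset[OF e(2)]) (use be in auto)
    show "moves {e - b..<e - b + b} hA (\<phi> c) b" by (rule moves_subset[OF stageD(7)[OF e(1)]]) (use be in auto)
  qed auto
  ultimately show ?case unfolding e' h' by blast
qed

lemma stage_run_left:
  assumes st: "stage a b hA hB (\<phi> c) (\<phi> d)" and hom: "\<And>x y. \<phi> (x * y) = \<phi> x * \<phi> y"
    and U: "visits \<phi> J {0..<a} hA U" and V: "visits \<phi> J {a..<a+b} hB V" and m: "real m * a \<le> b"
    and run: "run_on_left m c d U V = (c', U')"
  shows "stage a (b - real m * a) (hA + m * hB) hB (\<phi> c') (\<phi> d) \<and>
     visits \<phi> J {0..<a} (hA + m * hB) U' \<and>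
     visits \<phi> J {a..<a + (b - real m * a)} hB V"
  using m run
proof (induction m arbitrary: c' U')
  case 0 thus ?case using assms by simp
next
  case (Suc m)
  obtain c1 U1 where 1: "run_on_left m c d U V = (c1, U1)" by fastforce
  have a: "0 < a" using stageD[OF st] by simp
  have "real m * a \<le> b" using Suc.prems(1) a by (simp add: algebra_simps)
  note IH = Suc.IH[OF this 1]
  define e where "e = b - real m * a"
  have e: "stage a e (hA + m * hB) hB (\<phi> c1) (\<phi> d)" "visits \<phi> J {0..<a} (hA + m * hB) U1"
    "visits \<phi> J {a..<a + e} hB V" using IH by (auto simp: e_def)
  have "a \<le> e" using Suc.prems(1) by (simp add: e_def algebra_simps)
  hence ae: "a < e" using stage_neq[OF e(1)] by simp
  have eq: "c' = c1 * d" "U' = List.union U1 (map ((*) c1) V)" using Suc.prems(2) 1 by auto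
  have e': "e - a = b - real (Suc m) * a" by (simp add: e_def algebra_simps)
  have h': "hA + m * hB + hB = hA + Suc m * hB" by simp
  have "stage a (e - a) (hA + m * hB + hB) hB (\<phi> c') (\<phi> d)"
    using stage_left[OF e(1) ae] by (simp add: eq hom)
  moreover have "visits \<phi> J {a..<a + (e - a)} hB V" by (rule visits_subset[OF e(3)]) (use a in auto)
  moreover have "visits \<phi> J {0..<a} (hA + m * hB + hB) U'"
    unfolding eq
  proof (rule visits_concat[OF e(2) _ stageD(7)[OF e(1)] _ hom])
    show "visits \<phi> J {e..<a + e} hB V" by (rule visits_subset[OF e(3)]) (use ae in auto)
  qed auto
  ultimately show ?case unfolding e' h' by blast
qed

text \<open>
  The list \<open>U\<close> belongs to the left tower and \<open>V\<close> to the right one, on whichever side the longer interval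
  \<open>x\<close> lies.
\<close>

definition tower_visits :: "(quat \<Rightarrow> quat) \<Rightarrow> real set \<Rightarrow> bool \<Rightarrow> real \<Rightarrow> real \<Rightarrow> nat \<Rightarrow> nat \<Rightarrow> quat list \<Rightarrow> quat list \<Rightarrow> bool" where
  "tower_visits \<phi> J r x y hA hB U V \<longleftrightarrow>
     (if r then visits \<phi> J {0..<x} hA U \<and> visits \<phi> J {x..<x+y} hB V
      else visits \<phi> J {0..<y} hA U \<and> visits \<phi> J {y..<y+x} hB V)"

text \<open>
  The longer length is reduced modulo the shorter one, which becomes the longer length on the other side.
  The remainder is positive because lengths of a stage are never equal.
\<close>

lemma gauss_step:
  assumes g: "gauss_stage r x y hA hB (\<phi> c) (\<phi> d)" and hom: "\<And>x y. \<phi> (x * y) = \<phi> x * \<phi> y"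
    and vis: "tower_visits \<phi> J r x y hA hB U V"
  defines "m \<equiv> nat \<lfloor>x / y\<rfloor>"
  obtains y' hA' hB' where "1 \<le> m" "hA + hB < hA' + hB'"
    "r \<Longrightarrow> run_on_right m c d U V = (d', V') \<Longrightarrow>
       gauss_stage False y y' hA' hB' (\<phi> c) (\<phi> d') \<and> tower_visits \<phi> J False y y' hA' hB' U V'"
    "\<not> r \<Longrightarrow> run_on_left m c d U V = (c', U') \<Longrightarrow>
       gauss_stage True y y' hA' hB' (\<phi> c') (\<phi> d) \<and> tower_visits \<phi> J True y y' hA' hB' U' V"
proof -
  note b = gauss_stage_bounds[OF g]
  have "1 < x / y" using b by simp
  hence m: "1 \<le> m" "real m \<le> x / y" "x / y < real m + 1" unfolding m_def by linarith+
  hence my: "real m * y \<le> x" "x - real m * y < y" using b by (auto simp: field_simps)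
  show ?thesis
  proof (cases r)
    case True
    hence st: "stage x y hA hB (\<phi> c) (\<phi> d)" "visits \<phi> J {0..<x} hA U" "visits \<phi> J {x..<x+y} hB V"
      using g vis by (auto simp: gauss_stage_def tower_visits_def)
    have *: "gauss_stage False y (x - real m * y) hA (hB + m * hA) (\<phi> c) (\<phi> d') \<and>
        tower_visits \<phi> J False y (x - real m * y) hA (hB + m * hA) U V'" if "run_on_right m c d U V = (d', V')" for d' V'
    proof -
      have "1 * hA \<le> m * hA" using m by (intro mult_right_mono) auto
      hence "hA \<le> hB + m * hA" by linarith
      thus ?thesis using stage_run_right[OF st(1) hom st(2,3) my(1) that] my(2)
        by (simp add: gauss_stage_def tower_visits_def)
    qed
    show ?thesis
      by (rule that[of hA "hB + m * hA" "x - real m * y"])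
         (use True m stageD[OF st(1)] * in auto)
  next
    case False
    hence st: "stage y x hA hB (\<phi> c) (\<phi> d)" "visits \<phi> J {0..<y} hA U" "visits \<phi> J {y..<y+x} hB V"
      using g vis by (auto simp: gauss_stage_def tower_visits_def)
    have *: "gauss_stage True y (x - real m * y) (hA + m * hB) hB (\<phi> c') (\<phi> d) \<and>
        tower_visits \<phi> J True y (x - real m * y) (hA + m * hB) hB U' V" if "run_on_left m c d U V = (c', U')" for c' U'
      using stage_run_left[OF st(1) hom st(2,3) my(1) that] my(2)
      by (simp add: gauss_stage_def tower_visits_def)
    show ?thesis
      by (rule that[of "hA + m * hB" hB "x - real m * y"])
         (use False m stageD[OF st(1)] * in auto)
  qed
qed

end

context quat_rotation
begin

section \<open>Hitting times of the skew product\<close>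

definition badly_approx :: "real \<Rightarrow> real \<Rightarrow> bool" where
  "badly_approx c w \<longleftrightarrow> 0 < c \<and> 0 \<le> w \<and> (\<forall>q::nat. \<forall>p::int. 0 < q \<longrightarrow> c * real q powr - w \<le> \<bar>real q * \<alpha> - of_int p\<bar>)"

text \<open>
  If \<open>h\<close> is the height of the tower over the longer interval, then \<open>h \<alpha>\<close> has distance \<open>y\<close> from an integer,
  and \<open>h \<le> 1 / x\<close>.
\<close>

lemma gauss_stage_short_side:
  assumes g: "gauss_stage r x y hA hB A B" and ba: "badly_approx c w"
  shows "c * x powr w \<le> y"
proof -
  note b = gauss_stage_bounds[OF g]
  have key: "c * x powr w \<le> \<bar>real h * \<alpha> - of_int p\<bar>" if "real h \<le> 1 / x" "0 < h" for h :: nat and p :: int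
  proof -
    have "x \<le> 1 / real h" using that b by (simp add: field_simps)
    hence "x powr w \<le> (1 / real h) powr w" using b ba by (intro powr_mono2) (auto simp: badly_approx_def)
    also have "\<dots> = real h powr - w" by (simp add: powr_divide powr_minus_divide)
    finally have "c * x powr w \<le> c * real h powr - w"
      using ba by (intro mult_left_mono) (auto simp: badly_approx_def)
    also have "\<dots> \<le> \<bar>real h * \<alpha> - of_int p\<bar>" using ba that(2) by (simp add: badly_approx_def)
    finally show ?thesis .
  qed
  show ?thesis
  proof (cases r)
    case True
    hence st: "stage x y hA hB A B" using g by (simp add: gauss_stage_def)
    then obtain m :: int where "y = real hA * \<alpha> - of_int m" by (auto simp: stage_def)
    with key[of hA m] stage_heights[OF st] stageD[OF st] show ?thesis by simp
  next
    case False
    hence st: "stage y x hA hB A B" using g by (simp add: gauss_stage_def)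
    then obtain m :: int where "y = of_int m - real hB * \<alpha>" by (auto simp: stage_def)
    with key[of hB m] stage_heights[OF st] stageD[OF st] show ?thesis by (simp add: abs_minus_commute)
  qed
qed

lemma eight_labels_all:
  assumes "length (remdups U) = 8" shows "v \<in> set (U :: quat list)"
proof -
  have "card (set U) = card (UNIV :: quat set)" using assms by (simp add: length_remdups_card_conv card_quat)
  hence "set U = UNIV" using card_subset_eq[of UNIV "set U"] by auto
  thus ?thesis by simp
qed

text \<open>
  Every orbit soon passes through a complete tower of the later stage, and there it meets the part \<open>J\<close> of
  the base of the reference stage with every label.
\<close>

lemma full_visits_hit:
  assumes ref: "stage a b kA kB A B" "J \<subseteq> (if kA \<le> kB then {0..<a+b} else {0..<a})"
    and g: "gauss_stage r x y hA hB C D" and vis: "tower_visits \<phi> J r x y hA hB U V"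
    and full: "length (remdups U) = 8" "length (remdups V) = 8" and surj: "surj \<phi>"
  shows "hits (4 / y + 2 * (real kA + real kB)) (a + b)"
proof -
  note b = gauss_stage_bounds[OF g] note s = stageD[OF ref(1)]
  obtain a' b' where st: "stage a' b' hA hB C D"
    and v: "visits \<phi> J {0..<a'} hA U" "visits \<phi> J {a'..<a'+b'} hB V"
    using g vis by (auto simp: gauss_stage_def tower_visits_def split: if_splits)
  have "hits (2 * (real hA + real hB) + 2 * (real kA + real kB)) (a + b)"
  proof (rule hits_from_base[OF ref(1) HOL.refl])
    fix g h u z assume u: "u \<in> {0..<a+b}" and z: "z \<in> {0..<a+b}"
    have "u \<in> {0..<1}" using u s by auto
    then obtain n where n: "n \<le> hA + hB" "snd ((skew ^^ n) (g, u)) \<in> {0..<a'+b'}"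
      using reach_base[OF st] by blast
    obtain g1 u1 where 1: "(skew ^^ n) (g, u) = (g1, u1)" by fastforce
    obtain k where k: "h = g1 * k" using quat_divide by blast
    obtain w where w: "k = \<phi> w" using surj by blast
    have "\<exists>i\<le>hA + hB. \<exists>x'\<in>J. (skew ^^ i) (g1, u1) = (g1 * \<phi> w, x')"
    proof (cases "u1 < a'")
      case True
      hence "u1 \<in> {0..<a'}" using n 1 by auto
      then obtain i x' where "i < hA" "x' \<in> J" "(skew ^^ i) (g1, u1) = (g1 * \<phi> w, x')"
        using v(1) eight_labels_all[OF full(1)] unfolding visits_def by blast
      thus ?thesis by (intro exI[of _ i]) auto
    next
      case False
      hence "u1 \<in> {a'..<a'+b'}" using n 1 by auto
      then obtain i x' where "i < hB" "x' \<in> J" "(skew ^^ i) (g1, u1) = (g1 * \<phi> w, x')"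
        using v(2) eight_labels_all[OF full(2)] unfolding visits_def by blast
      thus ?thesis by (intro exI[of _ i]) auto
    qed
    then obtain i x' where i: "i \<le> hA + hB" "x' \<in> J" "(skew ^^ i) (g1, u1) = (h, x')" unfolding k w by blast
    have "(skew ^^ (i + n)) (g, u) = (h, x')" by (simp only: funpow_add o_apply 1 i(3))
    moreover have "real (i + n) \<le> 2 * (real hA + real hB)" using i n by simp
    moreover have x': "x' \<in> (if kA \<le> kB then {0..<a+b} else {0..<a})" using ref(2) i(2) by blast
    moreover have "x' \<in> {0..<a+b}" using x' s by (auto split: if_splits)
    hence "\<bar>x' - z\<bar> \<le> a + b" using z unfolding atLeastLessThan_iff by linarith
    ultimately show "\<exists>n x'. real n \<le> 2 * (real hA + real hB) \<and> x' \<in> (if kA \<le> kB then {0..<a + b} else {0..<a})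
       \<and> (skew ^^ n) (g, u) = (h, x') \<and> \<bar>x' - z\<bar> \<le> a + b" by blast
  qed
  moreover have "2 * (real hA + real hB) \<le> 2 * (2 / y)" using b(5) by (intro mult_left_mono) auto
  ultimately show ?thesis by (elim hits_mono) auto
qed

text \<open>
  Either the towers already visit everything, or the current quotient is at least \<open>4\<close> and sweeping applies,
  or the quotient is \<open>1\<close>, \<open>2\<close> or \<open>3\<close> and the next of the \<open>k\<close> runs is recorded. In the last case the longer
  length shrinks by a factor of at most \<open>4\<close>, so it stays above \<open>M\<close> throughout.
\<close>

lemma covering_hits:
  assumes ba: "badly_approx c w" and hom: "\<And>x y. \<phi> (x * y) = \<phi> x * \<phi> y" and surj: "surj \<phi>"
    and ref: "stage a b kA kB A B" "J \<subseteq> (if kA \<le> kB then {0..<a+b} else {0..<a})"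
    and "covering k r C D U V"
    and "gauss_stage r x y hA hB (\<phi> C) (\<phi> D)" "tower_visits \<phi> J r x y hA hB U V"
    and "0 < M" "4 ^ k * M \<le> x" "x \<le> a + b"
  shows "hits (13 / (c * M powr w) + 2 * (real kA + real kB)) (5 * (a + b))"
  using assms(6-)
proof (induction k arbitrary: r C D U V x y hA hB)
  case 0
  note b = gauss_stage_bounds[OF 0(2)]
  have "c * M powr w \<le> c * x powr w"
    using 0 ba b by (intro mult_left_mono powr_mono2) (auto simp: badly_approx_def)
  also have "\<dots> \<le> y" by (rule gauss_stage_short_side[OF 0(2) ba])
  finally have "4 / y \<le> 13 / (c * M powr w)"
    using ba 0 b by (intro frac_le) (auto simp: badly_approx_def)
  moreover have "hits (4 / y + 2 * (real kA + real kB)) (a + b)"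
    using full_visits_hit[OF ref 0(2,3) _ _ surj] 0(1) by simp
  ultimately show ?case using stageD[OF ref(1)] by (elim hits_mono) auto
next
  case (Suc k)
  note b = gauss_stage_bounds[OF Suc.prems(2)]
  have "1 * M \<le> 4 ^ Suc k * M" using Suc.prems by (intro mult_right_mono one_le_power) auto
  hence Mx: "M \<le> x" using Suc.prems by linarith
  have "c * M powr w \<le> c * x powr w"
    using Mx Suc.prems ba by (intro mult_left_mono powr_mono2) (auto simp: badly_approx_def)
  also have "\<dots> \<le> y" by (rule gauss_stage_short_side[OF Suc.prems(2) ba])
  finally have cy: "c * M powr w \<le> y" .
  have c0: "0 < c * M powr w" using ba Suc.prems by (auto simp: badly_approx_def)
  have s: "0 < a" "0 < b" using stageD[OF ref(1)] by auto
  consider "length (remdups U) = 8 \<and> length (remdups V) = 8" | "4 * y \<le> x"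
    | "x < 4 * y" "\<not> (length (remdups U) = 8 \<and> length (remdups V) = 8)" by linarith
  thus ?case
  proof cases
    case 1
    have "4 / y \<le> 13 / (c * M powr w)" using cy c0 b by (intro frac_le) auto
    moreover have "hits (4 / y + 2 * (real kA + real kB)) (a + b)"
      using full_visits_hit[OF ref Suc.prems(2,3) _ _ surj] 1 by simp
    ultimately show ?thesis using s by (elim hits_mono) auto
  next
    case 2
    have "13 / y \<le> 13 / (c * M powr w)" using cy c0 b by (intro frac_le) auto
    moreover have "5 * y \<le> 5 * (a + b)" using b Suc.prems(6) by simp
    ultimately show ?thesis using long_run_hits[OF Suc.prems(2) 2] by (elim hits_mono) auto
  next
    case 3
    define m where "m = nat \<lfloor>x / y\<rfloor>"
    have "x / y < 4" using 3 b by (simp add: field_simps)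
    hence m4: "m < 4" unfolding m_def by linarith
    have My: "4 ^ k * M \<le> y" using Suc.prems(5) 3 by simp
    have ya: "y \<le> a + b" using b Suc.prems(6) by simp
    show ?thesis
    proof (cases r)
      case True
      obtain d' V' where run: "run_on_right m C D U V = (d', V')" by fastforce
      obtain y' hA' hB' where *: "1 \<le> m" "gauss_stage False y y' hA' hB' (\<phi> C) (\<phi> d')"
        "tower_visits \<phi> J False y y' hA' hB' U V'"
        by (rule gauss_step[OF Suc.prems(2) hom Suc.prems(3), where d' = d' and V' = V']) (use True run in \<open>auto simp: m_def\<close>)
      have "m \<in> {1, 2, 3}" using *(1) m4 by auto
      hence "covering k False C d' U V'" using Suc.prems(1) 3(2) True run by auto
      from Suc.IH[OF this *(2,3) Suc.prems(4) My ya] show ?thesis .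
    next
      case False
      obtain c' U' where run: "run_on_left m C D U V = (c', U')" by fastforce
      obtain y' hA' hB' where *: "1 \<le> m" "gauss_stage True y y' hA' hB' (\<phi> c') (\<phi> D)"
        "tower_visits \<phi> J True y y' hA' hB' U' V"
        by (rule gauss_step[OF Suc.prems(2) hom Suc.prems(3), where c' = c' and U' = U']) (use False run in \<open>auto simp: m_def\<close>)
      have "m \<in> {1, 2, 3}" using *(1) m4 by auto
      hence "covering k True c' D U' V" using Suc.prems(1) 3(2) False run by auto
      from Suc.IH[OF this *(2,3) Suc.prems(4) My ya] show ?thesis .
    qed
  qed
qed

lemma gauss_step_exists:
  assumes g: "gauss_stage r x y hA hB A B"
  obtains y' hA' hB' A' B' where "gauss_stage (\<not> r) y y' hA' hB' A' B'" "hA + hB < hA' + hB'"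
proof -
  have gp: "gen_pair A B" using gauss_stage_bounds[OF g] by simp
  let ?\<phi> = "quat_hom A B"
  have \<phi>: "?\<phi> qi = A" "?\<phi> qj = B" by (simp_all add: qi_def qj_def)
  note hom = quat_hom_mult[OF gp]
  have g': "gauss_stage r x y hA hB (?\<phi> qi) (?\<phi> qj)" using g by (simp add: \<phi>)
  have v: "tower_visits ?\<phi> {} r x y hA hB [] []" by (simp add: tower_visits_def visits_def)
  obtain c1 U1 where 1: "run_on_right (nat \<lfloor>x / y\<rfloor>) qi qj [] [] = (c1, U1)" by fastforce
  obtain c2 U2 where 2: "run_on_left (nat \<lfloor>x / y\<rfloor>) qi qj [] [] = (c2, U2)" by fastforce
  show ?thesis
    by (rule gauss_step[OF g' hom v, where d' = c1 and V' = U1 and c' = c2 and U' = U2]; cases r) (use 1 2 that in auto)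
qed

lemma gauss_stage_init: "\<exists>r x y hA hB A B. gauss_stage r x y hA hB A B \<and> 1 / 2 \<le> x"
proof -
  obtain A B where st: "stage (1 - frac \<alpha>) (frac \<alpha>) 1 1 A B" using stage_init by blast
  show ?thesis
  proof (cases "frac \<alpha> < 1 - frac \<alpha>")
    case True
    hence "gauss_stage True (1 - frac \<alpha>) (frac \<alpha>) 1 1 A B" using st by (simp add: gauss_stage_def)
    thus ?thesis using True by (intro exI conjI) auto
  next
    case False
    hence "1 - frac \<alpha> < frac \<alpha>" using stage_neq[OF st] by simp
    hence "gauss_stage False (frac \<alpha>) (1 - frac \<alpha>) 1 1 A B" using st by (simp add: gauss_stage_def)
    thus ?thesis using False by (intro exI conjI) auto
  qed
qed

text \<open>
  As long as both lengths exceed \<open>\<rho>\<close>, both heights are below \<open>1 / \<rho>\<close>; but their sum grows with every run.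
\<close>

lemma gauss_stage_at_scale:
  assumes "0 < \<rho>" "\<rho> < 1 / 2"
  shows "\<exists>r x y hA hB A B. gauss_stage r x y hA hB A B \<and> \<rho> < x \<and> y \<le> \<rho>"
proof (rule ccontr)
  assume contra: "\<not> ?thesis"
  have "\<exists>r x y hA hB A B. gauss_stage r x y hA hB A B \<and> \<rho> < x \<and> n \<le> hA + hB" for n
  proof (induction n)
    case 0
    obtain r x y hA hB A B where "gauss_stage r x y hA hB A B" "1 / 2 \<le> x" using gauss_stage_init by blast
    moreover have "\<rho> < x" using assms \<open>1 / 2 \<le> x\<close> by simp
    ultimately show ?case by blast
  next
    case (Suc n)
    then obtain r x y hA hB A B where 1: "gauss_stage r x y hA hB A B" "\<rho> < x" "n \<le> hA + hB" by blast
    hence y: "\<rho> < y" using contra by (meson not_le)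
    obtain y' hA' hB' A' B' where "gauss_stage (\<not> r) y y' hA' hB' A' B'" "hA + hB < hA' + hB'"
      by (rule gauss_step_exists[OF 1(1)])
    moreover have "Suc n \<le> hA' + hB'" using calculation 1 by simp
    ultimately show ?case using y by blast
  qed
  then obtain r x y hA hB A B where 1: "gauss_stage r x y hA hB A B" "\<rho> < x" "nat \<lceil>2 / \<rho>\<rceil> + 1 \<le> hA + hB" by blast
  hence "\<rho> < y" using contra by (meson not_le)
  hence "2 / y \<le> 2 / \<rho>" using assms by (intro frac_le) auto
  hence "real (hA + hB) \<le> 2 / \<rho>" using gauss_stage_bounds(5)[OF 1(1)] by simp
  thus False using 1(3) by linarith
qed

text \<open>
  Take the stage whose lengths are separated by \<open>\<rho>\<close>. If its quotient is at least \<open>4\<close>, sweep. Otherwise the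
  shorter length exceeds \<open>\<rho> / 4\<close>, and the next stage is the reference stage for seven further runs; all
  longer lengths that matter are at least \<open>\<rho> / 4\<^bsup>8\<^esup>\<close>.
\<close>

lemma hits_at_all_scales:
  assumes ba: "badly_approx c w" and \<rho>: "0 < \<rho>" "\<rho> < 1 / 2"
  shows "hits (17 / (c * (\<rho> / 4 ^ 8) powr w)) (10 * \<rho>)"
proof -
  obtain r x y hA hB A B where g: "gauss_stage r x y hA hB A B" "\<rho> < x" "y \<le> \<rho>" using gauss_stage_at_scale[OF \<rho>] by blast
  note b = gauss_stage_bounds[OF g(1)]
  let ?M = "\<rho> / 4 ^ 8"
  have M0: "0 < ?M" using \<rho> by simp
  have c0: "0 < c * ?M powr w" using ba \<rho> by (auto simp: badly_approx_def)
  have le: "c * ?M powr w \<le> y" if "gauss_stage r x y hA hB A B" "?M \<le> x" for r x y hA hB A B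
  proof -
    have "c * ?M powr w \<le> c * x powr w"
      using that M0 ba by (intro mult_left_mono powr_mono2) (auto simp: badly_approx_def)
    also have "\<dots> \<le> y" by (rule gauss_stage_short_side[OF that(1) ba])
    finally show ?thesis .
  qed
  show ?thesis
  proof (cases "4 * y \<le> x")
    case True
    have "?M \<le> x" using g(2) \<rho> by simp
    hence "13 / y \<le> 17 / (c * ?M powr w)" using c0 b le[OF g(1)] by (intro frac_le) auto
    moreover have "5 * y \<le> 10 * \<rho>" using g(3) \<rho> by simp
    ultimately show ?thesis using long_run_hits[OF g(1) True] hits_mono by blast
  next
    case False
    hence y: "\<rho> / 4 < y" using g(2) by simp
    obtain y' kA kB C D where g': "gauss_stage (\<not> r) y y' kA kB C D" by (rule gauss_step_exists[OF g(1)])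
    note b' = gauss_stage_bounds[OF g']
    have gp: "gen_pair C D" using b' by simp
    let ?\<phi> = "quat_hom C D"
    have \<phi>: "?\<phi> qi = C" "?\<phi> qj = D" "?\<phi> 1 = 1" by (simp_all add: qi_def qj_def one_quat_def)
    have surj: "surj ?\<phi>" by (rule surjI[of _ "\<lambda>y. SOME x. ?\<phi> x = y"]) (rule someI_ex, rule quat_hom_surj[OF gp])
    have M: "4 ^ 7 * ?M \<le> y" using y by simp
    have fin: "hits (17 / (c * ?M powr w)) (10 * \<rho>)"
      if "hits (13 / (c * ?M powr w) + 2 * (real kA + real kB)) (5 * (y + y'))"
    proof -
      have "?M \<le> y" using y \<rho> by simp
      hence "2 * (2 / y') \<le> 4 / (c * ?M powr w)" using c0 b' le[OF g'] by (simp add: frac_le)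
      moreover have "2 * (real kA + real kB) \<le> 2 * (2 / y')" by (rule mult_left_mono[OF b'(5)]) simp
      ultimately have "2 * (real kA + real kB) \<le> 4 / (c * ?M powr w)" by (rule order_trans[rotated])
      hence "13 / (c * ?M powr w) + 2 * (real kA + real kB) \<le> 13 / (c * ?M powr w) + 4 / (c * ?M powr w)"
        by (rule add_left_mono)
      also have "\<dots> = 17 / (c * ?M powr w)" by (simp add: add_divide_distrib[symmetric])
      finally show ?thesis by (rule hits_mono[OF that]) (use g(3) b'(2) in simp)
    qed
    show ?thesis
    proof (cases r)
      case False
      hence gr: "gauss_stage True y y' kA kB (?\<phi> qi) (?\<phi> qj)" using g' \<phi> by simp
      hence st: "stage y y' kA kB C D" using \<phi> by (simp add: gauss_stage_def)
      have J: "{0..<y} \<subseteq> (if kA \<le> kB then {0..<y+y'} else {0..<y})" using b' by auto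
      have v: "tower_visits ?\<phi> {0..<y} True y y' kA kB [1] []"
        using stageD(4)[OF st] by (auto simp: tower_visits_def visits_def \<phi> intro!: exI[of _ 0])
      show ?thesis
        by (rule fin, rule covering_hits[OF ba quat_hom_mult[OF gp] surj st J covering_right gr v M0 M])
           (use b' in simp)
    next
      case True
      hence gr: "gauss_stage False y y' kA kB (?\<phi> qi) (?\<phi> qj)" using g' \<phi> by simp
      hence st: "stage y' y kA kB C D" "kA \<le> kB" using \<phi> by (auto simp: gauss_stage_def)
      have J: "{0..<y'+y} \<subseteq> (if kA \<le> kB then {0..<y'+y} else {0..<y'})" using st by auto
      have v: "tower_visits ?\<phi> {0..<y'+y} False y y' kA kB [1] [1]"
        using stageD(4,5)[OF st(1)] b' by (auto simp: tower_visits_def visits_def \<phi> intro!: exI[of _ 0])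
      have "hits (13 / (c * ?M powr w) + 2 * (real kA + real kB)) (5 * (y' + y))"
        by (rule covering_hits[OF ba quat_hom_mult[OF gp] surj st(1) J covering_left gr v M0 M])
           (use b' in simp)
      thus ?thesis using fin by (simp add: add.commute)
    qed
  qed
qed

end

section \<open>The flow and its first return map\<close>

lemma squares_iff [simp]: "(g, u, v) \<in> squares \<longleftrightarrow> 0 \<le> u \<and> u \<le> 1 \<and> 0 \<le> v \<and> v \<le> 1"
  by (auto simp: squares_def)

lemma glue_squares: "(a, b) \<in> glue \<Longrightarrow> a \<in> squares \<and> b \<in> squares"
  by (cases a rule: prod_cases3; cases b rule: prod_cases3) (auto elim!: glue.cases)

lemma EW_proj_eq_iff:
  assumes "a \<in> squares" "b \<in> squares"
  shows "EW_proj a = EW_proj b \<longleftrightarrow> (a, b) \<in> EW_rel"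
  unfolding EW_proj_def using eq_equiv_class_iff[OF equiv_EW_rel assms] .

lemma EW_proj_glue: "(a, b) \<in> glue \<Longrightarrow> EW_proj a = EW_proj b"
  using glue_squares EW_proj_eq_iff by (auto simp: EW_rel_def)

lemma mem_EW_proj: "a \<in> squares \<Longrightarrow> a \<in> EW_proj a"
  unfolding EW_proj_def by (simp add: EW_rel_def)

lemma mem_EW_proj_iff: "b \<in> EW_proj a \<longleftrightarrow> (a, b) \<in> EW_rel"
  by (simp add: EW_proj_def)

lemma EW_cases:
  assumes "p \<in> EW" obtains g z where "(g, z) \<in> squares" "p = EW_proj (g, z)"
  using assms unfolding EW_def EW_proj_def by (auto elim!: quotientE)

lemma glue_corner: "(a, b) \<in> glue \<Longrightarrow> snd a \<in> {0, 1} \<times> {0, 1} \<longleftrightarrow> snd b \<in> {0, 1} \<times> {0, 1}"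
  by (cases a rule: prod_cases3; cases b rule: prod_cases3) (auto elim!: glue.cases)

lemma EW_rel_corner:
  assumes "(a, b) \<in> EW_rel"
  shows "snd a \<in> {0, 1} \<times> {0, 1} \<longleftrightarrow> snd b \<in> {0, 1} \<times> {0, 1}"
proof -
  have "(a, b) \<in> (glue \<union> glue\<inverse>)\<^sup>*" using assms by (simp add: EW_rel_def)
  thus ?thesis
  proof (induction rule: rtrancl_induct)
    case (step y z)
    from step.hyps(2) have "(y, z) \<in> glue \<or> (z, y) \<in> glue" by auto
    hence "snd y \<in> {0, 1} \<times> {0, 1} \<longleftrightarrow> snd z \<in> {0, 1} \<times> {0, 1}" using glue_corner by metis
    with step.IH show ?case by (rule trans)
  qed simp
qed

lemma not_singular:
  assumes "(g, z) \<in> squares" "z \<notin> {0, 1} \<times> {0, 1}"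
  shows "EW_proj (g, z) \<notin> EW_singular"
proof
  assume "EW_proj (g, z) \<in> EW_singular"
  then obtain b where b: "EW_proj (g, z) = EW_proj b" "b \<in> UNIV \<times> {0, 1} \<times> {0, 1}"
    by (auto simp: EW_singular_def)
  moreover have "b \<in> squares" using b(2) by (auto simp: squares_def)
  ultimately have "((g, z), b) \<in> EW_rel" using EW_proj_eq_iff assms(1) by blast
  from EW_rel_corner[OF this] b(2) assms(2) show False by auto
qed

lemma EW_flow_trans:
  assumes "EW_flow \<theta> t p q" "EW_flow \<theta> t' q q'"
  shows "EW_flow \<theta> (t + t') p q'"
  using assms
proof (induction rule: EW_flow.induct)
  case (segment s g z t q)
  thus ?case using EW_flow.segment[of s g z \<theta> "t + t'" q'] by (simp add: add.assoc)
qed simp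

lemma EW_broken_line_nonneg: "EW_broken_line p q l \<Longrightarrow> 0 \<le> l"
  by (induction rule: EW_broken_line.induct) auto

lemma EW_dist_le_same_square:
  assumes "(g, z) \<in> squares" "(g, z') \<in> squares"
  shows "EW_dist (EW_proj (g, z)) (EW_proj (g, z')) \<le> dist z z'"
  unfolding EW_dist_def
proof (rule cInf_lower)
  show "dist z z' \<in> {l. EW_broken_line (EW_proj (g, z)) (EW_proj (g, z')) l}"
    using EW_broken_line.segment[OF assms EW_broken_line.refl] assms(2) EW_proj_in_EW by force
  show "bdd_below {l. EW_broken_line (EW_proj (g, z)) (EW_proj (g, z')) l}"
    using EW_broken_line_nonneg by (intro bdd_belowI[of _ 0]) auto
qed

text \<open>
  Reflecting the squares, if necessary, turns the direction into one of the first quadrant. The signs of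
  \<open>sin \<theta>\<close> and \<open>cos \<theta>\<close> then only affect the coordinates of \<open>chart\<close> and the elements \<open>X\<close> and \<open>Y\<close> by which
  the label changes across a vertical and a horizontal edge.
\<close>

locale irrational_direction =
  fixes \<theta> :: real
  assumes irr: "tan \<theta> \<notin> \<rat>"
begin

definition "c \<equiv> \<bar>cos \<theta>\<bar>"
definition "\<alpha> \<equiv> \<bar>tan \<theta>\<bar>"
definition "X \<equiv> (if 0 < sin \<theta> then qi else - qi)"
definition "Y \<equiv> (if 0 < cos \<theta> then qj else - qj)"
definition reflx :: "real \<Rightarrow> real" where "reflx u = (if 0 < sin \<theta> then u else 1 - u)"
definition refly :: "real \<Rightarrow> real" where "refly v = (if 0 < cos \<theta> then v else 1 - v)"
definition chart :: "quat \<Rightarrow> real \<Rightarrow> real \<Rightarrow> EW_point" where "chart g u v = EW_proj (g, reflx u, refly v)"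

lemma direction_nz: "cos \<theta> \<noteq> 0" "sin \<theta> \<noteq> 0" "tan \<theta> \<noteq> 0"
  using irr by (auto simp: tan_def)

lemma c_pos: "0 < c" using direction_nz by (simp add: c_def)

lemma sin_\<alpha>: "\<bar>sin \<theta>\<bar> = \<alpha> * c"
  using direction_nz by (simp add: c_def \<alpha>_def tan_def abs_divide)

sublocale quat_rotation \<alpha> X Y
proof
  show "0 < \<alpha>" using direction_nz by (simp add: \<alpha>_def)
  show "\<alpha> \<notin> \<rat>" using irr by (auto simp: \<alpha>_def abs_if split: if_splits)
  show "gen_pair X Y" by (simp add: gen_pair_def X_def Y_def quat_arith)
qed

lemma refl_squares: "(g, reflx u, refly v) \<in> squares \<longleftrightarrow> 0 \<le> u \<and> u \<le> 1 \<and> 0 \<le> v \<and> v \<le> 1"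
  by (auto simp: reflx_def refly_def)

lemma chart_not_singular:
  assumes "0 \<le> u" "u \<le> 1" "0 \<le> v" "v \<le> 1" "(u \<noteq> 0 \<and> u \<noteq> 1) \<or> (v \<noteq> 0 \<and> v \<noteq> 1)"
  shows "chart g u v \<notin> EW_singular"
  unfolding chart_def by (rule not_singular) (use assms in \<open>auto simp: reflx_def refly_def split: if_splits\<close>)

lemma chart_right: "0 \<le> v \<Longrightarrow> v \<le> 1 \<Longrightarrow> chart g 1 v = chart (g * X) 0 v"
proof -
  assume v: "0 \<le> v" "v \<le> 1"
  hence w: "0 \<le> refly v" "refly v \<le> 1" by (auto simp: refly_def)
  show ?thesis
  proof (cases "0 < sin \<theta>")
    case True
    thus ?thesis using EW_proj_glue[OF glue.right[OF w]] by (simp add: chart_def X_def reflx_def)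
  next
    case False
    have "g * (- qi) * qi = g" by (simp add: mult.assoc quat_relations(1))
    thus ?thesis using EW_proj_glue[OF glue.right[OF w, of "g * (- qi)"]] False by (simp add: chart_def X_def reflx_def)
  qed
qed

lemma chart_top: "0 \<le> u \<Longrightarrow> u \<le> 1 \<Longrightarrow> chart g u 1 = chart (g * Y) u 0"
proof -
  assume u: "0 \<le> u" "u \<le> 1"
  hence w: "0 \<le> reflx u" "reflx u \<le> 1" by (auto simp: reflx_def)
  show ?thesis
  proof (cases "0 < cos \<theta>")
    case True
    thus ?thesis using EW_proj_glue[OF glue.top[OF w]] by (simp add: chart_def Y_def refly_def)
  next
    case False
    have "g * (- qj) * qj = g" by (simp add: mult.assoc quat_relations(2))
    thus ?thesis using EW_proj_glue[OF glue.top[OF w, of "g * (- qj)"]] False by (simp add: chart_def Y_def refly_def)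
  qed
qed

lemma flow_in_square:
  assumes "0 \<le> u" "u \<le> u'" "u' \<le> 1" "0 \<le> v" "v \<le> v'" "v' \<le> 1" "u' - u = (v' - v) * \<alpha>"
    and "chart g u v \<notin> EW_singular" "chart g u' v' \<notin> EW_singular"
  shows "EW_flow \<theta> ((v' - v) / c) (chart g u v) (chart g u' v')"
proof -
  define d where "d = (v' - v) / c"
  have d: "0 \<le> d" "v' = v + d * c" using assms c_pos by (auto simp: d_def)
  have du: "u' = u + d * \<bar>sin \<theta>\<bar>" using assms(7) d by (simp add: sin_\<alpha> mult_ac)
  have z: "(reflx u', refly v') = (reflx u, refly v) + d *\<^sub>R (sin \<theta>, cos \<theta>)"
    using du d(2) by (auto simp: reflx_def refly_def c_def)
  have "EW_flow \<theta> (d + 0) (chart g u v) (chart g u' v')"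
    unfolding chart_def z
  proof (rule EW_flow.segment[OF d(1)])
    show "(g, reflx u, refly v) \<in> squares" "(g, (reflx u, refly v) + d *\<^sub>R (sin \<theta>, cos \<theta>)) \<in> squares"
      using assms unfolding z[symmetric] refl_squares by auto
    show "EW_proj (g, reflx u, refly v) \<notin> EW_singular" using assms by (simp add: chart_def)
    show "EW_flow \<theta> 0 (EW_proj (g, (reflx u, refly v) + d *\<^sub>R (sin \<theta>, cos \<theta>)))
       (EW_proj (g, (reflx u, refly v) + d *\<^sub>R (sin \<theta>, cos \<theta>)))"
      unfolding z[symmetric] using assms by (intro EW_flow.start) (auto simp: chart_def reflx_def refly_def intro!: EW_proj_in_EW)
  qed
  thus ?thesis by (simp add: d_def)
qed

text \<open>
  Cut the flow line at the vertical edges that it crosses. The conditions on \<open>(u, v)\<close> and on \<open>v' = 1\<close> keep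
  its ends away from the corners; in between, a line that rises strictly meets the vertical edges at
  heights strictly between \<open>0\<close> and \<open>1\<close>.
\<close>

lemma flow_up:
  assumes "0 \<le> u" "u < 1" "0 \<le> v" "v \<le> v'" "v' \<le> 1" "u \<noteq> 0 \<or> (v \<noteq> 0 \<and> v \<noteq> 1)"
    "v' < 1 \<or> u + (v' - v) * \<alpha> \<notin> \<int>"
  shows "EW_flow \<theta> ((v' - v) / c) (chart g u v) (chart (g * X ^ nat \<lfloor>u + (v' - v) * \<alpha>\<rfloor>) (frac (u + (v' - v) * \<alpha>)) v')"
  using assms
proof (induction "nat \<lfloor>u + (v' - v) * \<alpha>\<rfloor>" arbitrary: u v g)
  case 0
  let ?u = "u + (v' - v) * \<alpha>"
  have D: "0 \<le> (v' - v) * \<alpha>" using pos "0.prems" by simp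
  have "0 \<le> ?u" using D "0.prems"(1) by linarith
  hence "\<lfloor>?u\<rfloor> = 0" using 0(1) by linarith
  hence u1: "frac ?u = ?u" "?u < 1" by (auto simp: frac_def floor_eq_iff)
  have "?u \<noteq> 0 \<or> (v' \<noteq> 0 \<and> v' \<noteq> 1)"
  proof (rule ccontr)
    assume *: "\<not> ?thesis"
    hence "u = 0" using D "0.prems"(1) by linarith
    hence "v \<noteq> 0" "v' \<noteq> 1" using "0.prems" * by auto
    thus False using * "0.prems" by auto
  qed
  hence "EW_flow \<theta> ((v' - v) / c) (chart g u v) (chart g ?u v')"
    using "0.prems" D u1 by (intro flow_in_square chart_not_singular) auto
  thus ?case using u1 \<open>\<lfloor>?u\<rfloor> = 0\<close> by simp
next
  case (Suc k)
  let ?u = "u + (v' - v) * \<alpha>"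
  have k: "\<lfloor>?u\<rfloor> = int k + 1" using Suc(2) by linarith
  hence u1: "1 \<le> ?u" by linarith
  define v1 where "v1 = v + (1 - u) / \<alpha>"
  have v1: "v < v1" using Suc.prems pos by (simp add: v1_def)
  have e1: "(v1 - v) * \<alpha> = 1 - u" using pos by (simp add: v1_def)
  have e2: "(v' - v1) * \<alpha> = ?u - 1" using e1 by (simp add: algebra_simps)
  have v1': "v1 \<le> v'" using e2 u1 pos by (metis diff_ge_0_iff_ge zero_le_mult_iff not_less less_eq_real_def)
  have n1: "v1 \<noteq> 1"
  proof
    assume "v1 = 1"
    hence "v' = 1" using v1' Suc.prems by simp
    hence "?u = 1" using e2 \<open>v1 = 1\<close> by simp
    thus False using Suc.prems(7) \<open>v' = 1\<close> by simp
  qed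
  have v10: "0 < v1" "v1 < 1" using v1 v1' n1 Suc.prems by auto
  have "EW_flow \<theta> ((v1 - v) / c) (chart g u v) (chart g 1 v1)"
    using Suc.prems v1 v10 e1 by (intro flow_in_square chart_not_singular) auto
  also have "chart g 1 v1 = chart (g * X) 0 v1" using chart_right v10 by simp
  finally have 1: "EW_flow \<theta> ((v1 - v) / c) (chart g u v) (chart (g * X) 0 v1)" .
  have "k = nat \<lfloor>0 + (v' - v1) * \<alpha>\<rfloor>" unfolding e2 using k by simp
  moreover have "v' < 1 \<or> 0 + (v' - v1) * \<alpha> \<notin> \<int>"
    unfolding e2 using Suc.prems(7) by (metis Ints_1 Ints_add add_0 diff_add_cancel)
  ultimately have "EW_flow \<theta> ((v' - v1) / c) (chart (g * X) 0 v1)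
      (chart (g * X * X ^ nat \<lfloor>0 + (v' - v1) * \<alpha>\<rfloor>) (frac (0 + (v' - v1) * \<alpha>)) v')"
    using Suc.prems v10 v1' by (intro Suc.hyps) auto
  from EW_flow_trans[OF 1 this]
  have "EW_flow \<theta> ((v' - v) / c) (chart g u v) (chart (g * X * X ^ nat \<lfloor>?u - 1\<rfloor>) (frac (?u - 1)) v')"
    by (simp add: e2 add_divide_distrib[symmetric])
  moreover have "nat \<lfloor>?u\<rfloor> = Suc (nat \<lfloor>?u - 1\<rfloor>)" using k by simp
  moreover have "frac (?u - 1) = frac ?u" by (simp add: frac_def)
  ultimately show ?case by (simp add: mult.assoc power_commutes)
qed

lemma flow_return:
  assumes x: "x \<in> {0..<1}" and nz: "\<And>n::nat. x + real n * \<alpha> \<notin> \<int>"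
  shows "EW_flow \<theta> (real n / c) (chart g x 0) (chart (fst ((skew ^^ n) (g, x))) (snd ((skew ^^ n) (g, x))) 0) \<and>
    snd ((skew ^^ n) (g, x)) \<in> {0<..<1}"
proof (induction n)
  case 0
  have "x \<noteq> 0" using nz[of 0] by auto
  hence "chart g x 0 \<in> EW - EW_singular" using chart_not_singular[of x 0 g] x by (auto simp: chart_def reflx_def refly_def intro!: EW_proj_in_EW)
  thus ?case using \<open>x \<noteq> 0\<close> x by (auto intro: EW_flow.start)
next
  case (Suc n)
  obtain g1 x1 where 1: "(skew ^^ n) (g, x) = (g1, x1)" by fastforce
  obtain m :: int where m: "x1 = x + real n * \<alpha> - of_int m" using skew_translate[of n g x] 1 by auto
  have n1: "x1 + \<alpha> \<notin> \<int>"
  proof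
    assume "x1 + \<alpha> \<in> \<int>"
    hence "x1 + \<alpha> + of_int m \<in> \<int>" by simp
    moreover have "x1 + \<alpha> + of_int m = x + real (Suc n) * \<alpha>" by (simp add: m algebra_simps)
    ultimately show False using nz[of "Suc n"] by simp
  qed
  have x1: "0 < x1" "x1 < 1" using Suc 1 by auto
  have "EW_flow \<theta> ((1 - 0) / c) (chart g1 x1 0) (chart (g1 * X ^ nat \<lfloor>x1 + (1 - 0) * \<alpha>\<rfloor>) (frac (x1 + (1 - 0) * \<alpha>)) 1)"
    using x1 n1 by (intro flow_up) auto
  hence "EW_flow \<theta> (1 / c) (chart g1 x1 0) (chart (fst (skew (g1, x1))) (snd (skew (g1, x1))) 0)"
    using chart_top[of "frac (x1 + \<alpha>)"] by (simp add: skew_def frac_lt_1 less_imp_le)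
  moreover have "EW_flow \<theta> (real n / c) (chart g x 0) (chart g1 x1 0)" using Suc 1 by simp
  ultimately have "EW_flow \<theta> (real n / c + 1 / c) (chart g x 0) (chart (fst (skew (g1, x1))) (snd (skew (g1, x1))) 0)"
    by (rule EW_flow_trans[rotated])
  hence "EW_flow \<theta> (real (Suc n) / c) (chart g x 0) (chart (fst (skew (g1, x1))) (snd (skew (g1, x1))) 0)"
    by (simp add: add_divide_distrib add.commute)
  moreover have "snd (skew (g1, x1)) \<in> {0<..<1}" using n1 by (auto simp: skew_def frac_lt_1 frac_gt_0_iff)
  ultimately show ?case using 1 by simp
qed

text \<open>
  The flow line of \<open>p\<close> first climbs to a horizontal edge, then follows the skew product, and finally climbs
  to the height of \<open>p'\<close>. The condition on \<open>u\<close> and \<open>v\<close> says that it never meets a corner. The target is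
  moved down along the flow to a point \<open>y\<close> of a bottom edge; a displacement \<open>\<eta>\<close> on that edge becomes a
  horizontal displacement \<open>\<eta>\<close> at \<open>p'\<close>.
\<close>

lemma hitting_time_upper:
  assumes u: "0 < u" "u < 1" "0 < v" "v < 1" and gen: "\<And>m k :: int. u - v * \<alpha> + of_int m * \<alpha> \<noteq> of_int k"
    and u': "0 < u'" "u' < 1" "0 < v'" "v' < 1" and ba: "badly_approx d w"
  shows "\<exists>C>0. \<forall>\<^sub>F r in at_right 0. hitting_time \<theta> (chart g u v) (chart h u' v') r \<le> ereal (C * r powr - w)"
proof -
  define K :: real where "K = 20 * 4 ^ 8"
  define C where "C = (2 + 17 * K powr w / d) / c"
  have d: "0 < d" "0 \<le> w" using ba by (auto simp: badly_approx_def)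
  have C: "0 < C" using d c_pos by (auto simp: C_def intro!: divide_pos_pos add_pos_nonneg)
  define r0 where "r0 = Min {1, (1 - v) / c, u', 1 - u'}"
  have r0: "0 < r0" "r0 \<le> 1" "r0 \<le> (1 - v) / c" "r0 \<le> u'" "r0 \<le> 1 - u'"
    using u u' c_pos by (auto simp: r0_def)
  define x0 where "x0 = frac (u + (1 - v) * \<alpha>)"
  define g0 where "g0 = g * X ^ nat \<lfloor>u + (1 - v) * \<alpha>\<rfloor> * Y"
  have nonint: "x0 + real n * \<alpha> \<notin> \<int>" for n
  proof
    assume "x0 + real n * \<alpha> \<in> \<int>"
    then obtain k :: int where "x0 + real n * \<alpha> = of_int k" by (auto elim: Ints_cases)
    hence "u - v * \<alpha> + of_int (int n + 1) * \<alpha> = of_int (k + \<lfloor>u + (1 - v) * \<alpha>\<rfloor>)"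
      by (simp add: x0_def frac_def algebra_simps)
    thus False using gen by blast
  qed
  have x0: "x0 \<in> {0..<1}" by (auto simp: x0_def frac_lt_1)
  have "u + (1 - v) * \<alpha> \<notin> \<int>"
  proof
    assume "u + (1 - v) * \<alpha> \<in> \<int>"
    hence "x0 = 0" by (simp add: x0_def)
    thus False using nonint[of 0] by simp
  qed
  hence "EW_flow \<theta> ((1 - v) / c) (chart g u v) (chart (g * X ^ nat \<lfloor>u + (1 - v) * \<alpha>\<rfloor>) x0 1)"
    unfolding x0_def using u by (intro flow_up) auto
  hence f1: "EW_flow \<theta> ((1 - v) / c) (chart g u v) (chart g0 x0 0)"
    using chart_top[of x0] x0 by (simp add: g0_def)
  define y where "y = frac (u' - v' * \<alpha>)"
  define m where "m = \<lfloor>u' - v' * \<alpha>\<rfloor>"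
  have y: "y \<in> {0..<1}" "y + v' * \<alpha> = u' - of_int m" by (simp_all add: y_def m_def frac_lt_1) (simp add: frac_def)
  obtain h' where h': "h = h' * X ^ nat (- m)" using quat_divide by blast
  have main: "hitting_time \<theta> (chart g u v) (chart h u' v') r \<le> ereal (C * r powr - w)" if r: "0 < r" "r < r0" for r
  proof -
    \<comment> \<open>The scale \<open>r / 20\<close> gives the accuracy \<open>r / 2\<close>, which is smaller than \<open>r\<close>.\<close>
    have "hits (17 / (d * (r / 20 / 4 ^ 8) powr w)) (10 * (r / 20))"
      using hits_at_all_scales[OF ba, of "r / 20"] r r0 by simp
    then obtain n x1 where n: "real n \<le> 17 / (d * (r / 20 / 4 ^ 8) powr w)" "(skew ^^ n) (g0, x0) = (h', x1)" "\<bar>x1 - y\<bar> \<le> 10 * (r / 20)"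
      unfolding hits_def using x0 y(1) by blast
    note f2 = flow_return[OF x0 nonint, where n = n and g = g0]
    have x1: "0 < x1" "x1 < 1" using f2 n by auto
    define \<eta> where "\<eta> = x1 - y"
    have \<eta>: "\<bar>\<eta>\<bar> < r" using n(3) r by (simp add: \<eta>_def)
    hence u'\<eta>: "0 < u' + \<eta>" "u' + \<eta> < 1" using r r0 by (auto simp: abs_less_iff)
    have e: "x1 + (v' - 0) * \<alpha> = (u' + \<eta>) - of_int m" using y(2) by (simp add: \<eta>_def)
    have fl: "\<lfloor>x1 + (v' - 0) * \<alpha>\<rfloor> = - m" unfolding e using u'\<eta> by (simp add: floor_eq_iff)
    hence fr: "frac (x1 + (v' - 0) * \<alpha>) = u' + \<eta>" using e unfolding frac_def by simp
    have "EW_flow \<theta> ((v' - 0) / c) (chart h' x1 0)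
        (chart (h' * X ^ nat \<lfloor>x1 + (v' - 0) * \<alpha>\<rfloor>) (frac (x1 + (v' - 0) * \<alpha>)) v')"
      using x1 u' by (intro flow_up) auto
    hence f3: "EW_flow \<theta> (v' / c) (chart h' x1 0) (chart h (u' + \<eta>) v')" unfolding fl fr h' by simp
    define t where "t = (1 - v) / c + (real n / c + v' / c)"
    have "EW_flow \<theta> t (chart g u v) (chart h (u' + \<eta>) v')"
      unfolding t_def using f2 n f1 f3 by (auto intro!: EW_flow_trans)
    moreover have "EW_dist (chart h (u' + \<eta>) v') (chart h u' v') < r"
    proof -
      have "EW_dist (chart h (u' + \<eta>) v') (chart h u' v') \<le> dist (reflx (u' + \<eta>), refly v') (reflx u', refly v')"
        unfolding chart_def by (rule EW_dist_le_same_square; unfold refl_squares) (use u' u'\<eta> in auto)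
      also have "\<dots> = \<bar>\<eta>\<bar>" by (auto simp: dist_Pair_Pair dist_real_def reflx_def)
      finally show ?thesis using \<eta> by simp
    qed
    moreover have "r < t"
    proof -
      have "0 \<le> real n / c" "0 < v' / c" using c_pos u' by auto
      thus ?thesis using r r0 unfolding t_def by linarith
    qed
    ultimately have "hitting_time \<theta> (chart g u v) (chart h u' v') r \<le> ereal t"
      unfolding hitting_time_def by (intro Inf_lower) auto
    also have "t \<le> C * r powr - w"
    proof -
      have "1 \<le> r powr - w" using r r0 d powr_mono'[of "- w" 0 r] by simp
      moreover have "17 / (d * (r / 20 / 4 ^ 8) powr w) = 17 * K powr w / d * r powr - w"
      proof -
        have "r / 20 / 4 ^ 8 = r / K" by (simp add: K_def)
        hence "(r / 20 / 4 ^ 8) powr w = r powr w / K powr w" using r by (simp add: powr_divide K_def)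
        thus ?thesis using r d by (simp add: powr_minus field_simps)
      qed
      ultimately have "(1 - v) + (real n + v') \<le> (2 + 17 * K powr w / d) * r powr - w"
        using n(1) u u' by (simp add: distrib_right)
      hence "((1 - v) + (real n + v')) / c \<le> (2 + 17 * K powr w / d) * r powr - w / c"
        using c_pos by (intro divide_right_mono) auto
      moreover have "((1 - v) + (real n + v')) / c = t" by (simp add: t_def add_divide_distrib)
      moreover have "(2 + 17 * K powr w / d) * r powr - w / c = C * r powr - w" by (simp add: C_def)
      ultimately show ?thesis by (simp only:)
    qed
    finally show ?thesis by simp
  qed
  have "\<forall>\<^sub>F r in at_right 0. hitting_time \<theta> (chart g u v) (chart h u' v') r \<le> ereal (C * r powr - w)"
    using main r0(1) unfolding eventually_at_right_field by blast
  with C show ?thesis by blast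
qed

end

lemma hitting_time_ge: "ereal r \<le> hitting_time \<theta> p p' r"
  unfolding hitting_time_def by (rule Inf_greatest) auto

lemma log_ereal_mono:
  assumes "0 < x" "ereal x \<le> y" shows "ereal (ln x) \<le> log_ereal y"
  using assms by (cases y) (auto simp: log_ereal_def)

lemma log_ereal_le:
  assumes "0 < x" "ereal x \<le> y" "y \<le> ereal z" shows "log_ereal y \<le> ereal (ln z)"
  using assms by (cases y) (auto simp: log_ereal_def)

lemma w_hit_sup_le:
  assumes C: "0 < C" and ev: "\<forall>\<^sub>F r in at_right 0. hitting_time \<theta> p p' r \<le> ereal (C * r powr - w)"
  shows "w_hit_sup \<theta> p p' \<le> ereal w"
proof -
  let ?f = "\<lambda>r::real. (ln C + w * (- ln r)) / (- ln r)"
  have "\<forall>\<^sub>F r::real in at_right 0. 0 < r \<and> r < 1"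
    by (simp add: eventually_at_right_field) (meson zero_less_one)
  with ev have "\<forall>\<^sub>F r in at_right 0. log_ereal (hitting_time \<theta> p p' r) / ereal (- ln r) \<le> ereal (?f r)"
  proof eventually_elim
    case (elim r)
    have "log_ereal (hitting_time \<theta> p p' r) \<le> ereal (ln (C * r powr - w))"
      using elim hitting_time_ge log_ereal_le by blast
    also have "ln (C * r powr - w) = ln C + w * (- ln r)" using elim C by (simp add: ln_mult ln_powr)
    finally have "log_ereal (hitting_time \<theta> p p' r) / ereal (- ln r) \<le> ereal (ln C + w * (- ln r)) / ereal (- ln r)"
      using elim by (intro ereal_divide_right_mono) auto
    also have "\<dots> = ereal (?f r)" using elim by simp
    finally show ?case .
  qed
  hence "w_hit_sup \<theta> p p' \<le> Limsup (at_right 0) (\<lambda>r. ereal (?f r))"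
    unfolding w_hit_sup_def by (rule Limsup_mono)
  also have "(?f \<longlongrightarrow> w) (at_right 0)" by real_asymp
  hence "Limsup (at_right 0) (\<lambda>r. ereal (?f r)) = ereal w"
    by (intro lim_imp_Limsup) auto
  finally show ?thesis .
qed

section \<open>The Diophantine type\<close>

text \<open>
  If there were finitely many such fractions, Dirichlet's theorem with a large bound on the denominator
  would give one that is closer to \<open>\<alpha>\<close> than all of them.
\<close>

lemma dirichlet_pairs_infinite:
  fixes \<alpha> :: real
  assumes "\<alpha> \<notin> \<rat>"
  shows "infinite {(a :: int, b :: int). b > 0 \<and> coprime a b \<and> \<bar>\<alpha> - of_int a / of_int b\<bar> < of_int b powr - (1 + 1)}"
proof
  let ?S = "{(a :: int, b :: int). b > 0 \<and> coprime a b \<and> \<bar>\<alpha> - of_int a / of_int b\<bar> < of_int b powr - (1 + 1)}"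
  assume fin: "finite ?S"
  define \<epsilon> where "\<epsilon> = Min (insert 1 ((\<lambda>(a, b). \<bar>\<alpha> - of_int a / of_int b\<bar>) ` ?S))"
  have "\<alpha> - of_int a / of_int b \<noteq> 0" for a b :: int using assms by (metis Rats_divide Rats_of_int eq_iff_diff_eq_0)
  hence \<epsilon>: "0 < \<epsilon>" using fin unfolding \<epsilon>_def by (subst Min_gr_iff) auto
  define N where "N = nat \<lceil>1 / \<epsilon>\<rceil> + 1"
  have N: "1 / \<epsilon> < real N" unfolding N_def by linarith
  obtain h k :: int where hk: "coprime h k" "0 < k" "k \<le> int N" "\<bar>of_int k * \<alpha> - of_int h\<bar> < 1 / N"
    using Dirichlet_approx_coprime[of N \<alpha>] by (auto simp: N_def)
  have e: "\<bar>\<alpha> - of_int h / of_int k\<bar> = \<bar>of_int k * \<alpha> - of_int h\<bar> / of_int k"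
    using hk(2) by (simp add: abs_divide[symmetric] field_simps abs_mult)
  have "1 / N \<le> 1 / of_int k" using hk by (intro frac_le) auto
  hence "\<bar>of_int k * \<alpha> - of_int h\<bar> < 1 / of_int k" using hk by linarith
  hence "\<bar>\<alpha> - of_int h / of_int k\<bar> < (1 / of_int k) / of_int k"
    unfolding e using hk(2) by (intro divide_strict_right_mono) auto
  also have "\<dots> = of_int k powr - (1 + 1)"
    using hk(2) by (simp add: powr_minus powr_numeral power2_eq_square divide_inverse)
  finally have "(h, k) \<in> ?S" using hk by auto
  hence "\<epsilon> \<le> \<bar>\<alpha> - of_int h / of_int k\<bar>" using fin unfolding \<epsilon>_def by (intro Min_le) (auto intro!: image_eqI[where x = "(h, k)"])
  also have "\<dots> \<le> \<bar>of_int k * \<alpha> - of_int h\<bar>" unfolding e using hk(2) mult_left_mono[of 1 "of_int k" "\<bar>of_int k * \<alpha> - of_int h\<bar>"] by (simp add: divide_le_eq)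
  also have "\<dots> < 1 / N" by (rule hk)
  finally have "\<epsilon> * real N < 1" using N_def by (simp add: field_simps)
  thus False using N \<epsilon> by (simp add: field_simps)
qed

lemma diophantine_type_ge_1:
  assumes "\<alpha> \<notin> \<rat>" shows "1 \<le> diophantine_type \<alpha>"
  unfolding diophantine_type_def one_ereal_def
  by (rule Sup_upper) (use dirichlet_pairs_infinite[OF assms] in auto)

text \<open>
  All but finitely many reduced fractions satisfy the bound with constant \<open>1\<close>, and the others have a
  positive distance from \<open>\<alpha>\<close>. Reducing \<open>p / q\<close> only decreases the denominator.
\<close>

lemma approx_bound_above_type:
  assumes irr: "\<alpha> \<notin> \<rat>" and w: "diophantine_type \<alpha> < ereal w"
  shows "\<exists>c>0. \<forall>(q::nat) (p::int). 0 < q \<longrightarrow> c * real q powr - w \<le> \<bar>real q * \<alpha> - of_int p\<bar>"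
proof -
  let ?S = "{(a :: int, b :: int). b > 0 \<and> coprime a b \<and> \<bar>\<alpha> - of_int a / of_int b\<bar> < of_int b powr - (w + 1)}"
  have "1 < ereal w" by (rule le_less_trans[OF diophantine_type_ge_1[OF irr] w])
  hence w1: "1 \<le> w" by (simp add: one_ereal_def)
  have fin: "finite ?S"
  proof (rule ccontr)
    assume "infinite ?S"
    hence "ereal w \<le> diophantine_type \<alpha>" unfolding diophantine_type_def using w1 by (intro Sup_upper) auto
    thus False using w by simp
  qed
  define \<epsilon> where "\<epsilon> = Min (insert 1 ((\<lambda>(a, b). \<bar>\<alpha> - of_int a / of_int b\<bar>) ` ?S))"
  have nz: "\<alpha> - of_int a / of_int b \<noteq> 0" for a b :: int using irr by (metis Rats_divide Rats_of_int eq_iff_diff_eq_0)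
  hence \<epsilon>: "0 < \<epsilon>" using fin unfolding \<epsilon>_def by (subst Min_gr_iff) auto
  have \<epsilon>1: "\<epsilon> \<le> 1" using fin unfolding \<epsilon>_def by (intro Min_le) auto
  show ?thesis
  proof (intro exI[of _ \<epsilon>] conjI allI impI \<epsilon>)
    fix q :: nat and p :: int assume q: "0 < q"
    define d where "d = gcd p (int q)"
    define a where "a = p div d"
    define b where "b = int q div d"
    have d: "0 < d" using q by (simp add: d_def)
    have pq: "p = d * a" "int q = d * b" by (simp_all add: a_def b_def d_def)
    have cop: "coprime a b" unfolding a_def b_def d_def using q by (intro div_gcd_coprime) auto
    have b: "0 < b" using pq(2) q d by (metis of_nat_0_less_iff zero_less_mult_pos)
    have bq: "b \<le> int q" unfolding pq(2) using d b by simp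
    have rq: "real q = of_int d * of_int b" using pq(2) by (metis of_int_mult of_int_of_nat_eq)
    have e: "\<bar>real q * \<alpha> - of_int p\<bar> = real q * \<bar>\<alpha> - of_int a / of_int b\<bar>"
    proof -
      have "real q * \<alpha> - of_int p = real q * (\<alpha> - of_int a / of_int b)" using b by (simp add: rq pq(1) field_simps)
      thus ?thesis by (simp add: abs_mult)
    qed
    show "\<epsilon> * real q powr - w \<le> \<bar>real q * \<alpha> - of_int p\<bar>"
    proof (cases "(a, b) \<in> ?S")
      case True
      have "\<epsilon> \<le> \<bar>\<alpha> - of_int a / of_int b\<bar>" using fin True unfolding \<epsilon>_def by (intro Min_le) (auto intro!: image_eqI[where x = "(a, b)"])
      also have "\<dots> \<le> real q * \<bar>\<alpha> - of_int a / of_int b\<bar>" using q mult_right_mono[of 1 "real q" "\<bar>\<alpha> - of_int a / of_int b\<bar>"] by simp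
      finally have "\<epsilon> \<le> \<bar>real q * \<alpha> - of_int p\<bar>" unfolding e .
      moreover have "real q powr - w \<le> 1" using q w1 by (simp add: powr_minus field_simps ge_one_powr_ge_zero)
      hence "\<epsilon> * real q powr - w \<le> \<epsilon>" using \<epsilon> by simp
      ultimately show ?thesis by linarith
    next
      case False
      hence "of_int b powr - (w + 1) \<le> \<bar>\<alpha> - of_int a / of_int b\<bar>" using b cop by auto
      moreover have "real q powr - (w + 1) \<le> of_int b powr - (w + 1)"
        using b bq w1 by (intro powr_mono2') auto
      ultimately have "real q * real q powr - (w + 1) \<le> \<bar>real q * \<alpha> - of_int p\<bar>"
        unfolding e by (intro mult_left_mono) auto
      moreover have "real q * real q powr - (w + 1) = real q powr - w"
        using q powr_add[of "real q" 1 "- (w + 1)"] by simp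
      moreover have "\<epsilon> * real q powr - w \<le> real q powr - w" using \<epsilon>1 mult_right_mono[of \<epsilon> 1 "real q powr - w"] by simp
      ultimately show ?thesis by simp
    qed
  qed
qed

lemma (in irrational_direction) badly_approx_above_type:
  assumes "diophantine_type (tan \<theta>) < ereal w" shows "\<exists>d. badly_approx d w"
proof -
  obtain d where d: "0 < d" "\<And>(q::nat) (p::int). 0 < q \<Longrightarrow> d * real q powr - w \<le> \<bar>real q * tan \<theta> - of_int p\<bar>"
    using approx_bound_above_type[OF irr assms] by blast
  have "1 < ereal w" by (rule le_less_trans[OF diophantine_type_ge_1[OF irr] assms])
  hence w: "0 \<le> w" by (simp add: one_ereal_def)
  have "d * real q powr - w \<le> \<bar>real q * \<alpha> - of_int p\<bar>" if q: "0 < q" for q :: nat and p :: int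
  proof (cases "0 < tan \<theta>")
    case True thus ?thesis using d(2)[OF q, of p] by (simp add: \<alpha>_def)
  next
    case False
    have "real q * tan \<theta> - of_int (- p) = - (real q * \<alpha> - of_int p)" using False by (simp add: \<alpha>_def)
    thus ?thesis using d(2)[OF q, of "- p"] by simp
  qed
  thus ?thesis using d(1) w unfolding badly_approx_def by blast
qed

section \<open>Projection to the torus\<close>

definition lattice_equiv :: "real \<times> real \<Rightarrow> real \<times> real \<Rightarrow> bool" where
  "lattice_equiv z z' \<longleftrightarrow> fst z - fst z' \<in> \<int> \<and> snd z - snd z' \<in> \<int>"

lemma lattice_equiv_refl [simp]: "lattice_equiv z z" by (simp add: lattice_equiv_def)
lemma lattice_equiv_sym: "lattice_equiv z z' \<Longrightarrow> lattice_equiv z' z"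
  using Ints_minus[of "fst z - fst z'"] Ints_minus[of "snd z - snd z'"] by (simp add: lattice_equiv_def)
lemma lattice_equiv_trans: "lattice_equiv z z' \<Longrightarrow> lattice_equiv z' z'' \<Longrightarrow> lattice_equiv z z''"
  using Ints_add[of "fst z - fst z'" "fst z' - fst z''"] Ints_add[of "snd z - snd z'" "snd z' - snd z''"]
  by (simp add: lattice_equiv_def)
lemma lattice_equiv_add: "lattice_equiv z z' \<Longrightarrow> lattice_equiv (z + d) (z' + d)" by (simp add: lattice_equiv_def)

lemma glue_lattice: "(a, b) \<in> glue \<Longrightarrow> lattice_equiv (snd a) (snd b)"
  by (cases a rule: prod_cases3; cases b rule: prod_cases3) (auto elim!: glue.cases simp: lattice_equiv_def)

lemma EW_rel_lattice:
  assumes "((g, z), (h, z')) \<in> EW_rel" shows "lattice_equiv z z'"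
proof -
  have "lattice_equiv (snd a) (snd b)" if "(a, b) \<in> (glue \<union> glue\<inverse>)\<^sup>*" for a b
    using that
  proof (induction rule: rtrancl_induct)
    case (step y z)
    from step.hyps(2) have "(y, z) \<in> glue \<or> (z, y) \<in> glue" by auto
    hence "lattice_equiv (snd y) (snd z)" using glue_lattice lattice_equiv_sym by metis
    with step.IH show ?case by (rule lattice_equiv_trans)
  qed simp
  from this[of "(g, z)" "(h, z')"] show ?thesis using assms by (simp add: EW_rel_def)
qed

lemma EW_class_lattice:
  assumes "p \<in> EW" "(g, z) \<in> p" "(h, z') \<in> p" shows "lattice_equiv z z'"
proof -
  obtain g0 z0 where "p = EW_proj (g0, z0)" using EW_cases[OF assms(1)] by metis
  hence "lattice_equiv z0 z" "lattice_equiv z0 z'" using assms by (auto simp: mem_EW_proj_iff intro: EW_rel_lattice)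
  thus ?thesis using lattice_equiv_sym lattice_equiv_trans by blast
qed

text \<open>
  On the torus \<open>\<real>\<^sup>2 / \<int>\<^sup>2\<close> the flow is a translation.
\<close>

lemma EW_flow_lattice:
  assumes "EW_flow \<theta> t p q" "(g, z) \<in> p" "(h, z') \<in> q"
  shows "lattice_equiv z' (z + t *\<^sub>R (sin \<theta>, cos \<theta>))"
  using assms
proof (induction arbitrary: g z rule: EW_flow.induct)
  case (start p)
  thus ?case using EW_class_lattice[of p h z' g z] by (simp add: zero_prod_def[symmetric])
next
  case (segment s g1 z1 t q)
  let ?e = "(sin \<theta>, cos \<theta>)"
  have "lattice_equiv z1 z" using segment by (auto simp: mem_EW_proj_iff intro: EW_rel_lattice)
  moreover have "lattice_equiv z' (z1 + s *\<^sub>R ?e + t *\<^sub>R ?e)"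
    by (rule segment.IH[OF mem_EW_proj[OF segment.hyps(3)] segment.prems(2)])
  moreover have "z1 + s *\<^sub>R ?e + t *\<^sub>R ?e = z1 + (s + t) *\<^sub>R ?e" by (simp add: distrib_right)
  ultimately show ?case using lattice_equiv_add lattice_equiv_trans by metis
qed

text \<open>
  The projection does not increase distances: the segments of a broken line lift to a broken line in the
  plane.
\<close>

lemma EW_broken_line_lattice:
  assumes "EW_broken_line p q l" "(g, z) \<in> p" "(h, z') \<in> q"
  shows "\<exists>z''. lattice_equiv z'' z' \<and> dist z z'' \<le> l"
  using assms
proof (induction arbitrary: g z rule: EW_broken_line.induct)
  case (refl p)
  thus ?case using EW_class_lattice[of p g z h z'] by (intro exI[of _ z]) simp
next
  case (segment g1 z1 z1' q l)
  have l1: "lattice_equiv z z1" using segment by (auto simp: mem_EW_proj_iff intro: EW_rel_lattice lattice_equiv_sym)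
  obtain z'' where z'': "lattice_equiv z'' z'" "dist z1' z'' \<le> l"
    using segment.IH[OF mem_EW_proj[OF segment.hyps(2)] segment.prems(2)] by blast
  let ?y = "z'' + (z - z1)"
  have "lattice_equiv ?y z''" using l1 by (simp add: lattice_equiv_def)
  hence "lattice_equiv ?y z'" using z''(1) lattice_equiv_trans by blast
  moreover have "dist z ?y = dist z1 z''"
    by (simp add: dist_norm algebra_simps)
  hence "dist z ?y \<le> dist z1 z1' + l" using z''(2) dist_triangle[of z1 z'' z1'] by linarith
  ultimately show ?case by blast
qed

text \<open>
  The surface is connected, since \<open>i\<close> and \<open>j\<close> generate the group. So the infimum in the definition of
  the flat distance is taken over a nonempty set.
\<close>

lemma EW_broken_line_exists:
  assumes "p \<in> EW" "q \<in> EW" shows "\<exists>l. EW_broken_line p q l"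
proof -
  define R where "R g h \<longleftrightarrow> (\<forall>z z'. (g, z) \<in> squares \<longrightarrow> (h, z') \<in> squares \<longrightarrow>
      (\<forall>q l. EW_broken_line (EW_proj (h, z')) q l \<longrightarrow> (\<exists>l'. EW_broken_line (EW_proj (g, z)) q l')))" for g h :: quat
  have R_trans: "R g k" if "R g h" "R h k" for g h k
    unfolding R_def
  proof (intro allI impI)
    fix z z' q l assume *: "(g, z) \<in> squares" "(k, z') \<in> squares" "EW_broken_line (EW_proj (k, z')) q l"
    have h: "(h, 0, 0) \<in> squares" by simp
    show "\<exists>l'. EW_broken_line (EW_proj (g, z)) q l'" using that h * unfolding R_def by blast
  qed
  have step: "R g h" if e: "EW_proj (g, y) = EW_proj (h, y')" "(g, y) \<in> squares" "(h, y') \<in> squares" for g h y y'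
    unfolding R_def
  proof (intro allI impI)
    fix z z' q l assume *: "(g, z) \<in> squares" "(h, z') \<in> squares" "EW_broken_line (EW_proj (h, z')) q l"
    from EW_broken_line.segment[OF e(3) *(2,3)] have "EW_broken_line (EW_proj (g, y)) q (dist y' z' + l)" unfolding e(1) .
    from EW_broken_line.segment[OF *(1) e(2) this] show "\<exists>l'. EW_broken_line (EW_proj (g, z)) q l'" by blast
  qed
  have Ri: "R g (g * qi)" for g by (rule step[OF EW_proj_glue[OF glue.right[of 0]]]) auto
  have Rj: "R g (g * qj)" for g by (rule step[OF EW_proj_glue[OF glue.top[of 0]]]) auto
  have "R g (g * k)" for g k
  proof -
    have Ri': "R g (h * qi)" if "R g h" for h using R_trans[OF that Ri] .
    have Rj': "R g (h * qj)" if "R g h" for h using R_trans[OF that Rj] .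
    have g0: "R g g" using step[OF HOL.refl, of g "(0, 0)"] by simp
    note c = g0 Ri'[OF g0] Ri'[OF Ri'[OF g0]] Ri'[OF Ri'[OF Ri'[OF g0]]] Rj'[OF g0] Rj'[OF Ri'[OF g0]]
      Rj'[OF Ri'[OF Ri'[OF g0]]] Rj'[OF Ri'[OF Ri'[OF Ri'[OF g0]]]]
    have "\<forall>k. k \<in> {1, qi, qi * qi, qi * qi * qi, qj, qi * qj, qi * qi * qj, qi * qi * qi * qj}"
      unfolding all_quat_iff by (simp add: quat_arith)
    hence "k \<in> {1, qi, qi * qi, qi * qi * qi, qj, qi * qj, qi * qi * qj, qi * qi * qi * qj}" by blast
    thus ?thesis using c by (auto simp: mult.assoc)
  qed
  hence R: "R g h" for g h using quat_divide(1)[of h g] by metis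
  obtain g z h z' where "(g, z) \<in> squares" "p = EW_proj (g, z)" "(h, z') \<in> squares" "q = EW_proj (h, z')"
    using EW_cases[OF assms(1)] EW_cases[OF assms(2)] by metis
  thus ?thesis using R[of g h] EW_broken_line.refl[OF assms(2)] unfolding R_def by blast
qed

lemma EW_dist_lattice:
  assumes "EW_dist p q < r" "p \<in> EW" "q \<in> EW" "(g, z) \<in> p" "(h, z') \<in> q"
  shows "\<exists>z''. lattice_equiv z'' z' \<and> dist z z'' < r"
proof -
  have "{l. EW_broken_line p q l} \<noteq> {}" using EW_broken_line_exists assms by auto
  from cInf_lessD[OF this assms(1)[unfolded EW_dist_def]] obtain l where l: "EW_broken_line p q l" "l < r" by blast
  from EW_broken_line_lattice[OF l(1) assms(4,5)] l(2) show ?thesis by (meson le_less_trans)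
qed

lemma EW_flow_EW: "EW_flow \<theta> t p q \<Longrightarrow> p \<in> EW \<and> q \<in> EW"
  by (induction rule: EW_flow.induct) auto

text \<open>
  The intercept on the horizontal axis of the line through \<open>z\<close> in the direction of the flow, if \<open>\<beta> = tan \<theta>\<close>.
\<close>

definition intercept :: "real \<Rightarrow> real \<times> real \<Rightarrow> real" where
  "intercept \<beta> z = fst z - \<beta> * snd z"

text \<open>
  The line through \<open>z\<close> passes, at horizontal distance less than \<open>\<delta>\<close>, by a translate of \<open>z'\<close> under a lattice
  vector whose vertical component has absolute value at most \<open>N\<close>.
\<close>

definition near_return :: "real \<Rightarrow> real \<Rightarrow> real \<Rightarrow> real \<times> real \<Rightarrow> real \<times> real \<Rightarrow> bool" where
  "near_return \<beta> N \<delta> z z' \<longleftrightarrow> (\<exists>k m :: int. \<bar>of_int k\<bar> \<le> N \<and> \<bar>intercept \<beta> z - intercept \<beta> z' + of_int k * \<beta> - of_int m\<bar> < \<delta>)"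

text \<open>
  A hit at a time \<open>t < T\<close> lifts to a point of the line through \<open>z\<close> at distance less than \<open>r\<close> from a translate
  of \<open>z'\<close>, and comparing intercepts eliminates \<open>t\<close>. The vertical component of the lattice vector is at most
  \<open>T\<close> up to \<open>r \<le> 1\<close> and the difference of the vertical coordinates of \<open>z\<close> and \<open>z'\<close>, which is also at most \<open>1\<close>.
\<close>

lemma hitting_time_lower:
  assumes c: "cos \<theta> \<noteq> 0" and p: "p = EW_proj (g, z)" "(g, z) \<in> squares" and p': "p' = EW_proj (h, z')" "(h, z') \<in> squares"
    and r: "0 < r" "r \<le> 1" and far: "\<not> near_return (tan \<theta>) (T + 2) ((1 + \<bar>tan \<theta>\<bar>) * r) z z'"
  shows "ereal T \<le> hitting_time \<theta> p p' r"
  unfolding hitting_time_def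
proof (rule Inf_greatest, safe)
  fix t q assume t: "r < t" and q: "EW_flow \<theta> t p q" "EW_dist q p' < r"
  show "ereal T \<le> ereal t"
  proof (rule ccontr)
    assume "\<not> ?thesis"
    hence tT: "t < T" by simp
    have qE: "q \<in> EW" "p' \<in> EW" using EW_flow_EW[OF q(1)] p' by auto
    obtain h1 z1 where z1: "(h1, z1) \<in> q" using EW_cases[OF qE(1)] mem_EW_proj by metis
    have l1: "lattice_equiv z1 (z + t *\<^sub>R (sin \<theta>, cos \<theta>))"
      using EW_flow_lattice[OF q(1) _ z1] p mem_EW_proj by blast
    obtain z2 where z2: "lattice_equiv z2 z'" "dist z1 z2 < r"
      using EW_dist_lattice[OF q(2) qE z1] p' mem_EW_proj by blast
    obtain a1 a2 :: int where a: "fst z1 - (fst z + t * sin \<theta>) = of_int a1" "snd z1 - (snd z + t * cos \<theta>) = of_int a2"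
      using l1 by (auto simp: lattice_equiv_def elim!: Ints_cases)
    obtain b1 b2 :: int where b: "fst z2 - fst z' = of_int b1" "snd z2 - snd z' = of_int b2"
      using z2(1) by (auto simp: lattice_equiv_def elim!: Ints_cases)
    define e1 where "e1 = fst z1 - fst z2"
    define e2 where "e2 = snd z1 - snd z2"
    have e: "\<bar>e1\<bar> < r" "\<bar>e2\<bar> < r"
      using z2(2) dist_fst_le[of z1 z2] dist_snd_le[of z1 z2] by (auto simp: e1_def e2_def dist_real_def)
    define k where "k = b2 - a2"
    define m where "m = b1 - a1"
    have 1: "fst z + t * sin \<theta> - fst z' = e1 + of_int m" using a b by (simp add: e1_def m_def)
    have 2: "snd z + t * cos \<theta> - snd z' = e2 + of_int k" using a b by (simp add: e2_def k_def)
    have tan: "t * sin \<theta> = tan \<theta> * (t * cos \<theta>)" using c by (simp add: tan_def)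
    have "intercept (tan \<theta>) z - intercept (tan \<theta>) z' + of_int k * tan \<theta> - of_int m = e1 - tan \<theta> * e2"
    proof -
      have "tan \<theta> * (snd z + t * cos \<theta> - snd z') = tan \<theta> * (e2 + of_int k)" using 2 by simp
      thus ?thesis using 1 tan by (simp add: intercept_def algebra_simps)
    qed
    moreover have "\<bar>e1 - tan \<theta> * e2\<bar> < (1 + \<bar>tan \<theta>\<bar>) * r"
    proof -
      have "\<bar>e1 - tan \<theta> * e2\<bar> \<le> \<bar>e1\<bar> + \<bar>tan \<theta>\<bar> * \<bar>e2\<bar>" by (metis abs_mult abs_triangle_ineq4)
      also have "\<bar>tan \<theta>\<bar> * \<bar>e2\<bar> \<le> \<bar>tan \<theta>\<bar> * r" using e by (intro mult_left_mono) auto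
      finally show ?thesis using e by (simp add: distrib_right)
    qed
    moreover have "\<bar>of_int k\<bar> \<le> T + 2"
    proof -
      have "\<bar>t * cos \<theta>\<bar> \<le> t" using t r by (simp add: abs_mult mult_left_le)
      moreover have "\<bar>snd z - snd z'\<bar> \<le> 1" using p p' by (cases z; cases z') auto
      ultimately show ?thesis using 2 e r tT by linarith
    qed
    ultimately show False using far unfolding near_return_def by metis
  qed
qed

section \<open>Scales at which hits are rare\<close>

text \<open>
  By Fubini: the horizontal sections of a strip have length at most \<open>2 \<Delta>\<close>.
\<close>

lemma strip_measure:
  assumes "0 \<le> \<Delta>"
  shows "emeasure lborel {z \<in> {0..1} \<times> {0..1}. \<bar>intercept \<beta> z - \<gamma>\<bar> < \<Delta>} \<le> ennreal (2 * \<Delta>)"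
    and "{z \<in> {0..1} \<times> {0..1}. \<bar>intercept \<beta> z - \<gamma>\<bar> < \<Delta>} \<in> sets lborel"
proof -
  let ?S = "{z \<in> {0..1} \<times> {0..1}. \<bar>intercept \<beta> z - \<gamma>\<bar> < \<Delta>}"
  have "?S = {z \<in> space borel. fst z \<in> {0..1} \<and> snd z \<in> {0..1} \<and> \<bar>fst z - \<beta> * snd z - \<gamma>\<bar> < \<Delta>}"
    by (auto simp: intercept_def)
  also have "\<dots> \<in> sets (borel \<Otimes>\<^sub>M borel)" unfolding borel_prod[symmetric] by measurable
  finally have S: "?S \<in> sets (borel \<Otimes>\<^sub>M borel)" .
  thus SL: "?S \<in> sets lborel" unfolding borel_prod sets_lborel .
  have "emeasure lborel ?S = emeasure (lborel \<Otimes>\<^sub>M lborel) ?S" by (simp add: lborel_prod)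
  also have "\<dots> = (\<integral>\<^sup>+y. emeasure lborel ((\<lambda>x. (x, y)) -` ?S) \<partial>lborel)"
    using S by (intro lborel_pair.emeasure_pair_measure_alt2) (simp add: sets_pair_measure_cong[OF sets_lborel sets_lborel])
  also have "\<dots> \<le> (\<integral>\<^sup>+(y::real). ennreal (2 * \<Delta>) * indicator {0..1} y \<partial>lborel)"
  proof (rule nn_integral_mono)
    fix y :: real
    show "emeasure lborel ((\<lambda>x. (x, y)) -` ?S) \<le> ennreal (2 * \<Delta>) * indicator {0..1} y"
    proof (cases "y \<in> {0..1}")
      case True
      have "emeasure lborel ((\<lambda>x. (x, y)) -` ?S) \<le> emeasure lborel {\<beta> * y + \<gamma> - \<Delta>..\<beta> * y + \<gamma> + \<Delta>}"
        by (rule emeasure_mono) (auto simp: intercept_def abs_less_iff)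
      also have "\<dots> = ennreal (2 * \<Delta>)" using assms by simp
      finally show ?thesis using True by simp
    next
      case False
      hence "(\<lambda>x. (x, y)) -` ?S = {}" by auto
      thus ?thesis by (simp only: emeasure_empty zero_le)
    qed
  qed
  also have "\<dots> = ennreal (2 * \<Delta>)" by (subst nn_integral_cmult_indicator) auto
  finally show "emeasure lborel ?S \<le> ennreal (2 * \<Delta>)" .
qed

text \<open>
  Write \<open>k = q j + i\<close>. Modulo \<open>1\<close>, \<open>k \<beta>\<close> differs from \<open>i \<beta>\<close> by \<open>j (q \<beta> - p)\<close>, which is small. So only the
  residues \<open>i\<close> count, at the price of slightly wider strips.
\<close>

lemma near_return_in_strips:
  assumes near: "near_return \<beta> N \<delta> z z'" and z': "z' \<in> {0..1} \<times> {0..1}" and q: "0 < (q::int)"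
    and small: "\<delta> + N / of_int q * \<bar>of_int q * \<beta> - of_int p\<bar> \<le> 1"
  shows "\<exists>i\<in>{-q<..<q}. \<exists>m\<in>{- (\<lceil>\<bar>\<beta>\<bar>\<rceil> + 3)..\<lceil>\<bar>\<beta>\<bar>\<rceil> + 3}.
    \<bar>intercept \<beta> z' - (frac (intercept \<beta> z + of_int i * \<beta>) + of_int m)\<bar> < \<delta> + N / of_int q * \<bar>of_int q * \<beta> - of_int p\<bar>"
proof -
  let ?\<eta> = "of_int q * \<beta> - of_int p"
  obtain k m :: int where k: "\<bar>of_int k\<bar> \<le> N" "\<bar>intercept \<beta> z - intercept \<beta> z' + of_int k * \<beta> - of_int m\<bar> < \<delta>"
    using near unfolding near_return_def by blast
  \<comment> \<open>Rounding towards zero keeps \<open>\<bar>j\<bar> \<le> \<bar>k\<bar> / q\<close>, so the strips are hardly widened when \<open>N\<close> is small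
      compared with \<open>q\<close>; this matters for \<open>w = 1\<close>, where \<open>q \<bar>q \<beta> - p\<bar>\<close> need not be small.\<close>
  obtain i j where ij: "k = q * j + i" "i \<in> {-q<..<q}" "q * \<bar>j\<bar> \<le> \<bar>k\<bar>"
  proof (cases "0 \<le> k")
    case True
    have "q * (k div q) \<le> k" using q mult_div_mod_eq[of q k] pos_mod_sign[OF q, of k] by linarith
    moreover have "0 \<le> k div q" using True q by (simp add: pos_imp_zdiv_nonneg_iff)
    ultimately show ?thesis using True q that[of "k div q" "k mod q"] pos_mod_bound[OF q, of k] pos_mod_sign[OF q, of k] by auto
  next
    case False
    have "q * (- k div q) \<le> - k" using q mult_div_mod_eq[of q "- k"] pos_mod_sign[OF q, of "- k"] by linarith
    moreover have "0 \<le> - k div q" using False q by (simp add: pos_imp_zdiv_nonneg_iff)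
    moreover have "k = q * (- (- k div q)) + (- (- k mod q))" using mult_div_mod_eq[of q "- k"] by linarith
    ultimately show ?thesis using False q that[of "- (- k div q)" "- (- k mod q)"] pos_mod_bound[OF q, of "- k"] pos_mod_sign[OF q, of "- k"] by auto
  qed
  have "of_int q * \<bar>of_int j :: real\<bar> \<le> \<bar>of_int k\<bar>" using ij(3) by (metis of_int_abs of_int_le_iff of_int_mult)
  hence "of_int q * \<bar>of_int j :: real\<bar> \<le> N" using k(1) by linarith
  hence j: "\<bar>of_int j\<bar> \<le> N / of_int q" using q by (simp add: field_simps)
  define n where "n = \<lfloor>intercept \<beta> z + of_int i * \<beta>\<rfloor> - m + j * p"
  have "intercept \<beta> z' - (frac (intercept \<beta> z + of_int i * \<beta>) + of_int n)
      = - (intercept \<beta> z - intercept \<beta> z' + of_int k * \<beta> - of_int m) + of_int j * ?\<eta>"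
    by (simp add: n_def frac_def ij(1) algebra_simps)
  moreover have "\<bar>of_int j * ?\<eta>\<bar> \<le> N / of_int q * \<bar>?\<eta>\<bar>" unfolding abs_mult by (rule mult_right_mono[OF j]) simp
  ultimately have *: "\<bar>intercept \<beta> z' - (frac (intercept \<beta> z + of_int i * \<beta>) + of_int n)\<bar> < \<delta> + N / of_int q * \<bar>?\<eta>\<bar>"
    using k(2) by linarith
  have "\<bar>\<beta> * snd z'\<bar> \<le> \<bar>\<beta>\<bar>" using z' by (auto simp: abs_mult mult_left_le)
  hence "\<bar>intercept \<beta> z'\<bar> \<le> 1 + \<bar>\<beta>\<bar>" using z' by (cases z') (auto simp: intercept_def)
  moreover have "0 \<le> frac (intercept \<beta> z + of_int i * \<beta>)" "frac (intercept \<beta> z + of_int i * \<beta>) < 1" by (auto simp: frac_lt_1)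
  ultimately have "\<bar>of_int n :: real\<bar> \<le> \<bar>\<beta>\<bar> + 3" using * small by linarith
  hence "n \<in> {- (\<lceil>\<bar>\<beta>\<bar>\<rceil> + 3)..\<lceil>\<bar>\<beta>\<bar>\<rceil> + 3}" by auto linarith+
  with * ij(2) show ?thesis by blast
qed

text \<open>
  There are fewer than \<open>2 q\<close> residues \<open>i\<close>, and at most \<open>2 \<lceil>\<bar>\<beta>\<bar>\<rceil> + 7\<close> integer translates of each strip
  reach the unit square.
\<close>

lemma near_return_measure:
  assumes q: "0 < (q::int)" and small: "\<delta> + N / of_int q * \<bar>of_int q * \<beta> - of_int p\<bar> \<le> 1" and "0 \<le> \<delta>" "0 \<le> N"
  shows "emeasure lborel {z' \<in> {0..1} \<times> {0..1}. near_return \<beta> N \<delta> z z'}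
    \<le> ennreal (4 * (2 * of_int \<lceil>\<bar>\<beta>\<bar>\<rceil> + 7) * (of_int q * \<delta> + N * \<bar>of_int q * \<beta> - of_int p\<bar>))"
proof -
  let ?\<Delta> = "\<delta> + N / of_int q * \<bar>of_int q * \<beta> - of_int p\<bar>"
  let ?K = "{-q<..<q} \<times> {- (\<lceil>\<bar>\<beta>\<bar>\<rceil> + 3)..\<lceil>\<bar>\<beta>\<bar>\<rceil> + 3}"
  let ?S = "\<lambda>(i, m). {z' \<in> {0..1} \<times> {0..1}. \<bar>intercept \<beta> z' - (frac (intercept \<beta> z + of_int i * \<beta>) + of_int m)\<bar> < ?\<Delta>}"
  have \<Delta>: "0 \<le> ?\<Delta>" using assms by simp
  have c0: "0 \<le> \<lceil>\<bar>\<beta>\<bar>\<rceil>" by simp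
  have "emeasure lborel {z' \<in> {0..1} \<times> {0..1}. near_return \<beta> N \<delta> z z'} \<le> emeasure lborel (\<Union>x\<in>?K. ?S x)"
  proof (rule emeasure_mono)
    show "{z' \<in> {0..1} \<times> {0..1}. near_return \<beta> N \<delta> z z'} \<subseteq> (\<Union>x\<in>?K. ?S x)"
      using near_return_in_strips[OF _ _ q small, of z] by fastforce
    show "(\<Union>x\<in>?K. ?S x) \<in> sets lborel" using strip_measure(2)[OF \<Delta>] by (intro sets.finite_UN) auto
  qed
  also have "\<dots> \<le> (\<Sum>x\<in>?K. emeasure lborel (?S x))"
    using strip_measure(2)[OF \<Delta>] by (intro emeasure_subadditive_finite) auto
  also have "\<dots> \<le> (\<Sum>x\<in>?K. ennreal (2 * ?\<Delta>))"
    using strip_measure(1)[OF \<Delta>] by (intro sum_mono) auto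
  also have "\<dots> = ennreal (real (card ?K) * (2 * ?\<Delta>))"
    using \<Delta> by (simp add: ennreal_mult ennreal_of_nat_eq_real_of_nat)
  also have "\<dots> \<le> ennreal (4 * (2 * of_int \<lceil>\<bar>\<beta>\<bar>\<rceil> + 7) * (of_int q * \<delta> + N * \<bar>of_int q * \<beta> - of_int p\<bar>))"
  proof (rule ennreal_leI)
    have regroup: "(2 * a) * b * (2 * d) = 4 * b * (a * d)" for a b d :: real by (simp add: algebra_simps)
    have "real (card ?K) = (2 * of_int q - 1) * (2 * of_int \<lceil>\<bar>\<beta>\<bar>\<rceil> + 7)"
      using q c0 by (simp add: card_cartesian_product)
    also have "\<dots> \<le> (2 * of_int q) * (2 * of_int \<lceil>\<bar>\<beta>\<bar>\<rceil> + 7)" using c0 by (intro mult_right_mono) auto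
    finally have "real (card ?K) * (2 * ?\<Delta>) \<le> (2 * of_int q) * (2 * of_int \<lceil>\<bar>\<beta>\<bar>\<rceil> + 7) * (2 * ?\<Delta>)"
      using \<Delta> by (intro mult_right_mono) auto
    also have "\<dots> = 4 * (2 * of_int \<lceil>\<bar>\<beta>\<bar>\<rceil> + 7) * (of_int q * ?\<Delta>)"
      by (rule regroup)
    also have "of_int q * ?\<Delta> = of_int q * \<delta> + N * \<bar>of_int q * \<beta> - of_int p\<bar>" using q by (simp add: distrib_left)
    finally show "real (card ?K) * (2 * ?\<Delta>) \<le> 4 * (2 * of_int \<lceil>\<bar>\<beta>\<bar>\<rceil> + 7) * (of_int q * \<delta> + N * \<bar>of_int q * \<beta> - of_int p\<bar>)" .
  qed
  finally show ?thesis .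
qed

text \<open>
  A denominator admits only finitely many numerators.
\<close>

lemma approximations_unbounded:
  fixes \<beta> w :: real
  assumes inf: "infinite {(a :: int, b :: int). b > 0 \<and> coprime a b \<and> \<bar>\<beta> - of_int a / of_int b\<bar> < of_int b powr - (w + 1)}"
    and w: "1 \<le> w"
  shows "\<exists>a b :: int. B \<le> b \<and> 0 < b \<and> \<bar>of_int b * \<beta> - of_int a\<bar> < of_int b powr - w"
proof (rule ccontr)
  assume contra: "\<not> ?thesis"
  let ?S = "{(a :: int, b :: int). b > 0 \<and> coprime a b \<and> \<bar>\<beta> - of_int a / of_int b\<bar> < of_int b powr - (w + 1)}"
  have e: "\<bar>of_int b * \<beta> - of_int a\<bar> < of_int b powr - w" if "0 < b" "\<bar>\<beta> - of_int a / of_int b\<bar> < of_int b powr - (w + 1)" for a b :: int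
  proof -
    have "of_int b * \<beta> - of_int a = of_int b * (\<beta> - of_int a / of_int b)" using that by (simp add: field_simps)
    hence "\<bar>of_int b * \<beta> - of_int a\<bar> = of_int b * \<bar>\<beta> - of_int a / of_int b\<bar>" using that by (simp add: abs_mult)
    also have "\<dots> < of_int b * of_int b powr - (w + 1)" using that by (intro mult_strict_left_mono) auto
    also have "\<dots> = of_int b powr - w" using that powr_add[of "of_int b" 1 "- (w + 1)"] by simp
    finally show ?thesis .
  qed
  have "?S \<subseteq> {- \<lceil>of_int B * \<bar>\<beta>\<bar> + 1\<rceil>..\<lceil>of_int B * \<bar>\<beta>\<bar> + 1\<rceil>} \<times> {0..B}"
  proof
    fix x assume x: "x \<in> ?S"
    obtain a b where ab: "x = (a, b)" by fastforce
    hence b: "0 < b" "\<bar>of_int b * \<beta> - of_int a\<bar> < of_int b powr - w" using x e[of b a] by auto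
    hence "b < B" using contra by (meson not_le)
    have "of_int b powr - w \<le> 1" using b w by (simp add: powr_minus field_simps ge_one_powr_ge_zero)
    hence "\<bar>of_int b * \<beta> - of_int a\<bar> < 1" using b by linarith
    moreover have "\<bar>of_int b * \<beta>\<bar> \<le> of_int B * \<bar>\<beta>\<bar>"
      using b \<open>b < B\<close> by (simp add: abs_mult mult_right_mono)
    ultimately have "\<bar>of_int a :: real\<bar> \<le> of_int B * \<bar>\<beta>\<bar> + 1" by linarith
    hence "a \<in> {- \<lceil>of_int B * \<bar>\<beta>\<bar> + 1\<rceil>..\<lceil>of_int B * \<bar>\<beta>\<bar> + 1\<rceil>}" unfolding atLeastAtMost_iff by linarith
    thus "x \<in> {- \<lceil>of_int B * \<bar>\<beta>\<bar> + 1\<rceil>..\<lceil>of_int B * \<bar>\<beta>\<bar> + 1\<rceil>} \<times> {0..B}" using b \<open>b < B\<close> ab by simp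
  qed
  hence "finite ?S" by (rule finite_subset) auto
  thus False using inf by contradiction
qed

text \<open>
  Take a good approximation \<open>a / b\<close> with exponent \<open>w > v\<close>, and put \<open>r = b\<^bsup>-1-e\<^esup>\<close> and \<open>T = b\<^bsup>w-e\<^esup>\<close>. The area of the
  strips is then of order \<open>b r + (T + 2) \<bar>b \<beta> - a\<bar>\<close>, which is of order \<open>b\<^bsup>-e\<^esup> + b\<^bsup>-w\<^esup>\<close>.
\<close>

lemma rare_scale:
  assumes v: "ereal v < diophantine_type \<beta>" and \<epsilon>: "0 < \<epsilon>" "\<epsilon> \<le> 1"
  shows "\<exists>r T. 0 < r \<and> r < \<epsilon> \<and> r powr - v \<le> T \<and>
    (\<forall>z. emeasure lborel {z' \<in> {0..1} \<times> {0..1}. near_return \<beta> (T + 2) ((1 + \<bar>\<beta>\<bar>) * r) z z'} \<le> ennreal \<epsilon>)"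
proof -
  obtain w where w: "1 \<le> w" "v < w"
    and inf: "infinite {(a :: int, b :: int). b > 0 \<and> coprime a b \<and> \<bar>\<beta> - of_int a / of_int b\<bar> < of_int b powr - (w + 1)}"
    using v unfolding diophantine_type_def less_Sup_iff by auto
  \<comment> \<open>With this \<open>e\<close> one has \<open>v (1 + e) \<le> w - e\<close>, that is, \<open>r\<^bsup>-v\<^esup> \<le> T\<close>.\<close>
  define e where "e = (w - v) / (2 + \<bar>v\<bar>)"
  have e: "0 < e" using w by (simp add: e_def)
  have "e * (1 + v) \<le> e * (2 + \<bar>v\<bar>)" using e by (intro mult_left_mono) auto
  also have "\<dots> = w - v" by (simp add: e_def)
  finally have ev: "v * (1 + e) \<le> w - e" by (simp add: algebra_simps)
  define M where "M = 4 * (2 * real_of_int \<lceil>\<bar>\<beta>\<bar>\<rceil> + 7)"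
  have "1 \<le> 4 * (2 * x + 7)" if "0 \<le> x" for x :: real using that by simp
  hence M: "1 \<le> M" unfolding M_def by simp
  have lim: "((\<lambda>x::real. M * ((1 + \<bar>\<beta>\<bar>) * x powr - e + (x powr - e + 2 * x powr - w))) \<longlongrightarrow> M * ((1 + \<bar>\<beta>\<bar>) * 0 + (0 + 2 * 0))) at_top"
    using e w by (intro tendsto_intros tendsto_neg_powr filterlim_ident) auto
  hence "\<forall>\<^sub>F x in at_top. M * ((1 + \<bar>\<beta>\<bar>) * x powr - e + (x powr - e + 2 * x powr - w)) < \<epsilon>"
    using \<epsilon> by (auto dest: order_tendstoD(2)[where a = \<epsilon>])
  moreover have "((\<lambda>x::real. x powr - (1 + e)) \<longlongrightarrow> 0) at_top" using e by (intro tendsto_neg_powr filterlim_ident) auto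
  hence "\<forall>\<^sub>F x in at_top. x powr - (1 + e) < \<epsilon>" using \<epsilon> by (auto dest: order_tendstoD(2)[where a = \<epsilon>])
  ultimately have "\<forall>\<^sub>F x::real in at_top. M * ((1 + \<bar>\<beta>\<bar>) * x powr - e + (x powr - e + 2 * x powr - w)) < \<epsilon> \<and> x powr - (1 + e) < \<epsilon>"
    by eventually_elim auto
  then obtain B where B: "\<And>x. B \<le> x \<Longrightarrow> M * ((1 + \<bar>\<beta>\<bar>) * x powr - e + (x powr - e + 2 * x powr - w)) < \<epsilon> \<and> x powr - (1 + e) < \<epsilon>"
    unfolding eventually_at_top_linorder by blast
  obtain a b :: int where b: "\<lceil>B\<rceil> \<le> b" "0 < b" "\<bar>of_int b * \<beta> - of_int a\<bar> < of_int b powr - w"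
    using approximations_unbounded[OF inf w(1)] by blast
  define x where "x = real_of_int b"
  have x: "1 \<le> x" "B \<le> x" using b by (auto simp: x_def ceiling_le_iff)
  define r where "r = x powr - (1 + e)"
  define T where "T = x powr (w - e)"
  let ?\<delta> = "(1 + \<bar>\<beta>\<bar>) * r" and ?\<eta> = "\<bar>of_int b * \<beta> - of_int a\<bar>"
  have total: "of_int b * ?\<delta> + (T + 2) * ?\<eta> \<le> (1 + \<bar>\<beta>\<bar>) * x powr - e + (x powr - e + 2 * x powr - w)"
  proof -
    have "x * r = x powr - e" using x powr_add[of x 1 "- (1 + e)"] by (simp add: r_def)
    hence 1: "of_int b * ?\<delta> = (1 + \<bar>\<beta>\<bar>) * x powr - e" unfolding x_def by (metis mult.left_commute)
    have "(T + 2) * ?\<eta> \<le> (T + 2) * x powr - w" using b by (intro mult_left_mono) (auto simp: T_def x_def)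
    also have "\<dots> = x powr - e + 2 * x powr - w" using x by (simp add: T_def distrib_right powr_add[symmetric])
    finally show ?thesis unfolding 1 by (rule add_left_mono)
  qed
  have small: "M * (of_int b * ?\<delta> + (T + 2) * ?\<eta>) < \<epsilon>"
  proof -
    have "M * (of_int b * ?\<delta> + (T + 2) * ?\<eta>) \<le> M * ((1 + \<bar>\<beta>\<bar>) * x powr - e + (x powr - e + 2 * x powr - w))"
      using total M by (intro mult_left_mono) auto
    also have "\<dots> < \<epsilon>" using B[OF x(2)] by blast
    finally show ?thesis .
  qed
  have nn: "0 \<le> of_int b * ?\<delta> + (T + 2) * ?\<eta>" using x by (auto simp: r_def T_def x_def[symmetric])
  have "?\<delta> + (T + 2) / of_int b * ?\<eta> = (of_int b * ?\<delta> + (T + 2) * ?\<eta>) / of_int b"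
  proof -
    have "d + t / y * h = (y * d + t * h) / y" if "y \<noteq> 0" for d t y h :: real
      using that by (simp add: field_simps)
    thus ?thesis using b(2) by simp
  qed
  also have "\<dots> \<le> (of_int b * ?\<delta> + (T + 2) * ?\<eta>) / 1" using nn b(2) by (intro divide_left_mono) auto
  also have "\<dots> \<le> M * (of_int b * ?\<delta> + (T + 2) * ?\<eta>)" using nn M mult_right_mono[of 1 M "of_int b * ?\<delta> + (T + 2) * ?\<eta>"] by simp
  also have "\<dots> \<le> 1" using small \<epsilon> by simp
  finally have le1: "?\<delta> + (T + 2) / of_int b * ?\<eta> \<le> 1" .
  have bound: "emeasure lborel {z' \<in> {0..1} \<times> {0..1}. near_return \<beta> (T + 2) ?\<delta> z z'} \<le> ennreal \<epsilon>" for z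
  proof -
    have "emeasure lborel {z' \<in> {0..1} \<times> {0..1}. near_return \<beta> (T + 2) ?\<delta> z z'} \<le> ennreal (M * (of_int b * ?\<delta> + (T + 2) * ?\<eta>))"
      unfolding M_def by (rule near_return_measure[OF b(2) le1]) (auto simp: r_def T_def)
    also have "\<dots> \<le> ennreal \<epsilon>" using small by (intro ennreal_leI) auto
    finally show ?thesis .
  qed
  have "r powr - v = x powr (v * (1 + e))" using x by (simp add: r_def powr_powr algebra_simps)
  also have "\<dots> \<le> T" unfolding T_def using x ev by (intro powr_mono) auto
  finally have "r powr - v \<le> T" .
  moreover have "0 < r" "r < \<epsilon>" using x B[OF x(2)] by (auto simp: r_def)
  ultimately show ?thesis using bound by blast
qed

section \<open>Almost every pair of points\<close>

lemma AE_not_on_line: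
  assumes "a \<noteq> 0"
  shows "AE z in lborel. a \<bullet> (z :: real \<times> real) \<noteq> b"
proof -
  have "negligible {z. a \<bullet> z = b}" using assms by (intro negligible_hyperplane) auto
  hence "{z. a \<bullet> z = b} \<in> null_sets lebesgue" by (simp add: negligible_iff_null_sets)
  moreover have "{z. a \<bullet> z = b} \<in> sets lborel" using closed_hyperplane[of a b] by simp
  ultimately have "{z. a \<bullet> z = b} \<in> null_sets lborel" by (simp add: null_sets_completion_iff)
  from AE_not_in[OF this] show ?thesis by simp
qed

definition open_square :: "(real \<times> real) set" where
  "open_square = {0<..<1} \<times> {0<..<1}"

lemma AE_open_square: "AE z in lborel. z \<in> {0..1} \<times> {0..1} \<longrightarrow> z \<in> open_square"
proof -
  have "AE z :: real \<times> real in lborel. (1, 0) \<bullet> z \<noteq> b" "AE z :: real \<times> real in lborel. (0, 1) \<bullet> z \<noteq> b" for b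
    by (rule AE_not_on_line, simp add: zero_prod_def)+
  from this[of 0] this[of 1]
  show ?thesis
  proof eventually_elim
    case (elim z)
    thus ?case by (cases z) (auto simp: open_square_def inner_prod_def)
  qed
qed

lemma EW_rel_interior:
  assumes "(a, b) \<in> EW_rel" "snd a \<in> open_square" shows "b = a"
proof -
  have no: "snd x \<notin> open_square" if "(x, y) \<in> glue \<or> (y, x) \<in> glue" for x y
    using that by (cases x rule: prod_cases3; cases y rule: prod_cases3) (auto elim!: glue.cases simp: open_square_def)
  have "(a, b) \<in> (glue \<union> glue\<inverse>)\<^sup>*" using assms by (simp add: EW_rel_def)
  thus ?thesis
  proof (induction rule: rtrancl_induct)
    case (step y z)
    from step.hyps(2) have "(y, z) \<in> glue \<or> (z, y) \<in> glue" by auto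
    from no[OF this] assms(2) step.IH show ?case by simp
  qed simp
qed

text \<open>
  Coordinates inside a square are determined by the point of the surface. The value \<open>(0, 0)\<close>, which is
  not in the open square, marks the points on the edges.
\<close>

definition coord :: "EW_point \<Rightarrow> real \<times> real" where
  "coord p = (if \<exists>g. \<exists>z\<in>open_square. p = EW_proj (g, z)
    then SOME z. z \<in> open_square \<and> (\<exists>g. p = EW_proj (g, z)) else (0, 0))"

lemma open_square_subset: "z \<in> open_square \<Longrightarrow> (g, z) \<in> squares"
  by (auto simp: open_square_def squares_def)

lemma coord_EW_proj:
  assumes "(g, z) \<in> squares"
  shows "coord (EW_proj (g, z)) = (if z \<in> open_square then z else (0, 0))"
proof -
  have uniq: "(g', z') = (g, z)" if "z' \<in> open_square" "EW_proj (g, z) = EW_proj (g', z')" for g' z'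
  proof -
    have "((g', z'), (g, z)) \<in> EW_rel"
      using EW_proj_eq_iff[OF open_square_subset[OF that(1)] assms] that(2) by metis
    from EW_rel_interior[OF this] that(1) show ?thesis by simp
  qed
  show ?thesis
  proof (cases "z \<in> open_square")
    case True
    have "(SOME z'. z' \<in> open_square \<and> (\<exists>g'. EW_proj (g, z) = EW_proj (g', z'))) = z"
      by (rule some_equality) (use True uniq in blast)+
    thus ?thesis using True unfolding coord_def by auto
  next
    case False
    hence "\<not> (\<exists>g'. \<exists>z'\<in>open_square. EW_proj (g, z) = EW_proj (g', z'))" using uniq by blast
    thus ?thesis using False unfolding coord_def by simp
  qed
qed

lemma coord_interior:
  assumes "coord p \<in> open_square" obtains g where "p = EW_proj (g, coord p)"
proof -
  have "(0, 0) \<notin> open_square" by (simp add: open_square_def)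
  hence "\<exists>z. z \<in> open_square \<and> (\<exists>g. p = EW_proj (g, z))" using assms unfolding coord_def by (auto split: if_splits)
  then obtain g z where "z \<in> open_square" "p = EW_proj (g, z)" by blast
  hence "p = EW_proj (g, coord p)" using coord_EW_proj[OF open_square_subset[of z g]] by simp
  thus ?thesis using that by blast
qed

lemma snd_measurable_squares: "snd \<in> measurable squares_measure borel"
proof -
  have "id \<in> measurable (restrict_space lborel ({0..1} \<times> {0..1}) :: (real \<times> real) measure) borel"
    by (rule measurable_restrict_space1) simp
  hence "(\<lambda>a. id (snd a)) \<in> measurable squares_measure borel"
    unfolding squares_measure_def by (rule measurable_compose[OF measurable_snd])
  thus ?thesis by (simp add: id_def)
qed

lemma coord_measurable: "coord \<in> borel_measurable EW_measure"
proof (rule measurableI)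
  fix A :: "(real \<times> real) set" assume A: "A \<in> sets borel"
  let ?f = "\<lambda>a :: quat \<times> real \<times> real. if snd a \<in> open_square then snd a else (0, 0)"
  have o: "open_square \<in> sets borel" unfolding open_square_def by (intro borel_open open_Times) auto
  have "(\<lambda>z. if z \<in> open_square then z else (0, 0)) \<in> borel_measurable borel"
    using o by (intro measurable_If_set) auto
  hence "?f \<in> measurable squares_measure borel"
    using measurable_compose[OF snd_measurable_squares] by blast
  hence "?f -` A \<inter> space squares_measure \<in> sets squares_measure" using A by (rule measurable_sets)
  moreover have "EW_proj -` (coord -` A \<inter> EW) \<inter> squares = ?f -` A \<inter> space squares_measure"
    by (auto simp: space_squares_measure coord_EW_proj simp del: squares_iff split: if_splits)
  ultimately show "coord -` A \<inter> space EW_measure \<in> sets EW_measure"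
    unfolding space_EW_measure sets_EW_measure by simp
qed simp

text \<open>
  The inverse image of the exceptional set in the eight squares is null, as the edges are null.
\<close>

lemma AE_EW_measure:
  assumes "AE z in lborel. z \<in> open_square \<longrightarrow> Q z"
  shows "AE p in EW_measure. coord p \<in> open_square \<and> Q (coord p)"
proof -
  let ?S = "{0..1} \<times> {0..1} :: (real \<times> real) set"
  let ?L = "restrict_space lborel ?S :: (real \<times> real) measure"
  have S: "?S \<in> sets lborel" unfolding sets_lborel by (intro borel_closed closed_Times) auto
  have o: "open_square \<in> sets lborel" unfolding open_square_def sets_lborel by (intro borel_open open_Times) auto
  obtain N where N: "{z \<in> space lborel. \<not> (z \<in> open_square \<longrightarrow> Q z)} \<subseteq> N"
    and N0: "emeasure lborel N = 0" "N \<in> sets lborel" by (rule AE_E[OF assms])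
  obtain N' where N': "{z \<in> space lborel. \<not> (z \<in> ?S \<longrightarrow> z \<in> open_square)} \<subseteq> N'"
    and N0': "emeasure lborel N' = 0" "N' \<in> sets lborel" by (rule AE_E[OF AE_open_square])
  define A where "A = (N \<union> N') \<inter> ?S"
  have A: "A \<in> null_sets lborel" unfolding A_def
    using N0 N0' S by (intro null_set_Int2 null_sets.Un) (auto simp: null_sets_def)
  have eS: "emeasure lborel ?S = 1"
    unfolding lborel_prod[symmetric] by (subst lborel.emeasure_pair_measure_Times) auto
  interpret L: finite_measure ?L
    using S eS by (intro finite_measureI) (simp add: space_restrict_space emeasure_restrict_space)
  have AS: "A \<subseteq> ?S" and AB: "A \<in> sets lborel" "emeasure lborel A = 0"
    using A by (auto simp: A_def null_sets_def)
  have "?S \<inter> A \<in> sets ?L" unfolding sets_restrict_space using AB(1) by (rule imageI)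
  moreover have "?S \<inter> A = A" using AS by blast
  ultimately have AL: "A \<in> sets ?L" by (simp only:)
  have AL0: "emeasure ?L A = 0"
    using emeasure_restrict_space[of ?S lborel A] S AS AB(2) by simp
  have null: "emeasure squares_measure (UNIV \<times> A) = 0" and sets: "UNIV \<times> A \<in> sets squares_measure"
    unfolding squares_measure_def using AL AL0 by (auto simp: L.emeasure_pair_measure_Times)
  define B where "B = (N \<union> - open_square)"
  have B: "B \<in> sets borel" using N0(2) o by (auto simp: B_def)
  have mB: "coord -` B \<inter> EW \<in> sets EW_measure"
    using measurable_sets[OF coord_measurable B] by (simp add: space_EW_measure)
  have "EW_proj -` (coord -` B \<inter> EW) \<inter> squares \<subseteq> UNIV \<times> A"
  proof
    fix a assume a: "a \<in> EW_proj -` (coord -` B \<inter> EW) \<inter> squares"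
    obtain g z where az: "a = (g, z)" by (cases a)
    hence sq: "(g, z) \<in> squares" and c: "coord (EW_proj (g, z)) \<in> B" using a by auto
    have zS: "z \<in> ?S" using sq by (auto simp: squares_def)
    show "a \<in> UNIV \<times> A"
    proof (cases "z \<in> open_square")
      case True
      thus ?thesis using c zS az coord_EW_proj[OF sq] by (auto simp: B_def A_def)
    next
      case False
      hence "z \<in> N'" using zS N' by auto
      thus ?thesis using zS az by (auto simp: A_def)
    qed
  qed
  hence "emeasure squares_measure (EW_proj -` (coord -` B \<inter> EW) \<inter> squares) \<le> emeasure squares_measure (UNIV \<times> A)"
    using sets by (rule emeasure_mono)
  hence "coord -` B \<inter> EW \<in> null_sets EW_measure"
    using mB null by (simp add: null_sets_def emeasure_EW_measure)
  from AE_not_in[OF this] AE_space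
  show ?thesis
  proof eventually_elim
    case (elim p)
    hence "coord p \<notin> B" by (simp add: space_EW_measure)
    hence "coord p \<in> open_square" "coord p \<notin> N" by (auto simp: B_def)
    thus ?case using N by auto
  qed
qed

lemma finite_EW_measure: "finite_measure EW_measure"
  by (rule finite_measureI) (simp add: space_EW_measure emeasure_EW)

text \<open>
  Along \<open>r n \<rightarrow> 0\<close> the quotient of logarithms is infinitely often at least \<open>ln (T n) / - ln (r n)\<close>, hence at
  least \<open>v\<close>.
\<close>

lemma w_hit_sup_ge:
  assumes rT: "\<And>n::nat. 0 < r n \<and> r n < 1 / (real n + 1) \<and> r n powr - v \<le> T n"
    and often: "\<And>B::nat. \<exists>n\<ge>B. ereal (T n) \<le> hitting_time \<theta> p p' (r n)"
  shows "ereal v \<le> w_hit_sup \<theta> p p'"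
proof (rule ccontr)
  assume "\<not> ?thesis"
  hence "Limsup (at_right 0) (\<lambda>r. log_ereal (hitting_time \<theta> p p' r) / ereal (- ln r)) < ereal v"
    by (simp add: w_hit_sup_def)
  from Limsup_lessD[OF this] obtain b where b: "0 < b" and
    less: "\<And>x. 0 < x \<Longrightarrow> x < b \<Longrightarrow> log_ereal (hitting_time \<theta> p p' x) / ereal (- ln x) < ereal v"
    unfolding eventually_at_right_field by blast
  obtain n where n: "nat \<lceil>1 / b\<rceil> + 1 \<le> n" "ereal (T n) \<le> hitting_time \<theta> p p' (r n)" using often by blast
  have "1 / b \<le> real n + 1" using n(1) by linarith
  hence "1 / (real n + 1) \<le> b" using b by (simp add: field_simps)
  hence rb: "r n < b" using rT[of n] by linarith
  have r: "0 < r n" "r n < 1 / (real n + 1)" "r n powr - v \<le> T n" using rT[of n] by auto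
  have "1 / (real n + 1) \<le> 1" by simp
  hence r1: "r n < 1" using r by linarith
  hence ln: "0 < - ln (r n)" using r by simp
  have pv: "0 < r n powr - v" using r by simp
  hence "- v * ln (r n) \<le> ln (T n)" using r ln_mono[OF r(3) pv] by (simp add: ln_powr)
  hence "v \<le> ln (T n) / - ln (r n)" using ln by (simp add: pos_le_divide_eq del: divide_minus_right)
  hence "ereal v \<le> ereal (ln (T n)) / ereal (- ln (r n))" using ln by simp
  also have "\<dots> \<le> log_ereal (hitting_time \<theta> p p' (r n)) / ereal (- ln (r n))"
    using ln less_le_trans[OF pv r(3)] n(2) by (intro ereal_divide_right_mono log_ereal_mono) auto
  also have "\<dots> < ereal v" by (rule less[OF r(1) rb])
  finally show False by simp
qed

text \<open>
  The exceptional set is contained in sets of arbitrarily small measure.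
\<close>

lemma AE_rarely_near:
  assumes sm: "\<And>n::nat. emeasure lborel {z' \<in> {0..1} \<times> {0..1}. near_return \<beta> (T n) (\<delta> n) z z'} \<le> ennreal (1 / (real n + 1))"
  shows "AE z' in lborel. z' \<in> open_square \<longrightarrow> (\<exists>n\<ge>B::nat. \<not> near_return \<beta> (T n) (\<delta> n) z z')"
proof (rule AE_I')
  let ?E = "\<lambda>n. {z' \<in> {0..1} \<times> {0..1}. near_return \<beta> (T n) (\<delta> n) z z'}"
  let ?N = "\<Inter>n\<in>{B..}. ?E n"
  have E: "?E n \<in> sets lborel" for n
  proof -
    have "?E n = {z' \<in> space borel. fst z' \<in> {0..1} \<and> snd z' \<in> {0..1} \<and> (\<exists>k m :: int. \<bar>of_int k\<bar> \<le> T n \<and>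
        \<bar>intercept \<beta> z - (fst z' - \<beta> * snd z') + of_int k * \<beta> - of_int m\<bar> < \<delta> n)}"
      unfolding near_return_def intercept_def by auto
    also have "\<dots> \<in> sets (borel \<Otimes>\<^sub>M borel)" unfolding borel_prod[symmetric] by measurable
    finally show ?thesis unfolding borel_prod sets_lborel .
  qed
  have N: "?N \<in> sets lborel" using E by (intro sets.countable_INT') auto
  have "emeasure lborel ?N \<le> ennreal \<epsilon>" if "0 < \<epsilon>" for \<epsilon>
  proof -
    define n where "n = max B (nat \<lceil>1 / \<epsilon>\<rceil>)"
    have "1 / \<epsilon> \<le> real n + 1" unfolding n_def by linarith
    hence "1 / (real n + 1) \<le> \<epsilon>" using that by (simp add: field_simps)
    moreover have "emeasure lborel ?N \<le> emeasure lborel (?E n)" by (rule emeasure_mono[OF _ E]) (auto simp: n_def)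
    ultimately show ?thesis using sm[of n] by (meson ennreal_leI order_trans)
  qed
  hence "emeasure lborel ?N \<le> 0 + ennreal \<epsilon>" if "0 < \<epsilon>" for \<epsilon> using that by (simp only: add_0)
  hence "emeasure lborel ?N \<le> 0" by (rule ennreal_le_epsilon)
  hence "emeasure lborel ?N = 0" by (simp only: le_zero_eq)
  thus "?N \<in> null_sets lborel" using N unfolding null_sets_def by blast
  show "{z' \<in> space lborel. \<not> (z' \<in> open_square \<longrightarrow> (\<exists>n\<ge>B. \<not> near_return \<beta> (T n) (\<delta> n) z z'))} \<subseteq> ?N"
    by (auto simp: open_square_def)
qed

theorem proposition2p5:
  fixes \<theta> :: real
  assumes "tan \<theta> \<notin> \<rat>"
  shows "AE (p, p') in EW_measure \<Otimes>\<^sub>M EW_measure. w_hit_sup \<theta> p p' = diophantine_type (tan \<theta>)"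
proof -
  interpret irrational_direction \<theta> by unfold_locales (rule assms)
  interpret E: finite_measure EW_measure by (rule finite_EW_measure)
  interpret EE: pair_sigma_finite EW_measure EW_measure ..
  let ?\<beta> = "tan \<theta>"
  let ?\<tau> = "diophantine_type ?\<beta>"
  define scale where "scale v n x \<longleftrightarrow> 0 < fst x \<and> fst x < 1 / (real n + 1) \<and> fst x powr - v \<le> snd x \<and>
      (\<forall>z. emeasure lborel {z' \<in> {0..1} \<times> {0..1}. near_return ?\<beta> (snd x + 2) ((1 + \<bar>?\<beta>\<bar>) * fst x) z z'}
        \<le> ennreal (1 / (real n + 1)))" for v :: real and n :: nat and x
  have "\<exists>x. ereal v < ?\<tau> \<longrightarrow> scale v n x" for v n
  proof (cases "ereal v < ?\<tau>")
    case True
    obtain r T where "0 < r \<and> r < 1 / (real n + 1) \<and> r powr - v \<le> T \<and>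
      (\<forall>z. emeasure lborel {z' \<in> {0..1} \<times> {0..1}. near_return ?\<beta> (T + 2) ((1 + \<bar>?\<beta>\<bar>) * r) z z'}
        \<le> ennreal (1 / (real n + 1)))"
      using rare_scale[OF True, of "1 / (real n + 1)"] by auto
    hence "scale v n (r, T)" unfolding scale_def fst_conv snd_conv .
    thus ?thesis by blast
  qed simp
  hence "\<exists>rT. \<forall>v n. ereal v < ?\<tau> \<longrightarrow> scale v n (rT v n)" by metis
  then obtain rT where scale: "\<And>v n. ereal v < ?\<tau> \<Longrightarrow> scale v n (rT v n)" by blast
  hence rT: "\<And>v n. ereal v < ?\<tau> \<Longrightarrow>
      0 < fst (rT v n) \<and> fst (rT v n) < 1 / (real n + 1) \<and> fst (rT v n) powr - v \<le> snd (rT v n)"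
    unfolding scale_def by blast
  have rare: "\<And>v n z. ereal v < ?\<tau> \<Longrightarrow>
      emeasure lborel {z' \<in> {0..1} \<times> {0..1}. near_return ?\<beta> (snd (rT v n) + 2) ((1 + \<bar>?\<beta>\<bar>) * fst (rT v n)) z z'}
        \<le> ennreal (1 / (real n + 1))"
    using scale unfolding scale_def by blast
  \<comment> \<open>The flow line of a generic point misses the corners; this gives the upper bound. Points
      that are far from each other at infinitely many scales, for every rational exponent \<open>v\<close> below
      the type, give the lower bound.\<close>
  define generic where "generic z \<longleftrightarrow> (\<forall>m k :: int. reflx (fst z) - refly (snd z) * \<alpha> + of_int m * \<alpha> \<noteq> of_int k)" for z :: "real \<times> real"
  define far where "far z z' \<longleftrightarrow> (\<forall>v::rat. ereal (of_rat v) < ?\<tau> \<longrightarrow> (\<forall>B::nat. \<exists>n\<ge>B.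
      \<not> near_return ?\<beta> (snd (rT (of_rat v) n) + 2) ((1 + \<bar>?\<beta>\<bar>) * fst (rT (of_rat v) n)) z z'))" for z z'
  have gen: "AE z in lborel. z \<in> open_square \<longrightarrow> generic z"
  proof -
    have "AE z in lborel. reflx (fst z) - refly (snd z) * \<alpha> + of_int m * \<alpha> \<noteq> of_int k" for m k :: int
    proof -
      define s where "s = (if 0 < sin \<theta> then 1 else - 1 :: real)"
      define s' where "s' = (if 0 < cos \<theta> then 1 else - 1 :: real)"
      define x0 where "x0 = (if 0 < sin \<theta> then 0 else 1 :: real)"
      define y0 where "y0 = (if 0 < cos \<theta> then 0 else 1 :: real)"
      have "(s, - s' * \<alpha>) \<noteq> 0" by (simp add: s_def zero_prod_def)
      from AE_not_on_line[OF this, of "of_int k - of_int m * \<alpha> - x0 + y0 * \<alpha>"] show ?thesis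
      proof eventually_elim
        case (elim z)
        have "reflx (fst z) = x0 + s * fst z" "refly (snd z) = y0 + s' * snd z"
          by (simp_all add: reflx_def refly_def x0_def y0_def s_def s'_def)
        thus ?case using elim by (simp add: inner_prod_def algebra_simps)
      qed
    qed
    hence "AE z in lborel. generic z" unfolding generic_def by (simp add: AE_all_countable)
    thus ?thesis by eventually_elim simp
  qed
  have far: "AE z' in lborel. z' \<in> open_square \<longrightarrow> far z z'" for z
  proof -
    have "AE z' in lborel. z' \<in> open_square \<longrightarrow> ereal (of_rat v) < ?\<tau> \<longrightarrow> (\<exists>n\<ge>B.
      \<not> near_return ?\<beta> (snd (rT (of_rat v) n) + 2) ((1 + \<bar>?\<beta>\<bar>) * fst (rT (of_rat v) n)) z z')" for v :: rat and B :: nat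
    proof (cases "ereal (of_rat v) < ?\<tau>")
      case True
      from AE_rarely_near[where T = "\<lambda>n. snd (rT (of_rat v) n) + 2" and \<delta> = "\<lambda>n. (1 + \<bar>?\<beta>\<bar>) * fst (rT (of_rat v) n)", OF rare[OF True], of B]
      show ?thesis by eventually_elim blast
    qed simp
    hence "AE z' in lborel. \<forall>v B. z' \<in> open_square \<longrightarrow> ereal (of_rat v) < ?\<tau> \<longrightarrow> (\<exists>n\<ge>B.
      \<not> near_return ?\<beta> (snd (rT (of_rat v) n) + 2) ((1 + \<bar>?\<beta>\<bar>) * fst (rT (of_rat v) n)) z z')"
      unfolding AE_all_countable by (intro allI)
    thus ?thesis by eventually_elim (auto simp: far_def)
  qed
  have eq: "w_hit_sup \<theta> p p' = ?\<tau>"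
    if p: "coord p \<in> open_square" and p': "coord p' \<in> open_square" and g: "generic (coord p)" and f: "far (coord p) (coord p')" for p p'
  proof (rule antisym)
    obtain g where pg: "p = EW_proj (g, coord p)" using coord_interior[OF p] .
    obtain h where ph: "p' = EW_proj (h, coord p')" using coord_interior[OF p'] .
    have sq: "(g, coord p) \<in> squares" "(h, coord p') \<in> squares" using p p' open_square_subset by auto
    show "w_hit_sup \<theta> p p' \<le> ?\<tau>"
    proof (rule ccontr)
      assume "\<not> ?thesis"
      hence "?\<tau> < w_hit_sup \<theta> p p'" by (simp only: not_le)
      then obtain w where w: "?\<tau> < ereal w" "ereal w < w_hit_sup \<theta> p p'" using ereal_dense2 by blast
      obtain d where d: "badly_approx d w" using badly_approx_above_type[OF w(1)] by blast
      let ?u = "reflx (fst (coord p))" and ?v = "refly (snd (coord p))"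
      let ?u' = "reflx (fst (coord p'))" and ?v' = "refly (snd (coord p'))"
      have chart: "p = chart g ?u ?v" "p' = chart h ?u' ?v'"
        using pg ph by (auto simp: chart_def reflx_def refly_def)
      have "0 < ?u" "?u < 1" "0 < ?v" "?v < 1" "0 < ?u'" "?u' < 1" "0 < ?v'" "?v' < 1"
        using p p' by (auto simp: open_square_def reflx_def refly_def mem_Times_iff)
      from hitting_time_upper[OF this(1-4) _ this(5-8) d, of g h] g
      obtain C where "0 < C" "\<forall>\<^sub>F r in at_right 0. hitting_time \<theta> p p' r \<le> ereal (C * r powr - w)"
        unfolding generic_def chart[symmetric] by blast
      hence "w_hit_sup \<theta> p p' \<le> ereal w" by (rule w_hit_sup_le)
      thus False using w(2) leD by blast
    qed
    show "?\<tau> \<le> w_hit_sup \<theta> p p'"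
    proof (rule ccontr)
      assume "\<not> ?thesis"
      hence "w_hit_sup \<theta> p p' < ?\<tau>" by (simp only: not_le)
      then obtain v :: rat where v: "w_hit_sup \<theta> p p' < ereal (of_rat v)" "ereal (of_rat v) < ?\<tau>"
        using ereal_dense3 by blast
      have "ereal (of_rat v) \<le> w_hit_sup \<theta> p p'"
      proof (rule w_hit_sup_ge)
        show "0 < fst (rT (of_rat v) n) \<and> fst (rT (of_rat v) n) < 1 / (real n + 1) \<and> fst (rT (of_rat v) n) powr - of_rat v \<le> snd (rT (of_rat v) n)" for n
          using rT[OF v(2)] .
        fix B :: nat
        obtain n where n: "B \<le> n" "\<not> near_return ?\<beta> (snd (rT (of_rat v) n) + 2) ((1 + \<bar>?\<beta>\<bar>) * fst (rT (of_rat v) n)) (coord p) (coord p')"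
          using f v(2) unfolding far_def by blast
        have "1 / (real n + 1) \<le> 1" by simp
        hence "0 < fst (rT (of_rat v) n)" "fst (rT (of_rat v) n) \<le> 1" using rT[OF v(2), of n] by linarith+
        from hitting_time_lower[OF direction_nz(1) pg sq(1) ph sq(2) this n(2)] n(1)
        show "\<exists>n\<ge>B. ereal (snd (rT (of_rat v) n)) \<le> hitting_time \<theta> p p' (fst (rT (of_rat v) n))" by blast
      qed
      thus False using v(1) leD by blast
    qed
  qed
  define W where "W = (\<lambda>x. (coord (fst x) \<in> open_square \<and> generic (coord (fst x))) \<and> coord (snd x) \<in> open_square \<and> far (coord (fst x)) (coord (snd x)))"
  have "AE x in EW_measure \<Otimes>\<^sub>M EW_measure. W x"
  proof (rule EE.AE_pair_measure)
    show "AE p in EW_measure. AE p' in EW_measure. W (p, p')"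
      using AE_EW_measure[OF gen]
    proof eventually_elim
      case (elim p)
      from AE_EW_measure[OF far[of "coord p"]] show ?case
        by eventually_elim (use elim in \<open>simp add: W_def\<close>)
    qed
    have c: "(\<lambda>x. coord (fst x)) \<in> borel_measurable (EW_measure \<Otimes>\<^sub>M EW_measure)"
      "(\<lambda>x. coord (snd x)) \<in> borel_measurable (EW_measure \<Otimes>\<^sub>M EW_measure)"
      using coord_measurable by measurable
    have [measurable]: "(\<lambda>x. fst (coord (fst x))) \<in> borel_measurable (EW_measure \<Otimes>\<^sub>M EW_measure)"
      "(\<lambda>x. snd (coord (fst x))) \<in> borel_measurable (EW_measure \<Otimes>\<^sub>M EW_measure)"
      "(\<lambda>x. fst (coord (snd x))) \<in> borel_measurable (EW_measure \<Otimes>\<^sub>M EW_measure)"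
      "(\<lambda>x. snd (coord (snd x))) \<in> borel_measurable (EW_measure \<Otimes>\<^sub>M EW_measure)"
      using c unfolding borel_prod[symmetric] by measurable
    have [measurable]: "reflx \<in> borel_measurable borel" "refly \<in> borel_measurable borel"
      unfolding reflx_def refly_def by measurable
    have "Measurable.pred (EW_measure \<Otimes>\<^sub>M EW_measure) W"
      unfolding W_def generic_def far_def near_return_def intercept_def open_square_def mem_Times_iff
      by measurable
    thus "{x \<in> space (EW_measure \<Otimes>\<^sub>M EW_measure). W x} \<in> sets (EW_measure \<Otimes>\<^sub>M EW_measure)"
      by (rule predE)
  qed
  thus ?thesis
  proof eventually_elim
    case (elim x)
    thus ?case using eq[of "fst x" "snd x"] by (auto simp: W_def split_beta)
  qed
qed

end
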